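(* Let $\mathcal E\subset J^r\pi$ be a regular equation of codimension $q$, and let $\mathcal G^r_\pi=\ker T\pi_{r,r-1}$. Then $\mathcal E$ can be locally written in normal form with respect to $q$ highest-order jet coordinates if and only if $$T\mathcal E+\mathcal G^r_\pi=TJ^r\pi|_{\mathcal E}.$$ Equivalently, for any local defining map $F=(F^1,\dots,F^q)$ of $\mathcal E$, the vertical symbol $\sigma_{\mathcal E}:=dF|_{\mathcal G^r_\pi|_{\mathcal E}}$ has rank $q$. In this case, the residual polarisation of the equation is $\mathcal G^r_{\mathcal E}=T\mathcal E\cap\mathcal G^r_\pi=\ker\sigma_{\mathcal E}$. In particular, if $q=\operatorname{rank}\mathcal G^r_\pi$, then $\mathcal E$ is locally the graph of a section of $\pi_{r,r-1}:J^r\pi\to J^{r-1}\pi$ if and only if $T\mathcal E\cap\mathcal G^r_\pi=0$.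
   Context: $\pi:E\to Q$ is a fibred manifold, $r\ge1$, $J^r\pi$ its $r$-th jet bundle ($J^0\pi=E$), $\pi_{r,s}:J^r\pi\to J^s\pi$ the projections; $(x^i,u^\alpha_I)_{|I|\le r}$ are adapted jet coordinates; the highest-order ones are $u^\alpha_K$ with $|K|=r$. An equation of order $r$ and codimension $q$ is an embedded submanifold $\mathcal E\subset J^r\pi$ locally given as $F^{-1}(0)$ with $F=(F^1,\dots,F^q)$ having independent differentials along $\mathcal E$; it is regular if $T\mathcal E\cap\mathcal C^r_\pi$ has constant rank, $\mathcal C^r_\pi$ being the Cartan distribution (common kernel of the contact forms $du^\alpha_I-\sum_iu^\alpha_{I+\widehat e_i}dx^i$, $|I|\le r-1$). "Locally in normal form with respect to $q$ highest-order jet coordinates" means: around every point of $\mathcal E$ there are adapted coordinates and $q$ of the coordinates $u^\alpha_K$, $|K|=r$, such that $\mathcal E$ is locally given by expressing these $q$ coordinates as smooth functions of all the remaining coordinates. $\sigma_{\mathcal E}:\mathcal G^r_\pi|_{\mathcal E}\to\mathbb R^q$ is the restriction of $dF$. *)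

theory Defs
  imports "HOL-Analysis.Analysis" "HOL-Library.Multiset"
begin

section \<open>Smooth maps between Euclidean spaces\<close>

text \<open>For open \<open>S\<close> and finite-dimensional domain, \<open>Ck_on k S f\<close> says that \<open>f\<close> is of class \<open>C\<close>
  to the \<open>k\<close> on \<open>S\<close>: all iterated directional derivatives up to order \<open>k\<close> exist and are continuous.\<close>

primrec Ck_on :: "nat \<Rightarrow> 'a::real_normed_vector set \<Rightarrow> ('a \<Rightarrow> 'b::real_normed_vector) \<Rightarrow> bool" where
  "Ck_on 0 S f \<longleftrightarrow> continuous_on S f"
| "Ck_on (Suc k) S f \<longleftrightarrow> (\<forall>x\<in>S. f differentiable (at x)) \<and>
     (\<forall>v. Ck_on k S (\<lambda>x. frechet_derivative f (at x) v))"

definition smooth_on :: "'a::real_normed_vector set \<Rightarrow> ('a \<Rightarrow> 'b::real_normed_vector) \<Rightarrow> bool" where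
  "smooth_on S f \<longleftrightarrow> (\<forall>k. Ck_on k S f)"

section \<open>Charts, atlases and smooth manifolds\<close>

text \<open>A chart is a pair of its domain and a coordinate map; the values of the coordinate map
  outside the domain are irrelevant. A manifold is given by its set of charts; its points are
  those covered by some chart, so no topology on the type of points is presupposed.\<close>

type_synonym ('p, 'a) chart = "'p set \<times> ('p \<Rightarrow> 'a)"

abbreviation dom_ch :: "('p, 'a) chart \<Rightarrow> 'p set" where
  "dom_ch c \<equiv> fst c"

abbreviation coord :: "('p, 'a) chart \<Rightarrow> 'p \<Rightarrow> 'a" where
  "coord c \<equiv> snd c"

definition param :: "('p, 'a) chart \<Rightarrow> 'a \<Rightarrow> 'p" where
  "param c = inv_into (dom_ch c) (coord c)"

definition carrier_of :: "('p, 'a) chart set \<Rightarrow> 'p set" where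
  "carrier_of A = (\<Union>c\<in>A. dom_ch c)"

definition is_chart :: "('p, 'a::euclidean_space) chart \<Rightarrow> bool" where
  "is_chart c \<longleftrightarrow> inj_on (coord c) (dom_ch c) \<and> open (coord c ` dom_ch c)"

definition compatible_charts ::
  "('p, 'a::euclidean_space) chart \<Rightarrow> ('p, 'a) chart \<Rightarrow> bool" where
  "compatible_charts c d \<longleftrightarrow>
     open (coord c ` (dom_ch c \<inter> dom_ch d)) \<and> open (coord d ` (dom_ch c \<inter> dom_ch d)) \<and>
     smooth_on (coord c ` (dom_ch c \<inter> dom_ch d)) (coord d \<circ> param c) \<and>
     smooth_on (coord d ` (dom_ch c \<inter> dom_ch d)) (coord c \<circ> param d)"

definition atlas_open :: "('p, 'a::euclidean_space) chart set \<Rightarrow> 'p set \<Rightarrow> bool" where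
  "atlas_open A W \<longleftrightarrow> W \<subseteq> carrier_of A \<and> (\<forall>c\<in>A. open (coord c ` (W \<inter> dom_ch c)))"

lemma istopology_atlas_open:
  assumes "\<And>c. c \<in> A \<Longrightarrow> is_chart c"
  shows "istopology (atlas_open A)"
proof -
  have "atlas_open A (S \<inter> T)" if S: "atlas_open A S" and T: "atlas_open A T" for S T
  proof -
    have "open (coord c ` (S \<inter> T \<inter> dom_ch c))" if c: "c \<in> A" for c
    proof -
      have "coord c ` (S \<inter> T \<inter> dom_ch c) = coord c ` (S \<inter> dom_ch c) \<inter> coord c ` (T \<inter> dom_ch c)"
        using assms[OF c] unfolding is_chart_def inj_on_def by blast
      then show ?thesis using S T c by (simp add: atlas_open_def open_Int)
    qed
    then show ?thesis using S by (auto simp: atlas_open_def)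
  qed
  moreover have "atlas_open A (\<Union>\<K>)" if K: "\<forall>S\<in>\<K>. atlas_open A S" for \<K>
  proof -
    have "open (coord c ` (\<Union>\<K> \<inter> dom_ch c))" if c: "c \<in> A" for c
    proof -
      have "coord c ` (\<Union>\<K> \<inter> dom_ch c) = (\<Union>S\<in>\<K>. coord c ` (S \<inter> dom_ch c))" by blast
      then show ?thesis using K c by (auto simp: atlas_open_def)
    qed
    then show ?thesis using K by (auto simp: atlas_open_def)
  qed
  ultimately show ?thesis unfolding istopology_def by blast
qed

text \<open>The set of charts is a maximal atlas and the underlying topological space is Hausdorff and
  second countable.\<close>

definition smooth_manifold :: "('p, 'a::euclidean_space) chart set \<Rightarrow> bool" where
  "smooth_manifold A \<longleftrightarrow>
     (\<forall>c\<in>A. is_chart c) \<and> (\<forall>c\<in>A. \<forall>d\<in>A. compatible_charts c d) \<and>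
     (\<forall>c. is_chart c \<and> dom_ch c \<subseteq> carrier_of A \<and> (\<forall>d\<in>A. compatible_charts c d) \<longrightarrow> c \<in> A) \<and>
     Hausdorff_space (topology (atlas_open A)) \<and> second_countable (topology (atlas_open A))"

definition euclid :: "('a, 'a::euclidean_space) chart set" where
  "euclid = {(UNIV, \<lambda>x. x)}"

definition smooth_map :: "('p, 'a::euclidean_space) chart set \<Rightarrow> ('r, 'c::euclidean_space) chart set
    \<Rightarrow> 'p set \<Rightarrow> ('p \<Rightarrow> 'r) \<Rightarrow> bool" where
  "smooth_map A B W f \<longleftrightarrow> (\<forall>p\<in>W. \<exists>c\<in>A. \<exists>d\<in>B. \<exists>N. atlas_open A N \<and>
     p \<in> N \<and> N \<subseteq> W \<inter> dom_ch c \<and> f ` N \<subseteq> dom_ch d \<and>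
     smooth_on (coord c ` N) (coord d \<circ> f \<circ> param c))"

section \<open>Tangent spaces\<close>

text \<open>A tangent vector at \<open>p\<close> is the family of its component vectors in all charts around \<open>p\<close>,
  transforming by the derivatives of the coordinate changes, and extended by \<open>0\<close> to all other
  charts; vector space operations are pointwise.\<close>

type_synonym ('p, 'a) tvec = "('p, 'a) chart \<Rightarrow> 'a"

definition charts_at :: "('p, 'a) chart set \<Rightarrow> 'p \<Rightarrow> ('p, 'a) chart set" where
  "charts_at A p = {c \<in> A. p \<in> dom_ch c}"

definition zero_tvec :: "('p, 'a::euclidean_space) tvec" where
  "zero_tvec = (\<lambda>c. 0)"

definition tangent_space :: "('p, 'a::euclidean_space) chart set \<Rightarrow> 'p \<Rightarrow> ('p, 'a) tvec set" where
  "tangent_space A p = {v.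
     (\<forall>c. c \<notin> charts_at A p \<longrightarrow> v c = 0) \<and>
     (\<forall>c\<in>charts_at A p. \<forall>d\<in>charts_at A p.
        v d = frechet_derivative (coord d \<circ> param c) (at (coord c p)) (v c))}"

definition tvec_sum :: "('p, 'a::euclidean_space) tvec set \<Rightarrow> ('p, 'a) tvec set \<Rightarrow> ('p, 'a) tvec set" where
  "tvec_sum V V' = {v. \<exists>a\<in>V. \<exists>b\<in>V'. v = (\<lambda>c. a c + b c)}"

text \<open>Dimension of a linear subspace of the tangent space at \<open>p\<close>, computed in any chart.\<close>

definition tdim :: "('p, 'a::euclidean_space) chart set \<Rightarrow> 'p \<Rightarrow> ('p, 'a) tvec set \<Rightarrow> nat" where
  "tdim A p V = dim ((\<lambda>v. v (SOME c. c \<in> charts_at A p)) ` V)"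

definition tangent_map :: "('p, 'a::euclidean_space) chart set \<Rightarrow> ('r, 'c::euclidean_space) chart set
    \<Rightarrow> ('p \<Rightarrow> 'r) \<Rightarrow> 'p \<Rightarrow> ('p, 'a) tvec \<Rightarrow> ('r, 'c) tvec" where
  "tangent_map A B f p v = (let c = (SOME c. c \<in> charts_at A p) in
     (\<lambda>d. if d \<in> charts_at B (f p)
          then frechet_derivative (coord d \<circ> f \<circ> param c) (at (coord c p)) (v c) else 0))"

definition differential :: "('p, 'a::euclidean_space) chart set \<Rightarrow> ('p \<Rightarrow> 'c::euclidean_space)
    \<Rightarrow> 'p \<Rightarrow> ('p, 'a) tvec \<Rightarrow> 'c" where
  "differential A F p v = tangent_map A euclid F p v (UNIV, \<lambda>x. x)"

text \<open>Vectors tangent to a subset \<open>S\<close>: velocities at \<open>0\<close> of smooth curves of the ambient manifold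
  running inside \<open>S\<close>. For embedded submanifolds this is the usual tangent space.\<close>

definition tangent_to :: "('p, 'a::euclidean_space) chart set \<Rightarrow> 'p set \<Rightarrow> 'p \<Rightarrow> ('p, 'a) tvec set" where
  "tangent_to A S p = {v. \<exists>\<gamma> \<epsilon>. \<epsilon> > 0 \<and> smooth_map euclid A {-\<epsilon><..<\<epsilon>} \<gamma> \<and>
     \<gamma> ` {-\<epsilon><..<\<epsilon>} \<subseteq> S \<and> \<gamma> (0::real) = p \<and>
     v = (\<lambda>d. if d \<in> charts_at A p then vector_derivative (coord d \<circ> \<gamma>) (at 0) else 0)}"

text \<open>\<open>F\<close> is a defining map of \<open>S\<close> on the open set \<open>W\<close>: there \<open>S\<close> is the zero set of \<open>F\<close>, and the
  differentials of the components of \<open>F\<close> are linearly independent along \<open>S\<close>.\<close>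

definition local_defining_map :: "('p, 'a::euclidean_space) chart set \<Rightarrow> 'p set \<Rightarrow> 'p set
    \<Rightarrow> ('p \<Rightarrow> real^'q) \<Rightarrow> bool" where
  "local_defining_map A S W F \<longleftrightarrow> atlas_open A W \<and> smooth_map A euclid W F \<and>
     S \<inter> W = {p \<in> W. F p = 0} \<and>
     (\<forall>p\<in>S \<inter> W. \<forall>l::'q \<Rightarrow> real.
        (\<forall>v\<in>tangent_space A p. (\<Sum>a\<in>UNIV. l a * differential A F p v $ a) = 0) \<longrightarrow> (\<forall>a. l a = 0))"

section \<open>Fibred manifolds and adapted charts\<close>

definition fibred_manifold :: "('b, real^'n) chart set \<Rightarrow> ('e, (real^'n) \<times> (real^'m)) chart set
    \<Rightarrow> ('e \<Rightarrow> 'b) \<Rightarrow> bool" where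
  "fibred_manifold Q E pr \<longleftrightarrow> smooth_manifold Q \<and> smooth_manifold E \<and>
     smooth_map E Q (carrier_of E) pr \<and> pr ` carrier_of E = carrier_of Q \<and>
     (\<forall>e\<in>carrier_of E. tangent_map E Q pr e ` tangent_space E e = tangent_space Q (pr e))"

text \<open>Adapted coordinates: a chart \<open>b = (x\<^sup>i)\<close> of \<open>Q\<close> and a chart \<open>c\<close> of \<open>E\<close> of the form
  \<open>(x\<^sup>i \<circ> pr, u\<^sup>\<alpha>)\<close>.\<close>

definition adapted :: "('b, real^'n) chart set \<Rightarrow> ('e, (real^'n) \<times> (real^'m)) chart set
    \<Rightarrow> ('e \<Rightarrow> 'b) \<Rightarrow> (('b, real^'n) chart \<times> ('e, (real^'n) \<times> (real^'m)) chart) set" where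
  "adapted Q E pr = {(b, c). b \<in> Q \<and> c \<in> E \<and> pr ` dom_ch c \<subseteq> dom_ch b \<and>
     (\<forall>e\<in>dom_ch c. fst (coord c e) = coord b (pr e))}"

definition local_section :: "('b, real^'n) chart set \<Rightarrow> ('e, (real^'n) \<times> (real^'m)) chart set
    \<Rightarrow> ('e \<Rightarrow> 'b) \<Rightarrow> 'b \<Rightarrow> ('b \<Rightarrow> 'e) \<Rightarrow> bool" where
  "local_section Q E pr x s \<longleftrightarrow> (\<exists>U. atlas_open Q U \<and> x \<in> U \<and> smooth_map Q E U s \<and>
     (\<forall>y\<in>U. pr (s y) = y))"

definition local_rep :: "('b, real^'n) chart \<Rightarrow> ('e, (real^'n) \<times> (real^'m)) chart
    \<Rightarrow> ('b \<Rightarrow> 'e) \<Rightarrow> real^'n \<Rightarrow> real^'m" where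
  "local_rep b c s = (\<lambda>y. snd (coord c (s (param b y))))"

primrec iter_pd :: "'n list \<Rightarrow> (real^'n \<Rightarrow> real^'m) \<Rightarrow> real^'n \<Rightarrow> real^'m" where
  "iter_pd [] f = f"
| "iter_pd (i # js) f = (\<lambda>x. frechet_derivative (iter_pd js f) (at x) (axis i 1))"

section \<open>Jets\<close>

text \<open>A \<open>k\<close>-jet at \<open>x\<close> is the pair of \<open>x\<close> and an equivalence class of local sections around \<open>x\<close>.
  Zero-jets are the points of \<open>E\<close>, via \<open>jet_target\<close>.\<close>

type_synonym ('b, 'e) jet = "'b \<times> ('b \<Rightarrow> 'e) set"

definition same_jet :: "('b, real^'n) chart set \<Rightarrow> ('e, (real^'n) \<times> (real^'m)) chart set
    \<Rightarrow> ('e \<Rightarrow> 'b) \<Rightarrow> nat \<Rightarrow> 'b \<Rightarrow> ('b \<Rightarrow> 'e) \<Rightarrow> ('b \<Rightarrow> 'e) \<Rightarrow> bool" where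
  "same_jet Q E pr k x s s' \<longleftrightarrow> s x = s' x \<and>
     (\<forall>(b, c)\<in>adapted Q E pr. s x \<in> dom_ch c \<longrightarrow>
        (\<forall>js. length js \<le> k \<longrightarrow>
           iter_pd js (local_rep b c s) (coord b x) = iter_pd js (local_rep b c s') (coord b x)))"

definition jet :: "('b, real^'n) chart set \<Rightarrow> ('e, (real^'n) \<times> (real^'m)) chart set
    \<Rightarrow> ('e \<Rightarrow> 'b) \<Rightarrow> nat \<Rightarrow> 'b \<Rightarrow> ('b \<Rightarrow> 'e) \<Rightarrow> ('b, 'e) jet" where
  "jet Q E pr k x s = (x, {s'. local_section Q E pr x s' \<and> same_jet Q E pr k x s s'})"

definition jets :: "('b, real^'n) chart set \<Rightarrow> ('e, (real^'n) \<times> (real^'m)) chart set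
    \<Rightarrow> ('e \<Rightarrow> 'b) \<Rightarrow> nat \<Rightarrow> ('b, 'e) jet set" where
  "jets Q E pr k = {jet Q E pr k x s | x s. x \<in> carrier_of Q \<and> local_section Q E pr x s}"

definition jet_rep :: "('b, 'e) jet \<Rightarrow> 'b \<Rightarrow> 'e" where
  "jet_rep \<theta> = (SOME s. s \<in> snd \<theta>)"

definition jet_target :: "('b, 'e) jet \<Rightarrow> 'e" where
  "jet_target \<theta> = jet_rep \<theta> (fst \<theta>)"

text \<open>The projection of jets of order at least \<open>l\<close> to \<open>l\<close>-jets.\<close>

definition jet_proj :: "('b, real^'n) chart set \<Rightarrow> ('e, (real^'n) \<times> (real^'m)) chart set
    \<Rightarrow> ('e \<Rightarrow> 'b) \<Rightarrow> nat \<Rightarrow> ('b, 'e) jet \<Rightarrow> ('b, 'e) jet" where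
  "jet_proj Q E pr l \<theta> = jet Q E pr l (fst \<theta>) (jet_rep \<theta>)"

text \<open>Multi-indices are multisets of base indices: \<open>|I|\<close> is the size and \<open>I + e\<^sub>i\<close> is \<open>add_mset i I\<close>.
  To have the jet coordinates take values in a Euclidean space, the jet order is carried by a
  finite type \<open>'k\<close>, with \<open>CARD('k) = order + 1\<close>. So if \<open>'r\<close> is an arbitrary finite type and
  \<open>r = CARD('r) \<ge> 1\<close>, then \<open>'k = 'r option\<close> gives order \<open>r\<close> and \<open>'k = 'r\<close> gives order \<open>r - 1\<close>.\<close>

typedef ('n, 'k) mindex = "{I :: 'n::finite multiset. size I < CARD('k::finite)}"
  by (rule exI[of _ "{#}"]) simp

instance mindex :: (finite, finite) finite
proof
  have "{I :: 'a multiset. size I < CARD('b)} \<subseteq> mset ` {xs. set xs \<subseteq> UNIV \<and> length xs \<le> CARD('b)}"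
  proof
    fix I :: "'a multiset"
    assume "I \<in> {I. size I < CARD('b)}"
    moreover obtain xs where "mset xs = I" using ex_mset by blast
    ultimately show "I \<in> mset ` {xs. set xs \<subseteq> UNIV \<and> length xs \<le> CARD('b)}" by auto
  qed
  then have "finite {I :: 'a multiset. size I < CARD('b)}"
    by (rule finite_subset) (intro finite_imageI finite_lists_length_le finite)
  then have "finite (Abs_mindex ` {I :: 'a multiset. size I < CARD('b)} :: ('a, 'b) mindex set)"
    by simp
  moreover have "(UNIV :: ('a, 'b) mindex set) \<subseteq> Abs_mindex ` {I. size I < CARD('b)}"
  proof
    fix x :: "('a, 'b) mindex"
    show "x \<in> Abs_mindex ` {I. size I < CARD('b)}"
      by (rule image_eqI[of _ _ "Rep_mindex x"]) (simp only: Rep_mindex_inverse, rule Rep_mindex)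
  qed
  ultimately show "finite (UNIV :: ('a, 'b) mindex set)"
    by (rule finite_subset[rotated])
qed

definition deg :: "('n::finite, 'k::finite) mindex \<Rightarrow> nat" where
  "deg I = size (Rep_mindex I)"

text \<open>Only meaningful if \<open>deg I\<close> is smaller than the jet order.\<close>

definition mindex_add :: "'n::finite \<Rightarrow> ('n, 'k::finite) mindex \<Rightarrow> ('n, 'k) mindex" where
  "mindex_add i I = Abs_mindex (add_mset i (Rep_mindex I))"

text \<open>The order in which a multi-index is enumerated is immaterial for smooth functions.\<close>

definition partial_deriv :: "('n::finite, 'k::finite) mindex \<Rightarrow> (real^'n \<Rightarrow> real^'m) \<Rightarrow> real^'n \<Rightarrow> real^'m" where
  "partial_deriv I f = iter_pd (SOME js. mset js = Rep_mindex I) f"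

text \<open>A point \<open>z\<close> of the coordinate space has the coordinates \<open>x\<^sup>i = fst z $ i\<close> and
  \<open>u\<^sup>\<alpha>\<^sub>I = snd z $ I $ \<alpha>\<close>.\<close>

type_synonym ('n, 'm, 'k) jet_space = "(real^'n) \<times> ((real^'m)^('n, 'k) mindex)"

definition jet_chart :: "('b, real^'n) chart set \<Rightarrow> ('e, (real^'n) \<times> (real^'m)) chart set
    \<Rightarrow> ('e \<Rightarrow> 'b) \<Rightarrow> ('b, real^'n) chart \<times> ('e, (real^'n) \<times> (real^'m)) chart
    \<Rightarrow> (('b, 'e) jet, ('n::finite, 'm::finite, 'k::finite) jet_space) chart" where
  "jet_chart Q E pr bc =
     ({\<theta> \<in> jets Q E pr (CARD('k) - 1). jet_target \<theta> \<in> dom_ch (snd bc)},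
      \<lambda>\<theta>. (coord (fst bc) (fst \<theta>),
           \<chi> I. partial_deriv I (local_rep (fst bc) (snd bc) (jet_rep \<theta>)) (coord (fst bc) (fst \<theta>))))"

definition jet_atlas :: "('b, real^'n) chart set \<Rightarrow> ('e, (real^'n) \<times> (real^'m)) chart set
    \<Rightarrow> ('e \<Rightarrow> 'b) \<Rightarrow> (('b, 'e) jet, ('n::finite, 'm::finite, 'k::finite) jet_space) chart set" where
  "jet_atlas Q E pr = jet_chart Q E pr ` adapted Q E pr"

text \<open>The Cartan distribution: common kernel of the contact forms
  \<open>du\<^sup>\<alpha>\<^sub>I - (\<Sum>i. u\<^sup>\<alpha>\<^sub>I\<^sub>+\<^sub>i dx\<^sup>i)\<close>, \<open>|I| \<le> order - 1\<close>, of all adapted charts.\<close>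

definition cartan_space :: "('b, real^'n) chart set \<Rightarrow> ('e, (real^'n) \<times> (real^'m)) chart set
    \<Rightarrow> ('e \<Rightarrow> 'b) \<Rightarrow> ('b, 'e) jet
    \<Rightarrow> (('b, 'e) jet, ('n::finite, 'm::finite, 'k::finite) jet_space) tvec set" where
  "cartan_space Q E pr \<theta> = {v \<in> tangent_space (jet_atlas Q E pr) \<theta>.
     \<forall>bc\<in>adapted Q E pr. jet_target \<theta> \<in> dom_ch (snd bc) \<longrightarrow>
       (\<forall>(I::('n, 'k) mindex) \<alpha>. deg I + 1 < CARD('k) \<longrightarrow>
          snd (v (jet_chart Q E pr bc)) $ I $ \<alpha> =
          (\<Sum>i\<in>UNIV. snd (coord (jet_chart Q E pr bc) \<theta>) $ (mindex_add i I) $ \<alpha>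
             * fst (v (jet_chart Q E pr bc)) $ i))}"

text \<open>The vertical bundle of the projection of \<open>r\<close>-jets to \<open>(r - 1)\<close>-jets, \<open>r = CARD('r)\<close>.\<close>

definition vertical_space :: "('b, real^'n) chart set \<Rightarrow> ('e, (real^'n) \<times> (real^'m)) chart set
    \<Rightarrow> ('e \<Rightarrow> 'b) \<Rightarrow> ('b, 'e) jet
    \<Rightarrow> (('b, 'e) jet, ('n::finite, 'm::finite, 'r::finite option) jet_space) tvec set" where
  "vertical_space Q E pr \<theta> = {v \<in> tangent_space (jet_atlas Q E pr) \<theta>.
     tangent_map (jet_atlas Q E pr)
       (jet_atlas Q E pr :: (('b, 'e) jet, ('n, 'm, 'r) jet_space) chart set)
       (jet_proj Q E pr (CARD('r) - 1)) \<theta> v = zero_tvec}"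

section \<open>Equations\<close>

text \<open>Equations of order \<open>CARD('k) - 1\<close> and codimension \<open>CARD('q)\<close>.\<close>

definition pde :: "'k::finite itself \<Rightarrow> 'q::finite itself \<Rightarrow> ('b, real^'n::finite) chart set
    \<Rightarrow> ('e, (real^'n) \<times> (real^'m::finite)) chart set \<Rightarrow> ('e \<Rightarrow> 'b) \<Rightarrow> ('b, 'e) jet set \<Rightarrow> bool" where
  "pde k q Q E pr \<E> \<longleftrightarrow> \<E> \<subseteq> jets Q E pr (CARD('k) - 1) \<and>
     (\<forall>\<theta>\<in>\<E>. \<exists>W (F :: ('b, 'e) jet \<Rightarrow> real^'q). \<theta> \<in> W \<and>
        local_defining_map
          (jet_atlas Q E pr :: (('b, 'e) jet, ('n, 'm, 'k) jet_space) chart set) \<E> W F)"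

definition regular_pde :: "'k::finite itself \<Rightarrow> 'q::finite itself \<Rightarrow> ('b, real^'n::finite) chart set
    \<Rightarrow> ('e, (real^'n) \<times> (real^'m::finite)) chart set \<Rightarrow> ('e \<Rightarrow> 'b) \<Rightarrow> ('b, 'e) jet set \<Rightarrow> bool" where
  "regular_pde k q Q E pr \<E> \<longleftrightarrow> pde k q Q E pr \<E> \<and>
     (\<exists>d. \<forall>\<theta>\<in>\<E>. tdim (jet_atlas Q E pr :: (('b, 'e) jet, ('n, 'm, 'k) jet_space) chart set) \<theta>
        (tangent_to (jet_atlas Q E pr) \<E> \<theta> \<inter> cartan_space Q E pr \<theta>) = d)"

text \<open>\<open>drop_coords S\<close> forgets the coordinates \<open>u\<^sup>\<alpha>\<^sub>I\<close> with \<open>(I, \<alpha>) \<in> S\<close>, by setting them to \<open>0\<close>; a function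
  of the remaining coordinates is a function of the value of \<open>drop_coords S\<close>.\<close>

definition drop_coords :: "(('n::finite, 'k::finite) mindex \<times> 'm::finite) set
    \<Rightarrow> ('n, 'm, 'k) jet_space \<Rightarrow> ('n, 'm, 'k) jet_space" where
  "drop_coords S z = (fst z, \<chi> I. \<chi> \<alpha>. if (I, \<alpha>) \<in> S then 0 else snd z $ I $ \<alpha>)"

text \<open>Around each point of \<open>\<E>\<close>, and in some adapted coordinates, \<open>\<E>\<close> is given by expressing \<open>q\<close>
  coordinates of highest order as smooth functions \<open>h\<close> of all the remaining coordinates.\<close>

definition locally_normal_form :: "'k::finite itself \<Rightarrow> nat \<Rightarrow> ('b, real^'n::finite) chart set
    \<Rightarrow> ('e, (real^'n) \<times> (real^'m::finite)) chart set \<Rightarrow> ('e \<Rightarrow> 'b) \<Rightarrow> ('b, 'e) jet set \<Rightarrow> bool" where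
  "locally_normal_form k q Q E pr \<E> \<longleftrightarrow>
     (\<forall>\<theta>\<in>\<E>. \<exists>bc\<in>adapted Q E pr. \<exists>(S :: (('n, 'k) mindex \<times> 'm) set) W D h.
        let c = (jet_chart Q E pr bc :: (('b, 'e) jet, ('n, 'm, 'k) jet_space) chart);
            A = (jet_atlas Q E pr :: (('b, 'e) jet, ('n, 'm, 'k) jet_space) chart set)
        in card S = q \<and> (\<forall>(I, \<alpha>)\<in>S. deg I = CARD('k) - 1) \<and>
           atlas_open A W \<and> \<theta> \<in> W \<and> W \<subseteq> dom_ch c \<and>
           open D \<and> drop_coords S ` coord c ` W \<subseteq> D \<and>
           (\<forall>(I, \<alpha>)\<in>S. smooth_on D (h I \<alpha> :: ('n, 'm, 'k) jet_space \<Rightarrow> real)) \<and>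
           \<E> \<inter> W = {\<eta> \<in> W. \<forall>(I, \<alpha>)\<in>S.
              snd (coord c \<eta>) $ I $ \<alpha> = h I \<alpha> (drop_coords S (coord c \<eta>))})"

text \<open>Around each of its points, the subset \<open>S\<close> of the manifold \<open>A\<close> is the image of a smooth section
  \<open>s\<close>, over an open set \<open>V\<close>, of the projection \<open>p\<close> from \<open>A\<close> to \<open>B\<close>.\<close>

definition locally_section_graph :: "('p, 'a::euclidean_space) chart set
    \<Rightarrow> ('r, 'c::euclidean_space) chart set \<Rightarrow> ('p \<Rightarrow> 'r) \<Rightarrow> 'p set \<Rightarrow> bool" where
  "locally_section_graph A B p S \<longleftrightarrow>
     (\<forall>\<theta>\<in>S. \<exists>W V s. atlas_open A W \<and> \<theta> \<in> W \<and> atlas_open B V \<and> smooth_map B A V s \<and>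
        (\<forall>y\<in>V. p (s y) = y) \<and> S \<inter> W = s ` V)"

definition residual_polarisation :: "('b, real^'n) chart set
    \<Rightarrow> ('e, (real^'n) \<times> (real^'m)) chart set \<Rightarrow> ('e \<Rightarrow> 'b) \<Rightarrow> ('b, 'e) jet set \<Rightarrow> ('b, 'e) jet
    \<Rightarrow> (('b, 'e) jet, ('n::finite, 'm::finite, 'r::finite option) jet_space) tvec set" where
  "residual_polarisation Q E pr \<E> \<theta> =
     tangent_to (jet_atlas Q E pr) \<E> \<theta> \<inter> vertical_space Q E pr \<theta>"

text \<open>The vertical symbol of a defining map \<open>F\<close> at \<open>\<theta>\<close> is the restriction of its differential to the
  vertical space; this is its kernel and its rank.\<close>

definition symbol_ker :: "('b, real^'n) chart set \<Rightarrow> ('e, (real^'n) \<times> (real^'m)) chart set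
    \<Rightarrow> ('e \<Rightarrow> 'b) \<Rightarrow> (('b, 'e) jet \<Rightarrow> real^'q) \<Rightarrow> ('b, 'e) jet
    \<Rightarrow> (('b, 'e) jet, ('n::finite, 'm::finite, 'r::finite option) jet_space) tvec set" where
  "symbol_ker Q E pr F \<theta> = {v \<in> vertical_space Q E pr \<theta>. differential (jet_atlas Q E pr) F \<theta> v = 0}"

definition symbol_rank :: "'r::finite itself \<Rightarrow> ('b, real^'n::finite) chart set
    \<Rightarrow> ('e, (real^'n) \<times> (real^'m::finite)) chart set
    \<Rightarrow> ('e \<Rightarrow> 'b) \<Rightarrow> (('b, 'e) jet \<Rightarrow> real^'q) \<Rightarrow> ('b, 'e) jet \<Rightarrow> nat" where
  "symbol_rank r Q E pr F \<theta> =
     dim (differential (jet_atlas Q E pr) F \<theta> `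
       (vertical_space Q E pr \<theta> :: (('b, 'e) jet, ('n, 'm, 'r option) jet_space) tvec set))"

end

theory Submission
  imports Defs
begin


text \<open>
  Everything is local, so the proof takes place in one jet chart around a point \<open>\<theta>\<close> of the equation.
  There the projection to jets of order \<open>r - 1\<close> is the linear map \<open>truncate\<close> that forgets the
  coordinates of highest order, and the vertical space is its kernel, spanned by the highest-order
  coordinate axes (\<open>vertical_space_iff\<close>, \<open>truncate_eq_0_iff\<close>). A defining map \<open>F\<close> has a differential
  \<open>L\<close> at \<open>\<theta>\<close> that is onto, and the vectors tangent to the equation form its kernel
  (\<open>tangent_to_eq_ker_differential\<close>). Hence transversality, \<open>ker L + ker truncate\<close> being everything,
  means that the symbol, that is \<open>L\<close> restricted to \<open>ker truncate\<close>, is onto, which is the rank condition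
  (\<open>transversal_iff_symbol_onto\<close>). The kernel of the symbol is then the intersection of the two
  spaces by definition.

  If the symbol is onto, the images of the highest-order axes span \<open>\<real>\<^sup>q\<close>, so some \<open>q\<close> of these axes are
  mapped to a basis, and the implicit function theorem solves \<open>F = 0\<close> for the corresponding
  coordinates (\<open>symbol_onto_imp_normal_form\<close>). Conversely, in a normal form each straight line of the
  coordinate space becomes a curve in the equation after a change of highest-order coordinates only, so
  every vector is tangent to the equation up to a vertical one (\<open>normal_form_imp_transversal\<close>). If
  the vertical spaces have dimension \<open>q\<close>, a trivial intersection forces the symbol to be bijective, the
  solution expresses all highest-order coordinates by the others, and this is a section of
  \<open>truncate\<close> (\<open>no_vertical_imp_section_graph\<close>); the image of a section contains no vertical curve
  to first order (\<open>section_graph_imp_no_vertical\<close>).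

  These arguments rest on two bodies of theory that are built up first. One is the calculus of
  maps of class \<open>C\<^sup>\<infinity>\<close>: the chain rule, the symmetry of second derivatives, and the
  inverse and implicit function theorems with smooth solutions (\<open>smooth_inverse_function\<close>,
  \<open>implicit_graph\<close>). The other is that the jet charts form a smooth atlas
  (\<open>smooth_atlas_jet_atlas\<close>). Contact of order \<open>k\<close> between two sections can be tested in
  a single pair of adapted charts because it is preserved by composition with smooth maps on either
  side (\<open>agree_local_rep_change\<close>); polynomial sections realise all values of the jet coordinates; and
  a transition map sends \<open>z\<close> to iterated derivatives of the transformed polynomial section with jet
  \<open>z\<close>, which depends smoothly on \<open>z\<close> (\<open>smooth_jet_transition\<close>).
\<close>

section \<open>Calculus of smooth maps\<close>

abbreviation dir_deriv :: "'a::real_normed_vector \<Rightarrow> ('a \<Rightarrow> 'b::real_normed_vector) \<Rightarrow> 'a \<Rightarrow> 'b" where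
  "dir_deriv v f \<equiv> \<lambda>x. frechet_derivative f (at x) v"

lemma frechet_derivative_eqI: "(f has_derivative f') (at x) \<Longrightarrow> frechet_derivative f (at x) = f'"
  by (metis frechet_derivative_at)

lemma frechet_derivative_cong_open:
  assumes "open S" "x \<in> S" "\<And>y. y \<in> S \<Longrightarrow> f y = g y"
  shows "frechet_derivative f (at x) = frechet_derivative g (at x)"
proof -
  have "(f has_derivative D) (at x) \<longleftrightarrow> (g has_derivative D) (at x)" for D
    using has_derivative_transform_within_open[of _ _ x UNIV S] assms by metis
  then show ?thesis by (simp add: frechet_derivative_def)
qed

lemma differentiable_cong_open:
  assumes "open S" "x \<in> S" "\<And>y. y \<in> S \<Longrightarrow> f y = g y"
  shows "f differentiable (at x) \<longleftrightarrow> g differentiable (at x)"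
  using has_derivative_transform_within_open[of _ _ x UNIV S] assms
  unfolding differentiable_def by metis

lemma Ck_on_subset: "Ck_on k S f \<Longrightarrow> T \<subseteq> S \<Longrightarrow> Ck_on k T f"
  by (induction k arbitrary: f) (auto intro: continuous_on_subset)

lemma Ck_on_cong:
  assumes "open S" "\<And>x. x \<in> S \<Longrightarrow> f x = g x"
  shows "Ck_on k S f \<longleftrightarrow> Ck_on k S g"
  using assms(2)
proof (induction k arbitrary: f g)
  case 0 then show ?case by (simp cong: continuous_on_cong)
next
  case (Suc k)
  have "Ck_on k S (dir_deriv v f) \<longleftrightarrow> Ck_on k S (dir_deriv v g)" for v
    by (rule Suc.IH) (metis Suc.prems assms(1) frechet_derivative_cong_open)
  moreover have "f differentiable (at x) \<longleftrightarrow> g differentiable (at x)" if "x \<in> S" for x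
    using differentiable_cong_open[OF assms(1) that] Suc.prems by metis
  ultimately show ?case by auto
qed

lemma Ck_on_Suc_imp: "Ck_on (Suc k) S f \<Longrightarrow> Ck_on k S f"
proof (induction k arbitrary: f)
  case 0 then show ?case
    by (auto intro!: continuous_at_imp_continuous_on differentiable_imp_continuous_within)
next
  case (Suc k) then show ?case by (meson Ck_on.simps(2))
qed

lemma Ck_on_const: "Ck_on k S (\<lambda>x. c)"
  by (induction k arbitrary: c) auto

lemma Ck_on_bounded_linear:
  assumes "bounded_linear L" "open S" "Ck_on k S f"
  shows "Ck_on k S (\<lambda>x. L (f x))"
  using assms(3)
proof (induction k arbitrary: f)
  case 0 then show ?case
    using assms(1) bounded_linear.continuous_on by auto
next
  case (Suc k)
  have D: "((\<lambda>x. L (f x)) has_derivative (\<lambda>v. L (frechet_derivative f (at x) v))) (at x)"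
    if "x \<in> S" for x
    using Suc.prems that
    by (intro bounded_linear.has_derivative[OF assms(1)] iffD1[OF frechet_derivative_works]) simp
  have "Ck_on k S (dir_deriv v (\<lambda>x. L (f x)))" for v
    using Suc Ck_on_cong[OF assms(2), of "dir_deriv v (\<lambda>x. L (f x))" "\<lambda>x. L (dir_deriv v f x)" k]
      frechet_derivative_eqI[OF D] by simp
  then show ?case using D by (auto simp: differentiable_def)
qed

lemma Ck_on_add:
  assumes "open S" "Ck_on k S f" "Ck_on k S g"
  shows "Ck_on k S (\<lambda>x. f x + g x)"
  using assms(2,3)
proof (induction k arbitrary: f g)
  case 0 then show ?case by (auto intro: continuous_intros)
next
  case (Suc k)
  have D: "((\<lambda>x. f x + g x) has_derivative (\<lambda>v. dir_deriv v f x + dir_deriv v g x)) (at x)"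
    if "x \<in> S" for x
    using Suc.prems that
    by (intro has_derivative_add iffD1[OF frechet_derivative_works]) simp_all
  have "Ck_on k S (dir_deriv v (\<lambda>x. f x + g x))" for v
    using Suc Ck_on_cong[OF assms(1), of "dir_deriv v (\<lambda>x. f x + g x)"
        "\<lambda>x. dir_deriv v f x + dir_deriv v g x" k]
      frechet_derivative_eqI[OF D] by simp
  then show ?case using D by (auto simp: differentiable_def)
qed

lemma Ck_on_sum:
  assumes "open S" "\<And>i. i \<in> I \<Longrightarrow> Ck_on k S (f i)"
  shows "Ck_on k S (\<lambda>x. \<Sum>i\<in>I. f i x)"
  using assms(2)
  by (induction I rule: infinite_finite_induct) (auto intro: Ck_on_const Ck_on_add[OF assms(1)])

lemma Ck_on_scaleR:
  fixes f :: "'a::real_normed_vector \<Rightarrow> real" and g :: "'a \<Rightarrow> 'b::real_normed_vector"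
  assumes "open S" "Ck_on k S f" "Ck_on k S g"
  shows "Ck_on k S (\<lambda>x. f x *\<^sub>R g x)"
  using assms(2,3)
proof (induction k arbitrary: f g)
  case 0 then show ?case by (auto intro: continuous_intros)
next
  case (Suc k)
  have D: "((\<lambda>x. f x *\<^sub>R g x) has_derivative (\<lambda>v. f x *\<^sub>R dir_deriv v g x + dir_deriv v f x *\<^sub>R g x)) (at x)"
    if "x \<in> S" for x
    using Suc.prems that
    by (intro has_derivative_scaleR iffD1[OF frechet_derivative_works]) simp_all
  have "Ck_on k S (\<lambda>x. f x *\<^sub>R dir_deriv v g x + dir_deriv v f x *\<^sub>R g x)" for v
    using Suc.prems Ck_on_Suc_imp[OF Suc.prems(1)] Ck_on_Suc_imp[OF Suc.prems(2)]
    by (intro Ck_on_add[OF assms(1)] Suc.IH) simp_all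
  then have "Ck_on k S (dir_deriv v (\<lambda>x. f x *\<^sub>R g x))" for v
    using Ck_on_cong[OF assms(1), of "dir_deriv v (\<lambda>x. f x *\<^sub>R g x)"
        "\<lambda>x. f x *\<^sub>R dir_deriv v g x + dir_deriv v f x *\<^sub>R g x" k]
      frechet_derivative_eqI[OF D] by simp
  then show ?case using D by (auto simp: differentiable_def)
qed

lemma linear_Basis_expand:
  fixes w :: "'a::euclidean_space"
  assumes "linear L"
  shows "L w = (\<Sum>b\<in>Basis. (w \<bullet> b) *\<^sub>R L b)"
  using assms by (metis (no_types, lifting) euclidean_representation linear_scale linear_sum sum.cong)

lemma frechet_derivative_Basis_expand:
  fixes f :: "'a::euclidean_space \<Rightarrow> 'b::real_normed_vector"
  assumes "f differentiable (at x)"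
  shows "frechet_derivative f (at x) w = (\<Sum>b\<in>Basis. (w \<bullet> b) *\<^sub>R frechet_derivative f (at x) b)"
  by (rule linear_Basis_expand[OF linear_frechet_derivative[OF assms]])

lemma frechet_derivative_comp:
  assumes "f differentiable (at x)" "g differentiable (at (f x))"
  shows "((\<lambda>x. g (f x)) has_derivative
           (\<lambda>v. frechet_derivative g (at (f x)) (frechet_derivative f (at x) v))) (at x)"
  by (intro has_derivative_compose[of f _ x UNIV g] iffD1[OF frechet_derivative_works] assms)

lemma dir_deriv_comp:
  fixes g :: "'b::euclidean_space \<Rightarrow> 'c::real_normed_vector"
  assumes "f differentiable (at x)" "g differentiable (at (f x))"
  shows "dir_deriv v (\<lambda>x. g (f x)) x = (\<Sum>b\<in>Basis. (dir_deriv v f x \<bullet> b) *\<^sub>R dir_deriv b g (f x))"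
  using frechet_derivative_eqI[OF frechet_derivative_comp[OF assms]]
    frechet_derivative_Basis_expand[OF assms(2)] by metis

text \<open>The derivative of a composite is expanded over the basis: each summand is a product of a
  derivative of the inner map and the composite of a derivative of the outer map with the inner map,
  so that the induction on the order stays within composites of maps between the same spaces.\<close>

lemma Ck_on_compose:
  fixes g :: "'b::euclidean_space \<Rightarrow> 'c::real_normed_vector"
  assumes "open S" "Ck_on k S f" "Ck_on k T g" "f ` S \<subseteq> T"
  shows "Ck_on k S (\<lambda>x. g (f x))"
  using assms(2,3)
proof (induction k arbitrary: g)
  case 0 then show ?case
    using assms(4) continuous_on_compose2 by auto
next
  case (Suc k)
  have df: "f differentiable (at x)" "g differentiable (at (f x))" if "x \<in> S" for x
    using Suc.prems that assms(4) by auto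
  have "Ck_on k S (\<lambda>x. (dir_deriv v f x \<bullet> b) *\<^sub>R dir_deriv b g (f x))" for v b
  proof (rule Ck_on_scaleR[OF assms(1)])
    show "Ck_on k S (\<lambda>x. dir_deriv v f x \<bullet> b)"
      by (rule Ck_on_bounded_linear[OF bounded_linear_inner_left assms(1)]) (use Suc.prems in simp)
    show "Ck_on k S (\<lambda>x. dir_deriv b g (f x))"
      by (rule Suc.IH[OF Ck_on_Suc_imp[OF Suc.prems(1)]]) (use Suc.prems in simp)
  qed
  then have "Ck_on k S (\<lambda>x. \<Sum>b\<in>Basis. (dir_deriv v f x \<bullet> b) *\<^sub>R dir_deriv b g (f x))" for v
    by (intro Ck_on_sum[OF assms(1)])
  then have "Ck_on k S (dir_deriv v (\<lambda>x. g (f x)))" for v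
    using Ck_on_cong[OF assms(1), of "dir_deriv v (\<lambda>x. g (f x))"
      "\<lambda>x. \<Sum>b\<in>Basis. (dir_deriv v f x \<bullet> b) *\<^sub>R dir_deriv b g (f x)" k] dir_deriv_comp[OF df]
    by simp
  then show ?case using frechet_derivative_comp[OF df] by (auto simp: differentiable_def)
qed

lemma smooth_on_subset: "smooth_on S f \<Longrightarrow> T \<subseteq> S \<Longrightarrow> smooth_on T f"
  using Ck_on_subset unfolding smooth_on_def by blast

lemma smooth_on_cong:
  assumes "open S" "\<And>x. x \<in> S \<Longrightarrow> f x = g x"
  shows "smooth_on S f \<longleftrightarrow> smooth_on S g"
  using Ck_on_cong[where f = f and g = g, OF assms] unfolding smooth_on_def by blast

lemma smooth_on_transform:
  "smooth_on S f \<Longrightarrow> open S \<Longrightarrow> (\<And>x. x \<in> S \<Longrightarrow> f x = g x) \<Longrightarrow> smooth_on S g"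
  using smooth_on_cong[of S f g] by blast

lemma smooth_on_const: "smooth_on S (\<lambda>x. c)"
  using Ck_on_const unfolding smooth_on_def by blast

lemma smooth_on_bounded_linear_comp:
  "bounded_linear L \<Longrightarrow> open S \<Longrightarrow> smooth_on S f \<Longrightarrow> smooth_on S (\<lambda>x. L (f x))"
  using Ck_on_bounded_linear unfolding smooth_on_def by blast

lemma smooth_on_id: "open S \<Longrightarrow> smooth_on S (\<lambda>x. x)"
  unfolding smooth_on_def
proof
  fix k assume "open S" show "Ck_on k S (\<lambda>x. x)"
    by (cases k) (auto intro: Ck_on_const)
qed

lemma smooth_on_bounded_linear: "bounded_linear L \<Longrightarrow> open S \<Longrightarrow> smooth_on S L"
  using smooth_on_bounded_linear_comp[OF _ _ smooth_on_id] by auto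

lemma smooth_on_linear:
  fixes L :: "'a::euclidean_space \<Rightarrow> 'b::real_normed_vector"
  shows "linear L \<Longrightarrow> open S \<Longrightarrow> smooth_on S L"
  by (simp add: linear_conv_bounded_linear smooth_on_bounded_linear)

lemma smooth_on_linear_comp:
  fixes L :: "'a::euclidean_space \<Rightarrow> 'b::real_normed_vector"
  shows "linear L \<Longrightarrow> open S \<Longrightarrow> smooth_on S f \<Longrightarrow> smooth_on S (\<lambda>x. L (f x))"
  by (simp add: linear_conv_bounded_linear smooth_on_bounded_linear_comp)

lemma smooth_on_add:
  "open S \<Longrightarrow> smooth_on S f \<Longrightarrow> smooth_on S g \<Longrightarrow> smooth_on S (\<lambda>x. f x + g x)"
  using Ck_on_add unfolding smooth_on_def by blast

lemma smooth_on_diff: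
  "open S \<Longrightarrow> smooth_on S f \<Longrightarrow> smooth_on S g \<Longrightarrow> smooth_on S (\<lambda>x. f x - g x)"
  using smooth_on_add[of S f "\<lambda>x. - g x"]
    smooth_on_bounded_linear_comp[OF bounded_linear_minus[OF bounded_linear_ident], of S g] by simp

lemma smooth_on_sum:
  "open S \<Longrightarrow> (\<And>i. i \<in> I \<Longrightarrow> smooth_on S (f i)) \<Longrightarrow> smooth_on S (\<lambda>x. \<Sum>i\<in>I. f i x)"
  using Ck_on_sum[of S I] unfolding smooth_on_def by blast

lemma smooth_on_scaleR:
  "open S \<Longrightarrow> smooth_on S f \<Longrightarrow> smooth_on S g \<Longrightarrow> smooth_on S (\<lambda>x. f x *\<^sub>R g x)"
  using Ck_on_scaleR unfolding smooth_on_def by blast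

lemma smooth_on_prod:
  fixes f :: "'i \<Rightarrow> 'a::real_normed_vector \<Rightarrow> real"
  assumes "open S" "\<And>i. i \<in> I \<Longrightarrow> smooth_on S (f i)"
  shows "smooth_on S (\<lambda>x. \<Prod>i\<in>I. f i x)"
  using assms(2)
proof (induction I rule: infinite_finite_induct)
  case (insert i F)
  then have "smooth_on S (\<lambda>x. f i x *\<^sub>R (\<Prod>i\<in>F. f i x))"
    by (intro smooth_on_scaleR assms(1)) auto
  with insert show ?case by simp
qed (auto intro: smooth_on_const)

lemma smooth_on_power:
  fixes f :: "'a::real_normed_vector \<Rightarrow> real"
  assumes "open S" "smooth_on S f"
  shows "smooth_on S (\<lambda>x. f x ^ m)"
proof (induction m)
  case (Suc m) then show ?case using smooth_on_scaleR[OF assms Suc.IH] by simp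
qed (simp add: smooth_on_const)

lemma smooth_on_compose:
  fixes g :: "'b::euclidean_space \<Rightarrow> 'c::real_normed_vector"
  assumes "open S" "smooth_on S f" "smooth_on T g" "f ` S \<subseteq> T"
  shows "smooth_on S (\<lambda>x. g (f x))"
  using assms Ck_on_compose unfolding smooth_on_def by blast

lemma smooth_on_Pair:
  assumes "open S" "smooth_on S f" "smooth_on S g"
  shows "smooth_on S (\<lambda>x. (f x, g x))"
proof -
  have "smooth_on S (\<lambda>x. (f x, 0) + (0, g x))"
    by (intro smooth_on_add assms(1)
        smooth_on_bounded_linear_comp[OF bounded_linear_Pair[OF bounded_linear_ident bounded_linear_zero]]
        smooth_on_bounded_linear_comp[OF bounded_linear_Pair[OF bounded_linear_zero bounded_linear_ident]]
        assms(2,3))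
  then show ?thesis by simp
qed

lemma smooth_on_fst: "open S \<Longrightarrow> smooth_on S f \<Longrightarrow> smooth_on S (\<lambda>x. fst (f x))"
  by (rule smooth_on_bounded_linear_comp[OF bounded_linear_fst])

lemma smooth_on_snd: "open S \<Longrightarrow> smooth_on S f \<Longrightarrow> smooth_on S (\<lambda>x. snd (f x))"
  by (rule smooth_on_bounded_linear_comp[OF bounded_linear_snd])

lemma smooth_on_vec_nth: "open S \<Longrightarrow> smooth_on S f \<Longrightarrow> smooth_on S (\<lambda>x. f x $ i)"
  by (rule smooth_on_bounded_linear_comp[OF bounded_linear_vec_nth])

lemma linear_axis: "linear (\<lambda>a. axis i a)"
  by (intro linearI) (auto simp: axis_def vec_eq_iff)

lemma vec_lambda_axis: "(\<chi> i. f i) = (\<Sum>i\<in>UNIV. axis i (f i))"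
  by (auto simp: vec_eq_iff axis_def)

lemma smooth_on_vec_lambda:
  fixes f :: "'i::finite \<Rightarrow> 'a::real_normed_vector \<Rightarrow> 'b::euclidean_space"
  assumes "open S" "\<And>i. smooth_on S (f i)"
  shows "smooth_on S (\<lambda>x. \<chi> i. f i x)"
  unfolding vec_lambda_axis
  by (intro smooth_on_sum smooth_on_linear_comp[OF linear_axis] assms)

lemma smooth_on_imp_differentiable: "smooth_on S f \<Longrightarrow> x \<in> S \<Longrightarrow> f differentiable (at x)"
  unfolding smooth_on_def by (metis Ck_on.simps(2))

lemma smooth_on_imp_has_derivative:
  "smooth_on S f \<Longrightarrow> x \<in> S \<Longrightarrow> (f has_derivative frechet_derivative f (at x)) (at x)"
  using smooth_on_imp_differentiable frechet_derivative_works by blast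

lemma smooth_on_imp_continuous_on: "smooth_on S f \<Longrightarrow> continuous_on S f"
  unfolding smooth_on_def by (metis Ck_on.simps(1))

lemma smooth_on_dir_deriv: "smooth_on S f \<Longrightarrow> smooth_on S (dir_deriv v f)"
  unfolding smooth_on_def by (metis Ck_on.simps(2))

lemma open_preimage_smooth:
  assumes "smooth_on S f" "open S" "open V"
  shows "open {x \<in> S. f x \<in> V}"
proof -
  have "open (f -` V \<inter> S)"
    using assms smooth_on_imp_continuous_on continuous_on_open_vimage by blast
  moreover have "f -` V \<inter> S = {x \<in> S. f x \<in> V}" by auto
  ultimately show ?thesis by simp
qed

section \<open>Symmetry of second derivatives\<close>

lemma has_vector_derivative_line:
  assumes "f differentiable (at (p + s *\<^sub>R u))"
  shows "((\<lambda>s. f (p + s *\<^sub>R u)) has_vector_derivative dir_deriv u f (p + s *\<^sub>R u)) (at s)"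
proof -
  let ?D = "frechet_derivative f (at (p + s *\<^sub>R u))"
  have "((\<lambda>s. p + s *\<^sub>R u) has_derivative (\<lambda>h. h *\<^sub>R u)) (at s)"
    by (auto intro!: derivative_eq_intros)
  then have "((\<lambda>s. f (p + s *\<^sub>R u)) has_derivative (\<lambda>h. ?D (h *\<^sub>R u))) (at s)"
    using has_derivative_compose[of "\<lambda>s. p + s *\<^sub>R u" _ s UNIV f ?D]
      iffD1[OF frechet_derivative_works assms] by simp
  moreover have "?D (h *\<^sub>R u) = h *\<^sub>R ?D u" for h
    using linear_frechet_derivative[OF assms] by (rule linear_scale)
  ultimately show ?thesis by (simp add: has_vector_derivative_def)
qed

text \<open>The second difference over a parallelogram, evaluated by applying the mean value theorem
  once in each direction. As it is symmetric in the two directions, so is the limit of its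
  quotients.\<close>

lemma second_difference_mvt:
  fixes f :: "'a::real_normed_vector \<Rightarrow> real"
  assumes f: "smooth_on S f" and h: "h > 0"
    and S: "\<And>s t. 0 \<le> s \<Longrightarrow> s \<le> h \<Longrightarrow> 0 \<le> t \<Longrightarrow> t \<le> h \<Longrightarrow> x + s *\<^sub>R u + t *\<^sub>R v \<in> S"
  obtains s t where "0 \<le> s" "s \<le> h" "0 \<le> t" "t \<le> h"
    "f (x + h *\<^sub>R u + h *\<^sub>R v) - f (x + h *\<^sub>R u) - f (x + h *\<^sub>R v) + f x
       = h * (h * dir_deriv v (dir_deriv u f) (x + s *\<^sub>R u + t *\<^sub>R v))"
proof -
  have line: "((\<lambda>s. g (p + s *\<^sub>R w)) has_real_derivative dir_deriv w g (p + s *\<^sub>R w)) (at s)"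
    if "smooth_on S g" "p + s *\<^sub>R w \<in> S" for g :: "'a \<Rightarrow> real" and p w s
    using has_vector_derivative_line[OF smooth_on_imp_differentiable[OF that]]
    by (simp add: has_real_derivative_iff_has_vector_derivative)
  let ?\<phi> = "\<lambda>s. f ((x + h *\<^sub>R v) + s *\<^sub>R u) - f (x + s *\<^sub>R u)"
  have "(?\<phi> has_real_derivative
      dir_deriv u f ((x + h *\<^sub>R v) + s *\<^sub>R u) - dir_deriv u f (x + s *\<^sub>R u)) (at s)"
    if "0 \<le> s" "s \<le> h" for s
    using S[OF that, of h] S[OF that, of 0] h
    by (intro DERIV_diff line f) (auto simp: algebra_simps)
  from MVT2[OF h, of ?\<phi>, OF this] obtain s where s: "0 < s" "s < h"
    "?\<phi> h - ?\<phi> 0 = (h - 0) * (dir_deriv u f ((x + h *\<^sub>R v) + s *\<^sub>R u) - dir_deriv u f (x + s *\<^sub>R u))"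
    by metis
  let ?\<psi> = "\<lambda>t. dir_deriv u f ((x + s *\<^sub>R u) + t *\<^sub>R v)"
  have "(?\<psi> has_real_derivative dir_deriv v (dir_deriv u f) ((x + s *\<^sub>R u) + t *\<^sub>R v)) (at t)"
    if "0 \<le> t" "t \<le> h" for t
    using S[of s t] that s by (intro line smooth_on_dir_deriv f) auto
  from MVT2[OF h, of ?\<psi>, OF this] obtain t where t: "0 < t" "t < h"
    "?\<psi> h - ?\<psi> 0 = (h - 0) * dir_deriv v (dir_deriv u f) ((x + s *\<^sub>R u) + t *\<^sub>R v)"
    by metis
  show ?thesis
  proof (rule that[of s t])
    have "x + h *\<^sub>R v + s *\<^sub>R u = x + s *\<^sub>R u + h *\<^sub>R v" "x + h *\<^sub>R v + h *\<^sub>R u = x + h *\<^sub>R u + h *\<^sub>R v"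
      by (simp_all add: algebra_simps)
    then show "f (x + h *\<^sub>R u + h *\<^sub>R v) - f (x + h *\<^sub>R u) - f (x + h *\<^sub>R v) + f x
       = h * (h * dir_deriv v (dir_deriv u f) (x + s *\<^sub>R u + t *\<^sub>R v))"
      using s(3) t(3) by (simp add: algebra_simps)
  qed (use s t in auto)
qed

lemma dir_deriv_commute_real:
  fixes f :: "'a::real_normed_vector \<Rightarrow> real"
  assumes f: "smooth_on S f" and S: "open S" "x \<in> S"
  shows "dir_deriv u (dir_deriv v f) x = dir_deriv v (dir_deriv u f) x"
proof (rule ccontr)
  let ?a = "dir_deriv v (dir_deriv u f)" and ?b = "dir_deriv u (dir_deriv v f)"
  assume ne: "?b x \<noteq> ?a x"
  define \<epsilon> where "\<epsilon> = \<bar>?a x - ?b x\<bar> / 2"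
  have \<epsilon>: "\<epsilon> > 0" using ne by (simp add: \<epsilon>_def)
  have "continuous (at x) ?a" "continuous (at x) ?b"
    using smooth_on_imp_continuous_on[OF smooth_on_dir_deriv[OF smooth_on_dir_deriv[OF f]]] S
    by (simp_all add: continuous_on_eq_continuous_at)
  then obtain d1 d2 where d: "d1 > 0" "\<And>y. dist y x < d1 \<Longrightarrow> dist (?a y) (?a x) < \<epsilon>"
    "d2 > 0" "\<And>y. dist y x < d2 \<Longrightarrow> dist (?b y) (?b x) < \<epsilon>"
    using \<epsilon> unfolding continuous_at_eps_delta by metis
  \<comment> \<open>A step size for which the parallelograms spanned by \<open>h u\<close> and \<open>h v\<close> stay where both mixed
    derivatives differ from their values at \<open>x\<close> by less than half the distance of these values.\<close>
  obtain d3 where d3: "d3 > 0" "ball x d3 \<subseteq> S" using S open_contains_ball by blast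
  define d where "d = min d1 (min d2 d3)"
  define h where "h = d / (2 * (norm u + norm v + 1))"
  have dpos: "d > 0" using d d3 by (simp add: d_def)
  have n0: "norm u + norm v + 1 > 0" by (simp add: add_nonneg_pos)
  have h: "h > 0" using dpos n0 by (simp add: h_def)
  have hd: "h * (norm u + norm v) < d"
  proof -
    have "h * (norm u + norm v) \<le> h * (norm u + norm v + 1)" using h by simp
    also have "\<dots> = d / 2" using n0 by (simp add: h_def field_simps)
    finally show ?thesis using dpos by simp
  qed
  have near: "dist (x + s *\<^sub>R w + t *\<^sub>R w') x < d"
    if "0 \<le> s" "s \<le> h" "0 \<le> t" "t \<le> h" "norm w + norm w' = norm u + norm v" for s t w w'
  proof -
    have "norm (s *\<^sub>R w + t *\<^sub>R w') \<le> s * norm w + t * norm w'"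
      using norm_triangle_ineq[of "s *\<^sub>R w" "t *\<^sub>R w'"] that by simp
    also have "\<dots> \<le> h * norm w + h * norm w'"
      using that by (intro add_mono mult_right_mono) auto
    finally show ?thesis using hd that(5)
      by (simp add: dist_norm add.assoc distrib_left[symmetric])
  qed
  have inS: "x + s *\<^sub>R w + t *\<^sub>R w' \<in> S"
    if "0 \<le> s" "s \<le> h" "0 \<le> t" "t \<le> h" "norm w + norm w' = norm u + norm v" for s t w w'
    using near[OF that] d3(2) by (auto simp: d_def dist_commute subset_eq)
  obtain s t where 1: "0 \<le> s" "s \<le> h" "0 \<le> t" "t \<le> h"
    "f (x + h *\<^sub>R u + h *\<^sub>R v) - f (x + h *\<^sub>R u) - f (x + h *\<^sub>R v) + f x
       = h * (h * ?a (x + s *\<^sub>R u + t *\<^sub>R v))"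
    using second_difference_mvt[OF f h, of x u v] inS by metis
  obtain s' t' where 2: "0 \<le> s'" "s' \<le> h" "0 \<le> t'" "t' \<le> h"
    "f (x + h *\<^sub>R v + h *\<^sub>R u) - f (x + h *\<^sub>R v) - f (x + h *\<^sub>R u) + f x
       = h * (h * ?b (x + s' *\<^sub>R v + t' *\<^sub>R u))"
    using second_difference_mvt[OF f h, of x v u] inS by (metis add.commute)
  have eq: "x + h *\<^sub>R v + h *\<^sub>R u = x + h *\<^sub>R u + h *\<^sub>R v" by (simp add: algebra_simps)
  have "h * (h * ?a (x + s *\<^sub>R u + t *\<^sub>R v)) = h * (h * ?b (x + s' *\<^sub>R v + t' *\<^sub>R u))"
    using 1(5) 2(5) unfolding eq by linarith
  then have "?a (x + s *\<^sub>R u + t *\<^sub>R v) = ?b (x + s' *\<^sub>R v + t' *\<^sub>R u)" using h by simp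
  moreover have "dist (?a (x + s *\<^sub>R u + t *\<^sub>R v)) (?a x) < \<epsilon>"
    using near[OF 1(1-4), of u v] by (intro d) (simp add: d_def)
  moreover have "dist (?b (x + s' *\<^sub>R v + t' *\<^sub>R u)) (?b x) < \<epsilon>"
    using near[OF 2(1-4), of v u] by (intro d) (simp add: d_def)
  ultimately show False by (auto simp: \<epsilon>_def dist_real_def abs_if split: if_splits)
qed

lemma dir_deriv_inner:
  assumes "f differentiable (at x)"
  shows "dir_deriv v (\<lambda>x. f x \<bullet> b) x = dir_deriv v f x \<bullet> b"
  using frechet_derivative_eqI[OF bounded_linear.has_derivative[OF bounded_linear_inner_left
        iffD1[OF frechet_derivative_works assms]]] by simp

lemma dir_deriv_commute:
  fixes f :: "'a::real_normed_vector \<Rightarrow> 'b::euclidean_space"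
  assumes f: "smooth_on S f" and S: "open S" "x \<in> S"
  shows "dir_deriv u (dir_deriv v f) x = dir_deriv v (dir_deriv u f) x"
proof (rule euclidean_eqI)
  fix b :: 'b
  have fb: "smooth_on S (\<lambda>x. f x \<bullet> b)"
    by (rule smooth_on_bounded_linear_comp[OF bounded_linear_inner_left S(1) f])
  have *: "dir_deriv u (dir_deriv v (\<lambda>x. f x \<bullet> b)) x = dir_deriv u (dir_deriv v f) x \<bullet> b" for u v
  proof -
    have "dir_deriv u (dir_deriv v (\<lambda>x. f x \<bullet> b)) x = dir_deriv u (\<lambda>x. dir_deriv v f x \<bullet> b) x"
      using frechet_derivative_cong_open[OF S, of "dir_deriv v (\<lambda>x. f x \<bullet> b)"]
        dir_deriv_inner[OF smooth_on_imp_differentiable[OF f]] by metis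
    also have "\<dots> = dir_deriv u (dir_deriv v f) x \<bullet> b"
      by (rule dir_deriv_inner[OF smooth_on_imp_differentiable[OF smooth_on_dir_deriv[OF f] S(2)]])
    finally show ?thesis .
  qed
  show "dir_deriv u (dir_deriv v f) x \<bullet> b = dir_deriv v (dir_deriv u f) x \<bullet> b"
    using dir_deriv_commute_real[OF fb S] * by metis
qed

section \<open>The inverse and implicit function theorems in the smooth category\<close>

text \<open>A product rule in which one factor is merely continuous: it suffices that the other one
  vanishes at the point.\<close>

lemma has_derivative_scaleR_vanishing:
  fixes p :: "'a::real_normed_vector \<Rightarrow> real"
  assumes p: "continuous (at x) p" and q: "(q has_derivative q') (at x)" and q0: "q x = 0"
  shows "((\<lambda>y. p y *\<^sub>R q y) has_derivative (\<lambda>h. p x *\<^sub>R q' h)) (at x)"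
proof -
  have bl: "bounded_linear q'" using q by (rule has_derivative_bounded_linear)
  have "((\<lambda>y. (p y - p x) *\<^sub>R q y) has_derivative (\<lambda>h. 0)) (at x)"
    unfolding has_derivative_at_alt
  proof (intro conjI allI impI)
    fix e :: real assume e: "e > 0"
    obtain K where K: "K > 0" "\<And>h. norm (q' h) \<le> norm h * K"
      using bounded_linear.pos_bounded[OF bl] by blast
    obtain d1 where d1: "d1 > 0" "\<And>y. norm (y - x) < d1 \<Longrightarrow> norm (q y - q x - q' (y - x)) \<le> 1 * norm (y - x)"
      using q zero_less_one unfolding has_derivative_at_alt by blast
    have "e / (K + 1) > 0" using e K by simp
    then obtain d2 where d2: "d2 > 0" "\<And>y. dist y x < d2 \<Longrightarrow> dist (p y) (p x) < e / (K + 1)"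
      using p unfolding continuous_at_eps_delta by blast
    have "norm ((p y - p x) *\<^sub>R q y) \<le> e * norm (y - x)" if y: "norm (y - x) < min d1 d2" for y
    proof -
      have "norm (q y) \<le> norm (q' (y - x)) + norm (q y - q' (y - x))"
        by (metis norm_triangle_sub add.commute)
      also have "\<dots> \<le> norm (y - x) * K + norm (y - x)"
        using K(2)[of "y - x"] d1(2)[of y] y q0 by simp
      finally have qy: "norm (q y) \<le> (K + 1) * norm (y - x)" by (simp add: algebra_simps)
      have "\<bar>p y - p x\<bar> \<le> e / (K + 1)"
        using d2(2)[of y] y by (simp add: dist_norm)
      then have "\<bar>p y - p x\<bar> * norm (q y) \<le> (e / (K + 1)) * ((K + 1) * norm (y - x))"
        using qy e K by (intro mult_mono) auto
      also have "\<dots> = e * norm (y - x)" using K by simp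
      finally show ?thesis by simp
    qed
    then show "\<exists>d>0. \<forall>y. norm (y - x) < d \<longrightarrow>
        norm ((p y - p x) *\<^sub>R q y - (p x - p x) *\<^sub>R q x - 0) \<le> e * norm (y - x)"
      using d1 d2 by (intro exI[of _ "min d1 d2"]) auto
  qed simp
  moreover have "((\<lambda>y. p x *\<^sub>R q y) has_derivative (\<lambda>h. p x *\<^sub>R q' h)) (at x)"
    using q by (rule has_derivative_scaleR_right)
  ultimately have "((\<lambda>y. (p y - p x) *\<^sub>R q y + p x *\<^sub>R q y) has_derivative (\<lambda>h. 0 + p x *\<^sub>R q' h)) (at x)"
    by (rule has_derivative_add)
  then show ?thesis by (simp add: algebra_simps)
qed

text \<open>Inversion of linear maps is smooth. This is obtained without determinants: with
  \<open>W x = (M x)\<inverse> b\<close> one has \<open>W x = W x\<^sub>0 - (M x\<^sub>0)\<inverse> ((M x - M x\<^sub>0) (W x))\<close>, which gives continuity of \<open>W\<close>,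
  then differentiability, and expresses the derivative of \<open>W\<close> polynomially through the maps \<open>W\<close> and
  the derivatives of \<open>M\<close>, so that the regularity of \<open>W\<close> can be raised step by step.\<close>

context
  fixes M :: "'x::real_normed_vector \<Rightarrow> 'a::euclidean_space \<Rightarrow> 'a" and X :: "'x set"
  assumes X: "open X" and lin: "\<And>x. x \<in> X \<Longrightarrow> linear (M x)" and bij: "\<And>x. x \<in> X \<Longrightarrow> bij (M x)"
    and sm: "\<And>i. i \<in> Basis \<Longrightarrow> smooth_on X (\<lambda>x. M x i)"
begin

lemma linear_inv_family: "x \<in> X \<Longrightarrow> linear (inv (M x))"
  using lin bij by (metis bij_def inj_linear_imp_inv_linear)

text \<open>The identity behind all estimates below, obtained by applying \<open>(M x)\<inverse>\<close> to
  \<open>M y w - M x w\<close> for \<open>w = (M y)\<inverse> b\<close>, where \<open>M y w = b\<close>.\<close>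

lemma inv_family_step:
  assumes "x \<in> X" "y \<in> X"
  shows "inv (M y) b = inv (M x) b - (\<Sum>i\<in>Basis. (inv (M y) b \<bullet> i) *\<^sub>R inv (M x) (M y i - M x i))"
proof -
  let ?w = "inv (M y) b" and ?A = "inv (M x)"
  have A: "linear ?A" using linear_inv_family assms by blast
  have "(\<Sum>i\<in>Basis. (?w \<bullet> i) *\<^sub>R ?A (M y i - M x i)) = ?A (M y ?w - M x ?w)"
    by (simp add: linear_Basis_expand[OF lin[OF assms(1)], of ?w]
        linear_Basis_expand[OF lin[OF assms(2)], of ?w] linear_diff[OF A] linear_sum[OF A]
        linear_scale[OF A] sum_subtractf scaleR_diff_right)
  also have "\<dots> = ?A b - ?w"
    using bij assms by (simp add: linear_diff[OF A] bij_is_surj surj_f_inv_f bij_is_inj inv_f_f)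
  finally show ?thesis by simp
qed

lemma inv_family_bounded:
  assumes "x \<in> X"
  obtains K where "K > 0" "\<forall>\<^sub>F y in at x. \<forall>b. norm (inv (M y) b) \<le> K * norm b"
proof -
  \<comment> \<open>As long as the perturbation of \<open>M x\<close> is at most half its lower bound \<open>B\<close>, the bound \<open>B / 2\<close>
    survives, and the inverse is bounded by \<open>2 / B\<close>.\<close>
  obtain B where B: "B > 0" "\<And>w. B * norm w \<le> norm (M x w)"
    using linear_inj_bounded_below_pos[OF lin[OF assms] bij_is_inj[OF bij[OF assms]]] by blast
  let ?S = "\<lambda>y. \<Sum>i\<in>Basis. norm (M y i - M x i)"
  have "((\<lambda>y. M y i) \<longlongrightarrow> M x i) (at x)" if "i \<in> Basis" for i
    using smooth_on_imp_continuous_on[OF sm[OF that]] X assms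
    by (simp add: continuous_on_eq_continuous_at isCont_def)
  then have "(?S \<longlongrightarrow> (\<Sum>i\<in>(Basis::'a set). norm (M x i - M x i))) (at x)"
    by (intro tendsto_intros) auto
  then have "(?S \<longlongrightarrow> 0) (at x)" by simp
  then have "\<forall>\<^sub>F y in at x. ?S y < B / 2" using B by (intro order_tendstoD) auto
  moreover have "\<forall>\<^sub>F y in at x. y \<in> X" using X assms eventually_at_in_open' by blast
  ultimately have "\<forall>\<^sub>F y in at x. \<forall>b. norm (inv (M y) b) \<le> (2 / B) * norm b"
  proof eventually_elim
    case (elim y)
    show ?case
    proof
      fix b
      let ?w = "inv (M y) b"
      have "norm (M y ?w - M x ?w) = norm (\<Sum>i\<in>Basis. (?w \<bullet> i) *\<^sub>R (M y i - M x i))"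
        using elim assms by (simp add: linear_Basis_expand[OF lin[OF assms], of ?w]
            linear_Basis_expand[OF lin[of y], of ?w] sum_subtractf scaleR_diff_right)
      also have "\<dots> \<le> (\<Sum>i\<in>Basis. norm ?w * norm (M y i - M x i))"
        by (rule order_trans[OF norm_sum])
          (auto intro!: sum_mono mult_right_mono simp: Basis_le_norm)
      also have "\<dots> = norm ?w * ?S y" by (simp add: sum_distrib_left)
      also have "\<dots> \<le> norm ?w * (B / 2)" using elim by (intro mult_left_mono) auto
      finally have "norm (M y ?w - M x ?w) \<le> norm ?w * (B / 2)" .
      moreover have "norm (M x ?w) \<le> norm (M y ?w) + norm (M y ?w - M x ?w)"
        by (metis norm_minus_commute norm_triangle_sub)
      moreover have "M y ?w = b" using bij elim by (simp add: bij_is_surj surj_f_inv_f)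
      ultimately have "B * norm ?w \<le> norm b + norm ?w * (B / 2)" using B(2)[of ?w] by simp
      then have "B * norm ?w \<le> 2 * norm b" by (simp add: field_simps)
      then show "norm ?w \<le> (2 / B) * norm b" using B(1) by (simp add: field_simps)
    qed
  qed
  then show ?thesis using that[of "2 / B"] B by simp
qed

lemma isCont_inv_family:
  assumes "x \<in> X"
  shows "isCont (\<lambda>y. inv (M y) b) x"
proof -
  obtain K where K: "K > 0" "\<forall>\<^sub>F y in at x. \<forall>b. norm (inv (M y) b) \<le> K * norm b"
    using inv_family_bounded[OF assms] by blast
  let ?S = "\<lambda>y. \<Sum>i\<in>Basis. K * norm b * norm (inv (M x) (M y i - M x i))"
  have bl: "bounded_linear (inv (M x))"
    using linear_inv_family[OF assms] by (simp add: linear_conv_bounded_linear)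
  have "((\<lambda>y. M y i) \<longlongrightarrow> M x i) (at x)" if "i \<in> Basis" for i
    using smooth_on_imp_continuous_on[OF sm[OF that]] X assms
    by (simp add: continuous_on_eq_continuous_at isCont_def)
  then have "(?S \<longlongrightarrow> (\<Sum>i\<in>(Basis::'a set). K * norm b * norm (inv (M x) (M x i - M x i)))) (at x)"
    by (intro tendsto_intros bounded_linear.tendsto[OF bl]) auto
  then have S0: "(?S \<longlongrightarrow> 0) (at x)" by (simp add: linear_0[OF linear_inv_family[OF assms]])
  have step: "norm (w - w') = norm d" if "w = w' - d" for w w' d :: 'a using that by simp
  have "\<forall>\<^sub>F y in at x. y \<in> X" using X assms eventually_at_in_open' by blast
  with K(2) have "\<forall>\<^sub>F y in at x. norm (inv (M y) b - inv (M x) b) \<le> ?S y"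
  proof eventually_elim
    case (elim y)
    let ?w = "inv (M y) b"
    have "norm (?w - inv (M x) b) = norm (\<Sum>i\<in>Basis. (?w \<bullet> i) *\<^sub>R inv (M x) (M y i - M x i))"
      by (rule step[OF inv_family_step[OF assms elim(2)]])
    also have "\<dots> \<le> (\<Sum>i\<in>Basis. norm ?w * norm (inv (M x) (M y i - M x i)))"
      by (rule order_trans[OF norm_sum])
        (auto intro!: sum_mono mult_right_mono simp: Basis_le_norm)
    also have "\<dots> \<le> ?S y" using elim(1) by (auto intro!: sum_mono mult_right_mono)
    finally show ?case .
  qed
  then have "((\<lambda>y. inv (M y) b - inv (M x) b) \<longlongrightarrow> 0) (at x)"
    by (rule Lim_null_comparison[OF _ S0])
  then show ?thesis by (simp add: isCont_def LIM_zero_iff)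
qed

lemma has_derivative_inv_family:
  assumes "x \<in> X"
  shows "((\<lambda>y. inv (M y) b) has_derivative
    (\<lambda>u. - (\<Sum>i\<in>Basis. (inv (M x) b \<bullet> i) *\<^sub>R inv (M x) (dir_deriv u (\<lambda>y. M y i) x)))) (at x)"
proof -
  let ?A = "inv (M x)"
  have A: "linear ?A" by (rule linear_inv_family[OF assms])
  have bl: "bounded_linear ?A" using A by (simp add: linear_conv_bounded_linear)
  have "((\<lambda>y. ?A (M y i - M x i)) has_derivative (\<lambda>u. ?A (dir_deriv u (\<lambda>y. M y i) x))) (at x)"
    if "i \<in> Basis" for i
    using bounded_linear.has_derivative[OF bl has_derivative_diff[OF
          smooth_on_imp_has_derivative[OF sm[OF that] assms] has_derivative_const]]
    by simp
  then have "((\<lambda>y. (inv (M y) b \<bullet> i) *\<^sub>R ?A (M y i - M x i)) has_derivative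
      (\<lambda>u. (?A b \<bullet> i) *\<^sub>R ?A (dir_deriv u (\<lambda>y. M y i) x))) (at x)" if "i \<in> Basis" for i
    using isCont_inv_family[OF assms, of b] that
    by (intro has_derivative_scaleR_vanishing)
      (auto simp: linear_0[OF A] intro: continuous_intros)
  then have "((\<lambda>y. ?A b - (\<Sum>i\<in>Basis. (inv (M y) b \<bullet> i) *\<^sub>R ?A (M y i - M x i))) has_derivative
      (\<lambda>u. 0 - (\<Sum>i\<in>Basis. (?A b \<bullet> i) *\<^sub>R ?A (dir_deriv u (\<lambda>y. M y i) x)))) (at x)"
    by (intro has_derivative_diff has_derivative_const has_derivative_sum)
  then have "((\<lambda>y. inv (M y) b) has_derivative
      (\<lambda>u. 0 - (\<Sum>i\<in>Basis. (?A b \<bullet> i) *\<^sub>R ?A (dir_deriv u (\<lambda>y. M y i) x)))) (at x)"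
    by (rule has_derivative_transform_within_open[OF _ X assms])
      (rule inv_family_step[OF assms, symmetric])
  then show ?thesis by simp
qed

lemma smooth_on_inv_family: "smooth_on X (\<lambda>x. inv (M x) b)"
  unfolding smooth_on_def
proof
  fix k show "Ck_on k X (\<lambda>x. inv (M x) b)"
  proof (induction k arbitrary: b)
    case 0 show ?case
      using isCont_inv_family by (simp add: continuous_at_imp_continuous_on)
  next
    case (Suc k)
    let ?D = "\<lambda>u x. (-1) *\<^sub>R (\<Sum>i\<in>Basis. (inv (M x) b \<bullet> i) *\<^sub>R
      (\<Sum>j\<in>Basis. (dir_deriv u (\<lambda>y. M y i) x \<bullet> j) *\<^sub>R inv (M x) j))"
    have D: "((\<lambda>y. inv (M y) b) has_derivative (\<lambda>u. ?D u x)) (at x)" if "x \<in> X" for x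
      using has_derivative_inv_family[OF that, of b]
        linear_Basis_expand[OF linear_inv_family[OF that], of "dir_deriv u (\<lambda>y. M y i) x" for u i]
      by simp
    have "Ck_on k X (\<lambda>x. dir_deriv u (\<lambda>y. M y i) x)" if "i \<in> Basis" for i u
      using smooth_on_dir_deriv[OF sm[OF that]] unfolding smooth_on_def by blast
    then have "Ck_on k X (?D u)" for u
      by (intro Ck_on_scaleR Ck_on_sum X Ck_on_const Suc.IH
          Ck_on_bounded_linear[OF bounded_linear_inner_left])
    then have "Ck_on k X (dir_deriv u (\<lambda>y. inv (M y) b))" for u
      using Ck_on_cong[OF X, of "dir_deriv u (\<lambda>y. inv (M y) b)" "?D u" k]
        frechet_derivative_eqI[OF D] by simp
    then show ?case using D by (auto simp: differentiable_def)
  qed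
qed

end

text \<open>The inverse function theorem for \<open>C\<^sup>1\<close> maps gives a differentiable local inverse \<open>g\<close>. Its derivative is the
  composite of the smooth map \<open>x \<mapsto> (Df x)\<inverse>\<close> with \<open>g\<close>, so each order of differentiability of \<open>g\<close>
  yields the next one.\<close>

lemma smooth_inverse_function:
  fixes f :: "'a::euclidean_space \<Rightarrow> 'a"
  assumes U: "open U" and f: "smooth_on U f" and x0: "x0 \<in> U"
    and inj: "\<And>w. frechet_derivative f (at x0) w = 0 \<Longrightarrow> w = 0"
  obtains U' V g where "open U'" "U' \<subseteq> U" "x0 \<in> U'" "open V" "f x0 \<in> V"
    "homeomorphism U' V f g" "smooth_on V g"
proof -
  let ?D = "\<lambda>x. frechet_derivative f (at x)"
  have lin: "linear (?D x)" if "x \<in> U" for x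
    using linear_frechet_derivative smooth_on_imp_differentiable f that by blast
  then have bl: "bounded_linear (?D x)" if "x \<in> U" for x
    using that by (simp add: linear_conv_bounded_linear)
  define f' where "f' x = Blinfun (?D x)" for x
  have f': "blinfun_apply (f' x) = ?D x" if "x \<in> U" for x
    unfolding f'_def by (rule bounded_linear_Blinfun_apply[OF bl[OF that]])
  have der: "(f has_derivative blinfun_apply (f' x)) (at x)" if "x \<in> U" for x
    using smooth_on_imp_has_derivative[OF f that] f'[OF that] by simp
  have cont: "continuous_on U f'"
  proof (rule continuous_on_blinfun_componentwise)
    fix i :: 'a
    have "continuous_on U (dir_deriv i f)"
      by (rule smooth_on_imp_continuous_on[OF smooth_on_dir_deriv[OF f]])
    then show "continuous_on U (\<lambda>x. blinfun_apply (f' x) i)"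
      using f' by (simp cong: continuous_on_cong)
  qed
  have inj0: "inj (?D x0)" using inj lin[OF x0] by (simp add: linear_injective_0)
  then have "linear (inv (?D x0))" using lin[OF x0] inj_linear_imp_inv_linear by blast
  then have "bounded_linear (inv (?D x0))" by (simp add: linear_conv_bounded_linear)
  then have inv0: "Blinfun (inv (?D x0)) o\<^sub>L f' x0 = id_blinfun"
    using inj0 x0 by (intro blinfun_eqI) (simp add: bounded_linear_Blinfun_apply f' inv_f_f)
  obtain U' V g g' where *: "open U'" "U' \<subseteq> U" "x0 \<in> U'" "open V" "f x0 \<in> V" "homeomorphism U' V f g"
    and g: "\<And>y. y \<in> V \<Longrightarrow> (g has_derivative (g' y)) (at y)"
      "\<And>y. y \<in> V \<Longrightarrow> g' y = inv (blinfun_apply (f' (g y)))"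
      "\<And>y. y \<in> V \<Longrightarrow> bij (blinfun_apply (f' (g y)))"
    using inverse_function_theorem[OF U der cont x0 inv0] by metis
  have gU': "g y \<in> U'" if "y \<in> V" for y using *(6) that by (auto simp: homeomorphism_def)
  have fg: "g ` V = U'" using *(6) by (auto simp: homeomorphism_def)
  have bijD: "bij (?D x)" if "x \<in> U'" for x
    using g(3) fg that f' *(2) by (metis imageE subsetD)
  have smW: "smooth_on U' (\<lambda>x. inv (?D x) b)" for b
  proof (rule smooth_on_inv_family[OF *(1) _ bijD])
    show "linear (?D x)" if "x \<in> U'" for x using lin *(2) that by blast
    show "smooth_on U' (\<lambda>x. ?D x i)" for i
      using smooth_on_subset[OF smooth_on_dir_deriv[OF f] *(2)] .
  qed
  have dg: "dir_deriv v g y = inv (?D (g y)) v" if "y \<in> V" for v y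
    using frechet_derivative_eqI[OF g(1)[OF that]] g(2)[OF that] f' *(2) gU'[OF that] by auto
  have "Ck_on k V g" for k
  proof (induction k)
    case 0 show ?case using *(6) by (simp add: homeomorphism_def)
  next
    case (Suc k)
    have "Ck_on k V (\<lambda>y. inv (?D (g y)) v)" for v
      using Ck_on_compose[OF *(4) Suc, of U' "\<lambda>x. inv (?D x) v"] smW[of v] gU'
      unfolding smooth_on_def by blast
    then have "Ck_on k V (dir_deriv v g)" for v
      using Ck_on_cong[OF *(4), of "dir_deriv v g" "\<lambda>y. inv (?D (g y)) v" k] dg by simp
    then show ?case using g(1) by (auto simp: differentiable_def)
  qed
  then have "smooth_on V g" unfolding smooth_on_def by blast
  with * show ?thesis by (rule that)
qed


lemma span_Basis_subset_expand:
  fixes \<beta> :: "'q::finite \<Rightarrow> 'a::euclidean_space"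
  assumes "inj \<beta>" "range \<beta> \<subseteq> Basis"
  shows "(\<Sum>a\<in>UNIV. c a *\<^sub>R \<beta> a) \<bullet> \<beta> a = c a"
proof -
  have "(\<Sum>a'\<in>UNIV. c a' *\<^sub>R \<beta> a') \<bullet> \<beta> a = (\<Sum>a'\<in>UNIV. if a' = a then c a else 0)"
    unfolding inner_sum_left
    by (rule sum.cong) (use assms in \<open>auto simp: inner_Basis inj_def subset_eq\<close>)
  then show ?thesis by simp
qed

text \<open>The complementary projection: the coordinates with axes \<open>\<beta> a\<close> are set to \<open>0\<close>.\<close>

definition kill_axes :: "('q::finite \<Rightarrow> 'a::euclidean_space) \<Rightarrow> 'a \<Rightarrow> 'a" where
  "kill_axes \<beta> z = z - (\<Sum>a\<in>UNIV. (z \<bullet> \<beta> a) *\<^sub>R \<beta> a)"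

lemma linear_kill_axes: "linear (kill_axes \<beta>)"
  unfolding kill_axes_def
  by (intro linearI)
    (simp_all add: inner_add_left scaleR_add_left sum.distrib scaleR_sum_right scaleR_diff_right)

lemma kill_axes_inner:
  "inj \<beta> \<Longrightarrow> range \<beta> \<subseteq> Basis \<Longrightarrow> kill_axes \<beta> z \<bullet> \<beta> a = 0"
  unfolding kill_axes_def inner_diff_left using span_Basis_subset_expand[of \<beta> "\<lambda>a. z \<bullet> \<beta> a" a] by simp

lemma kill_axes_add:
  assumes "inj \<beta>" "range \<beta> \<subseteq> Basis"
  shows "kill_axes \<beta> (kill_axes \<beta> z + (\<Sum>a\<in>UNIV. c a *\<^sub>R \<beta> a)) = kill_axes \<beta> z"
proof -
  have "(kill_axes \<beta> z + (\<Sum>a\<in>UNIV. c a *\<^sub>R \<beta> a)) \<bullet> \<beta> a = c a" for a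
    by (simp add: inner_add_left kill_axes_inner[OF assms] span_Basis_subset_expand[OF assms])
  then show ?thesis by (simp add: kill_axes_def[of \<beta> "kill_axes \<beta> z + x" for x])
qed

lemma kill_axes_idem: "inj \<beta> \<Longrightarrow> range \<beta> \<subseteq> Basis \<Longrightarrow> kill_axes \<beta> (kill_axes \<beta> z) = kill_axes \<beta> z"
  using kill_axes_add[of \<beta> z "\<lambda>_. 0"] by simp

lemma kill_axes_eq_0_span: "kill_axes \<beta> w = 0 \<Longrightarrow> w \<in> span (range \<beta>)"
  unfolding kill_axes_def by (metis (no_types, lifting) eq_iff_diff_eq_0 rangeI span_base span_scale span_sum)

lemma kill_axes_eqI:
  assumes "kill_axes \<beta> z = kill_axes \<beta> w" "\<And>a. z \<bullet> \<beta> a = w \<bullet> \<beta> a"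
  shows "z = w"
  using assms unfolding kill_axes_def by simp

text \<open>The implicit function theorem, in a form that solves \<open>f = 0\<close> for the \<open>q\<close> coordinates with axes
  \<open>\<beta> a\<close>: it is the inverse function theorem for the map that replaces these coordinates of \<open>z\<close> by
  the components of \<open>f z\<close>.\<close>

lemma implicit_graph:
  fixes f :: "'a::euclidean_space \<Rightarrow> real^'q::finite" and \<beta> :: "'q \<Rightarrow> 'a"
  assumes U: "open U" and f: "smooth_on U f" and z0: "z0 \<in> U" and fz0: "f z0 = 0"
    and \<beta>: "inj \<beta>" "range \<beta> \<subseteq> Basis"
    and inj: "\<And>w. w \<in> span (range \<beta>) \<Longrightarrow> frechet_derivative f (at z0) w = 0 \<Longrightarrow> w = 0"
  obtains N D H where "open N" "z0 \<in> N" "N \<subseteq> U" "open D" "smooth_on D H"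
    "\<forall>z\<in>N. kill_axes \<beta> z \<in> D"
    "\<forall>z\<in>N. f z = 0 \<longleftrightarrow> z = H (kill_axes \<beta> z)"
    "\<forall>z\<in>N. f z = 0 \<longleftrightarrow> (\<forall>a. z \<bullet> \<beta> a = H (kill_axes \<beta> z) \<bullet> \<beta> a)"
    "\<forall>y\<in>D. kill_axes \<beta> y = y \<longrightarrow> H y \<in> U \<and> f (H y) = 0 \<and> kill_axes \<beta> (H y) = y"
proof -
  let ?P = "kill_axes \<beta>"
  define G where "G z = ?P z + (\<Sum>a\<in>UNIV. (f z $ a) *\<^sub>R \<beta> a)" for z
  have smG: "smooth_on U G"
    unfolding G_def
    by (intro smooth_on_add smooth_on_sum smooth_on_scaleR smooth_on_vec_nth smooth_on_const U f
        smooth_on_linear linear_kill_axes)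
  have DG: "(G has_derivative (\<lambda>w. ?P w + (\<Sum>a\<in>UNIV. (frechet_derivative f (at z0) w $ a) *\<^sub>R \<beta> a))) (at z0)"
    unfolding G_def
    by (intro has_derivative_add has_derivative_sum has_derivative_scaleR_left
        bounded_linear.has_derivative[OF bounded_linear_vec_nth]
        smooth_on_imp_has_derivative[OF f z0] bounded_linear_imp_has_derivative)
      (simp add: linear_conv_bounded_linear[symmetric] linear_kill_axes)
  have PG: "?P (G z) = ?P z" for z unfolding G_def by (rule kill_axes_add[OF \<beta>])
  have Gb: "G z \<bullet> \<beta> a = f z $ a" for z a
    unfolding G_def by (simp add: inner_add_left kill_axes_inner[OF \<beta>] span_Basis_subset_expand[OF \<beta>])
  have injG: "w = 0" if "frechet_derivative G (at z0) w = 0" for w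
  proof -
    have eq: "?P w + (\<Sum>a\<in>UNIV. (frechet_derivative f (at z0) w $ a) *\<^sub>R \<beta> a) = 0"
      using that frechet_derivative_eqI[OF DG] by simp
    then have "frechet_derivative f (at z0) w $ a = 0" for a
      using span_Basis_subset_expand[OF \<beta>, of "\<lambda>a. frechet_derivative f (at z0) w $ a" a]
        kill_axes_inner[OF \<beta>, of w a] by (metis inner_add_left inner_zero_left add_0)
    then have "frechet_derivative f (at z0) w = 0" by (simp add: vec_eq_iff)
    moreover have "?P w = 0" using eq \<open>frechet_derivative f (at z0) w = 0\<close> by simp
    ultimately show ?thesis using inj kill_axes_eq_0_span by blast
  qed
  obtain U' V H where *: "open U'" "U' \<subseteq> U" "z0 \<in> U'" "open V" "G z0 \<in> V"
    "homeomorphism U' V G H" "smooth_on V H"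
    using smooth_inverse_function[OF U smG z0 injG] by metis
  have HG: "H (G z) = z" if "z \<in> U'" for z using *(6) that by (simp add: homeomorphism_def)
  have GH: "G (H y) = y" "H y \<in> U'" if "y \<in> V" for y
    using *(6) that by (auto simp: homeomorphism_def)
  define N where "N = {z \<in> U'. ?P z \<in> V}"
  have f0: "f z = 0 \<longleftrightarrow> G z = ?P z" for z
  proof
    assume "f z = 0" then show "G z = ?P z" by (simp add: G_def)
  next
    assume "G z = ?P z" then show "f z = 0"
      using Gb[of z] kill_axes_inner[OF \<beta>, of z] by (simp add: vec_eq_iff)
  qed
  have sol: "H y \<in> U \<and> f (H y) = 0 \<and> ?P (H y) = y" if "y \<in> V" "?P y = y" for y
  proof -
    have "?P (H y) = y" using PG[of "H y"] GH(1)[OF that(1)] that(2) by simp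
    then show ?thesis using GH[OF that(1)] f0[of "H y"] *(2) by auto
  qed
  have PP: "?P (?P z) = ?P z" for z by (rule kill_axes_idem[OF \<beta>])
  have graph: "f z = 0 \<longleftrightarrow> z = H (?P z)" if "z \<in> N" for z
    using that f0[of z] HG[of z] sol[of "?P z"] PP unfolding N_def by auto
  have graph': "f z = 0 \<longleftrightarrow> (\<forall>a. z \<bullet> \<beta> a = H (?P z) \<bullet> \<beta> a)" if "z \<in> N" for z
  proof
    assume "f z = 0" then show "\<forall>a. z \<bullet> \<beta> a = H (?P z) \<bullet> \<beta> a" using graph[OF that] by metis
  next
    assume "\<forall>a. z \<bullet> \<beta> a = H (?P z) \<bullet> \<beta> a"
    moreover have "?P (H (?P z)) = ?P z" using sol[of "?P z"] that PP by (simp add: N_def)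
    ultimately have "z = H (?P z)" by (metis kill_axes_eqI)
    then show "f z = 0" using graph[OF that] by blast
  qed
  show ?thesis
  proof (rule that[of N V H])
    show "open N" unfolding N_def
      by (rule open_preimage_smooth[OF smooth_on_linear[OF linear_kill_axes *(1)] *(1,4)])
    show "z0 \<in> N" using *(3,5) f0[of z0] fz0 by (simp add: N_def)
    show "N \<subseteq> U" using *(2) by (auto simp: N_def)
    show "\<forall>z\<in>N. ?P z \<in> V" by (simp add: N_def)
    show "\<forall>z\<in>N. f z = 0 \<longleftrightarrow> z = H (?P z)" using graph by blast
    show "\<forall>z\<in>N. f z = 0 \<longleftrightarrow> (\<forall>a. z \<bullet> \<beta> a = H (?P z) \<bullet> \<beta> a)" using graph' by blast
    show "\<forall>y\<in>V. ?P y = y \<longrightarrow> H y \<in> U \<and> f (H y) = 0 \<and> ?P (H y) = y" using sol by blast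
  qed (use * in auto)
qed

text \<open>If the images of certain axes span \<open>\<real>\<^sup>q\<close>, the images of some \<open>q\<close> of them form a basis, so that \<open>L\<close>
  is injective on the span of these axes. They are the coordinates for which the implicit function theorem can solve.\<close>

lemma select_independent_axes:
  fixes L :: "'a::euclidean_space \<Rightarrow> real^'q::finite"
  assumes L: "linear L" and B: "B \<subseteq> Basis" and onto: "L ` span B = UNIV"
  obtains \<beta> :: "'q \<Rightarrow> 'a" where "inj \<beta>" "range \<beta> \<subseteq> B"
    "\<And>w. w \<in> span (range \<beta>) \<Longrightarrow> L w = 0 \<Longrightarrow> w = 0"
proof -
  have "span (L ` B) = UNIV" using onto linear_span_image[OF L, of B] by simp
  then obtain C where C: "C \<subseteq> L ` B" "independent C" "card C = CARD('q)"
    using basis_exists[of "L ` B"] dim_span[of "L ` B"]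
    by (metis dim_UNIV DIM_cart DIM_real mult_1_right)
  have "finite C" using C(2) by (rule independent_imp_finite)
  then obtain e :: "'q \<Rightarrow> real^'q" where e: "bij_betw e UNIV C"
    using C(3) finite_same_card_bij[of "UNIV :: 'q set" C] by auto
  define \<beta> where "\<beta> a = (SOME b. b \<in> B \<and> L b = e a)" for a
  have \<beta>: "\<beta> a \<in> B \<and> L (\<beta> a) = e a" for a
  proof -
    have "e a \<in> L ` B" using C(1) bij_betwE[OF e] by auto
    then have "\<exists>b. b \<in> B \<and> L b = e a" by auto
    then show ?thesis unfolding \<beta>_def by (rule someI_ex)
  qed
  have inj\<beta>: "inj \<beta>" using e \<beta> by (metis bij_betw_def inj_def)
  have "L ` range \<beta> = C" using e \<beta> by (auto simp: bij_betw_def image_iff)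
  moreover have "inj_on L (range \<beta>)" using \<beta> e by (auto simp: inj_on_def bij_betw_def)
  ultimately have "inj_on L (span (range \<beta>))"
    using C(2) linear_inj_on_span_independent_image[OF L] by metis
  then have "w = 0" if "w \<in> span (range \<beta>)" "L w = 0" for w
    using that linear_0[OF L] span_0 by (metis inj_onD)
  then show ?thesis using that inj\<beta> \<beta> by blast
qed

section \<open>Manifolds in charts\<close>

text \<open>The part of the structure of a manifold on which the calculus of tangent vectors rests. It is
  isolated because it has to be applied to the jet charts of all adapted charts, which form an atlas
  but not a maximal one.\<close>

definition smooth_atlas :: "('p, 'a::euclidean_space) chart set \<Rightarrow> bool" where
  "smooth_atlas A \<longleftrightarrow> (\<forall>c\<in>A. is_chart c) \<and> (\<forall>c\<in>A. \<forall>d\<in>A. compatible_charts c d)"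

lemma param_coord: "is_chart c \<Longrightarrow> p \<in> dom_ch c \<Longrightarrow> param c (coord c p) = p"
  by (simp add: param_def is_chart_def inv_into_f_f)

lemma coord_param: "z \<in> coord c ` dom_ch c \<Longrightarrow> coord c (param c z) = z"
  by (simp add: param_def f_inv_into_f)

lemma param_in_dom: "z \<in> coord c ` dom_ch c \<Longrightarrow> param c z \<in> dom_ch c"
  by (simp add: param_def inv_into_into)

lemma param_in_Int:
  "is_chart c \<Longrightarrow> z \<in> coord c ` (dom_ch c \<inter> D) \<Longrightarrow> param c z \<in> dom_ch c \<inter> D"
  using param_coord by fastforce

lemma smooth_atlas_chart: "smooth_atlas A \<Longrightarrow> c \<in> A \<Longrightarrow> is_chart c"
  by (simp add: smooth_atlas_def)

lemma open_chart_image: "smooth_atlas A \<Longrightarrow> c \<in> A \<Longrightarrow> open (coord c ` dom_ch c)"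
  by (simp add: smooth_atlas_def is_chart_def)

lemma open_overlap: "smooth_atlas A \<Longrightarrow> c \<in> A \<Longrightarrow> d \<in> A \<Longrightarrow> open (coord c ` (dom_ch c \<inter> dom_ch d))"
  by (simp add: smooth_atlas_def compatible_charts_def)

lemma smooth_transition:
  "smooth_atlas A \<Longrightarrow> c \<in> A \<Longrightarrow> d \<in> A \<Longrightarrow>
    smooth_on (coord c ` (dom_ch c \<inter> dom_ch d)) (\<lambda>z. coord d (param c z))"
  by (simp add: smooth_atlas_def compatible_charts_def comp_def)

lemma charts_at_in: "c \<in> charts_at A p \<Longrightarrow> c \<in> A" "c \<in> charts_at A p \<Longrightarrow> p \<in> dom_ch c"
  by (simp_all add: charts_at_def)

lemma smooth_manifold_imp_smooth_atlas: "smooth_manifold A \<Longrightarrow> smooth_atlas A"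
  unfolding smooth_manifold_def smooth_atlas_def by blast

lemma atlas_open_chart: "atlas_open A W \<Longrightarrow> c \<in> A \<Longrightarrow> open (coord c ` (W \<inter> dom_ch c))"
  by (simp add: atlas_open_def)

text \<open>Seen in another chart, the image of \<open>V\<close> is a preimage of \<open>V\<close> under the transition map, hence
  open.\<close>

lemma atlas_open_param_image:
  assumes A: "smooth_atlas A" and c: "c \<in> A" and V: "open V" "V \<subseteq> coord c ` dom_ch c"
  shows "atlas_open A (param c ` V)"
  unfolding atlas_open_def
proof (intro conjI ballI)
  show "param c ` V \<subseteq> carrier_of A"
    using V param_in_dom[of _ c] c unfolding carrier_of_def by blast
  fix d assume d: "d \<in> A"
  let ?T = "{y \<in> coord d ` (dom_ch d \<inter> dom_ch c). coord c (param d y) \<in> V}"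
  have "coord d ` (param c ` V \<inter> dom_ch d) = ?T"
  proof (intro equalityI subsetI)
    fix y assume "y \<in> coord d ` (param c ` V \<inter> dom_ch d)"
    then obtain z where z: "z \<in> V" "param c z \<in> dom_ch d" "y = coord d (param c z)" by auto
    moreover from z(1) V(2) have "z \<in> coord c ` dom_ch c" by blast
    moreover have "param d y = param c z"
      using z param_coord[OF smooth_atlas_chart[OF A d] z(2)] by simp
    ultimately show "y \<in> ?T"
      using param_in_dom[of z c] coord_param[of z c] by simp
  next
    fix y assume "y \<in> ?T"
    then obtain p where p: "p \<in> dom_ch d" "p \<in> dom_ch c" "y = coord d p" "coord c (param d y) \<in> V"
      by auto
    then have "coord c p \<in> V" using param_coord smooth_atlas_chart[OF A d] by metis
    then have "p \<in> param c ` V" using param_coord smooth_atlas_chart[OF A c] p by (metis imageI)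
    then show "y \<in> coord d ` (param c ` V \<inter> dom_ch d)" using p by auto
  qed
  moreover have "open ?T"
    by (rule open_preimage_smooth[OF smooth_transition[OF A d c] open_overlap[OF A d c] V(1)])
  ultimately show "open (coord d ` (param c ` V \<inter> dom_ch d))" by simp
qed

lemma smooth_atlas_euclid: "smooth_atlas euclid"
  unfolding smooth_atlas_def euclid_def is_chart_def compatible_charts_def
  by (auto simp: param_def inv_into_def comp_def intro!: smooth_on_id)

lemma param_euclid: "param (UNIV, \<lambda>x. x) = (\<lambda>x. x)"
  by (auto simp: param_def inv_into_def)

lemma charts_at_euclid: "charts_at euclid x = {(UNIV, \<lambda>x. x)}"
  by (auto simp: charts_at_def euclid_def)

text \<open>Smoothness provides some pair of charts around each point. As transition maps are smooth, a
  map can then be read in any given pair of charts.\<close>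

lemma smooth_map_in_charts:
  fixes A :: "('p, 'a::euclidean_space) chart set" and B :: "('r, 'c::euclidean_space) chart set"
  assumes A: "smooth_atlas A" and B: "smooth_atlas B" and f: "smooth_map A B W f"
    and p: "p \<in> W" and c: "c \<in> charts_at A p" and d: "d \<in> charts_at B (f p)"
  obtains N where "open N" "coord c p \<in> N" "N \<subseteq> coord c ` dom_ch c" "param c ` N \<subseteq> W"
    "f ` param c ` N \<subseteq> dom_ch d" "smooth_on N (\<lambda>z. coord d (f (param c z)))"
proof -
  note c' = charts_at_in[OF c] and d' = charts_at_in[OF d]
  obtain c0 d0 N0 where *: "c0 \<in> A" "d0 \<in> B" "atlas_open A N0" "p \<in> N0" "N0 \<subseteq> W \<inter> dom_ch c0"
    "f ` N0 \<subseteq> dom_ch d0" and sm: "smooth_on (coord c0 ` N0) (coord d0 \<circ> f \<circ> param c0)"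
    using f p unfolding smooth_map_def by metis
  note Ac0 = smooth_atlas_chart[OF A *(1)] and Ac = smooth_atlas_chart[OF A c'(1)]
    and Bd0 = smooth_atlas_chart[OF B *(2)]
  have oN0: "open (coord c0 ` N0)"
    using atlas_open_chart[OF *(3,1)] *(5) by (metis Int_absorb2 le_inf_iff)
  let ?O = "coord c ` (dom_ch c \<inter> dom_ch c0)" and ?\<tau> = "\<lambda>z. coord c0 (param c z)"
  define N1 where "N1 = {z \<in> ?O. ?\<tau> z \<in> coord c0 ` N0}"
  have oN1: "open N1" unfolding N1_def
    by (rule open_preimage_smooth[OF smooth_transition[OF A c'(1) *(1)] open_overlap[OF A c'(1) *(1)] oN0])
  have N1: "param c z \<in> N0" "param c z \<in> dom_ch c" if z: "z \<in> N1" for z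
  proof -
    have "param c z \<in> dom_ch c \<inter> dom_ch c0" using that param_in_Int[OF Ac, of z "dom_ch c0"] unfolding N1_def by blast
    moreover obtain q where "q \<in> N0" "?\<tau> z = coord c0 q" using z unfolding N1_def by blast
    ultimately show "param c z \<in> N0" "param c z \<in> dom_ch c"
      using Ac0 *(5) unfolding is_chart_def by (auto dest: inj_onD)
  qed
  let ?g = "\<lambda>z. coord d0 (f (param c z))"
  have g: "smooth_on N1 ?g"
  proof -
    have "smooth_on N1 (\<lambda>z. (coord d0 \<circ> f \<circ> param c0) (?\<tau> z))"
      using smooth_on_subset[OF smooth_transition[OF A c'(1) *(1)], of N1]
      by (intro smooth_on_compose[OF oN1 _ sm]) (auto simp: N1_def)
    moreover have "(coord d0 \<circ> f \<circ> param c0) (?\<tau> z) = ?g z" if "z \<in> N1" for z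
    proof -
      have "param c z \<in> dom_ch c0" using N1(1)[OF that] *(5) by blast
      then show ?thesis by (simp add: param_coord[OF Ac0])
    qed
    ultimately show ?thesis by (rule smooth_on_transform[OF _ oN1])
  qed
  define N where "N = {z \<in> N1. ?g z \<in> coord d0 ` (dom_ch d0 \<inter> dom_ch d)}"
  have oN: "open N" unfolding N_def
    by (rule open_preimage_smooth[OF g oN1 open_overlap[OF B *(2) d'(1)]])
  have fN: "f (param c z) \<in> dom_ch d" "param d0 (?g z) = f (param c z)" if "z \<in> N" for z
  proof -
    have "f (param c z) \<in> dom_ch d0" using N1[of z] that *(6) by (auto simp: N_def)
    then show eq: "param d0 (?g z) = f (param c z)" by (rule param_coord[OF Bd0])
    show "f (param c z) \<in> dom_ch d"
      using that param_in_Int[OF Bd0, of "?g z" "dom_ch d"] eq by (simp add: N_def)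
  qed
  show ?thesis
  proof (rule that[OF oN])
    show "coord c p \<in> N"
      unfolding N_def N1_def using c' d' * Ac param_coord[of c p] by auto
    show "N \<subseteq> coord c ` dom_ch c" by (auto simp: N_def N1_def)
    show "param c ` N \<subseteq> W" using N1 *(5) by (auto simp: N_def)
    show "f ` param c ` N \<subseteq> dom_ch d" using fN by auto
    have "smooth_on N (\<lambda>z. coord d (param d0 (?g z)))"
      using smooth_on_subset[OF g, of N]
      by (intro smooth_on_compose[OF oN _ smooth_transition[OF B *(2) d'(1)]]) (auto simp: N_def)
    then show "smooth_on N (\<lambda>z. coord d (f (param c z)))"
      by (rule smooth_on_transform[OF _ oN]) (simp add: fN)
  qed
qed

subsection \<open>Tangent vectors in a chart\<close>

lemma coord_in_overlap:
  "c \<in> charts_at A p \<Longrightarrow> d \<in> charts_at A p \<Longrightarrow> coord c p \<in> coord c ` (dom_ch c \<inter> dom_ch d)"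
  by (auto simp: charts_at_def)

text \<open>The chain rule for \<open>g \<circ> c\<inverse> = (g \<circ> d\<inverse>) \<circ> (d \<circ> c\<inverse>)\<close>. With \<open>g\<close> a third coordinate map this is the
  cocycle rule for the derivatives of transition maps.\<close>

lemma frechet_change_chart:
  fixes A :: "('p, 'a::euclidean_space) chart set" and g :: "'p \<Rightarrow> 'b::real_normed_vector"
  assumes A: "smooth_atlas A" and c: "c \<in> charts_at A p" and d: "d \<in> charts_at A p"
    and g: "(\<lambda>z. g (param d z)) differentiable (at (coord d p))"
  shows "frechet_derivative (\<lambda>z. g (param c z)) (at (coord c p)) w =
    frechet_derivative (\<lambda>z. g (param d z)) (at (coord d p))
      (frechet_derivative (\<lambda>z. coord d (param c z)) (at (coord c p)) w)"
    and "(\<lambda>z. g (param c z)) differentiable (at (coord c p))"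
proof -
  note c' = charts_at_in[OF c] and d' = charts_at_in[OF d]
  note Ac = smooth_atlas_chart[OF A c'(1)] and Ad = smooth_atlas_chart[OF A d'(1)]
  let ?O = "coord c ` (dom_ch c \<inter> dom_ch d)" and ?\<tau> = "\<lambda>z. coord d (param c z)"
  have \<tau>: "?\<tau> differentiable (at (coord c p))"
    using smooth_on_imp_differentiable[OF smooth_transition[OF A c'(1) d'(1)] coord_in_overlap[OF c d]] .
  have \<tau>p: "?\<tau> (coord c p) = coord d p" by (simp add: param_coord[OF Ac c'(2)])
  have eq: "g (param d (?\<tau> z)) = g (param c z)" if "z \<in> ?O" for z
    using param_coord[OF Ad, of "param c z"] param_in_Int[OF Ac that] by simp
  have D: "((\<lambda>z. g (param d (?\<tau> z))) has_derivative (\<lambda>w. frechet_derivative (\<lambda>z. g (param d z)) (at (coord d p))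
      (frechet_derivative ?\<tau> (at (coord c p)) w))) (at (coord c p))"
    using frechet_derivative_comp[OF \<tau>, of "\<lambda>z. g (param d z)"] g \<tau>p by simp
  have "((\<lambda>z. g (param c z)) has_derivative (\<lambda>w. frechet_derivative (\<lambda>z. g (param d z)) (at (coord d p))
      (frechet_derivative ?\<tau> (at (coord c p)) w))) (at (coord c p))"
    by (rule has_derivative_transform_within_open[OF D open_overlap[OF A c'(1) d'(1)] coord_in_overlap[OF c d]])
      (rule eq)
  from frechet_derivative_eqI[OF this] differentiableI[OF this]
  show "frechet_derivative (\<lambda>z. g (param c z)) (at (coord c p)) w =
    frechet_derivative (\<lambda>z. g (param d z)) (at (coord d p))
      (frechet_derivative (\<lambda>z. coord d (param c z)) (at (coord c p)) w)"
    "(\<lambda>z. g (param c z)) differentiable (at (coord c p))"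
    by (auto simp: frechet_derivative_eqI differentiable_def)
qed

lemma transition_differentiable:
  "smooth_atlas A \<Longrightarrow> c \<in> charts_at A p \<Longrightarrow> d \<in> charts_at A p \<Longrightarrow>
    (\<lambda>z. coord d (param c z)) differentiable (at (coord c p))"
  using smooth_on_imp_differentiable[OF smooth_transition[of A c d] coord_in_overlap[of c A p d]]
    charts_at_in(1)[of c A p] charts_at_in(1)[of d A p] by blast

lemma frechet_transition_self:
  assumes A: "smooth_atlas A" and c: "c \<in> charts_at A p"
  shows "frechet_derivative (\<lambda>z. coord c (param c z)) (at (coord c p)) w = w"
proof -
  have "frechet_derivative (\<lambda>z. coord c (param c z)) (at (coord c p)) = frechet_derivative (\<lambda>z. z) (at (coord c p))"
    using charts_at_in[OF c] coord_param[of _ c]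
    by (intro frechet_derivative_cong_open[OF open_chart_image[OF A charts_at_in(1)[OF c]]]) auto
  then show ?thesis by simp
qed

text \<open>Evaluation at a chart identifies the tangent space with the coordinate space; this is the
  inverse of that identification.\<close>

definition lift_tvec :: "('p, 'a::euclidean_space) chart set \<Rightarrow> 'p \<Rightarrow> ('p, 'a) chart \<Rightarrow> 'a \<Rightarrow> ('p, 'a) tvec" where
  "lift_tvec A p c w = (\<lambda>d. if d \<in> charts_at A p
     then frechet_derivative (\<lambda>z. coord d (param c z)) (at (coord c p)) w else 0)"

lemma tangent_spaceI:
  assumes "\<And>d. d \<notin> charts_at A p \<Longrightarrow> v d = 0"
    "\<And>d e. d \<in> charts_at A p \<Longrightarrow> e \<in> charts_at A p \<Longrightarrow>
      v e = frechet_derivative (\<lambda>z. coord e (param d z)) (at (coord d p)) (v d)"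
  shows "v \<in> tangent_space A p"
  using assms unfolding tangent_space_def comp_def by blast

lemma tangent_space_outside: "v \<in> tangent_space A p \<Longrightarrow> d \<notin> charts_at A p \<Longrightarrow> v d = 0"
  unfolding tangent_space_def by blast

lemma lift_tvec_in:
  assumes A: "smooth_atlas A" and c: "c \<in> charts_at A p"
  shows "lift_tvec A p c w \<in> tangent_space A p"
proof (rule tangent_spaceI)
  fix d e assume de: "d \<in> charts_at A p" "e \<in> charts_at A p"
  show "lift_tvec A p c w e
    = frechet_derivative (\<lambda>z. coord e (param d z)) (at (coord d p)) (lift_tvec A p c w d)"
    unfolding lift_tvec_def if_P[OF de(1)] if_P[OF de(2)]
    by (rule frechet_change_chart(1)[OF A c de(1) transition_differentiable[OF A de]])
qed (simp add: lift_tvec_def)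

lemma lift_tvec_apply:
  assumes A: "smooth_atlas A" and c: "c \<in> charts_at A p"
  shows "lift_tvec A p c w c = w"
  using frechet_transition_self[OF A c] c by (simp add: lift_tvec_def)

lemma tangent_space_transition:
  "v \<in> tangent_space A p \<Longrightarrow> c \<in> charts_at A p \<Longrightarrow> d \<in> charts_at A p \<Longrightarrow>
    v d = frechet_derivative (\<lambda>z. coord d (param c z)) (at (coord c p)) (v c)"
  unfolding tangent_space_def comp_def by blast

lemma tvec_eqI:
  assumes "v \<in> tangent_space A p" "w \<in> tangent_space A p" "c \<in> charts_at A p" "v c = w c"
  shows "v = w"
proof
  fix d show "v d = w d"
    using assms tangent_space_transition[of _ A p c d] tangent_space_outside[of _ A p d]
    by (cases "d \<in> charts_at A p") metis+
qed

lemma zero_tvec_in: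
  assumes "smooth_atlas A" shows "zero_tvec \<in> tangent_space A p"
  using linear_0[OF linear_frechet_derivative[OF transition_differentiable[OF assms]]]
  by (simp add: tangent_space_def zero_tvec_def comp_def)

lemma tangent_space_add:
  assumes "smooth_atlas A" "v \<in> tangent_space A p" "w \<in> tangent_space A p"
  shows "(\<lambda>c. v c + w c) \<in> tangent_space A p"
proof (rule tangent_spaceI)
  fix d e assume "d \<in> charts_at A p" "e \<in> charts_at A p"
  then show "v e + w e = frechet_derivative (\<lambda>z. coord e (param d z)) (at (coord d p)) (v d + w d)"
    using linear_add[OF linear_frechet_derivative[OF transition_differentiable[OF assms(1)]]]
      tangent_space_transition assms by metis
qed (simp add: tangent_space_outside[OF assms(2)] tangent_space_outside[OF assms(3)])

text \<open>The tangent map is computed in a chosen chart of the domain, but by the chain rule any other one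
  gives the same result.\<close>

lemma tangent_map_chart:
  fixes A :: "('p, 'a::euclidean_space) chart set" and B :: "('r, 'c::euclidean_space) chart set"
  assumes A: "smooth_atlas A" and B: "smooth_atlas B" and f: "smooth_map A B W f"
    and p: "p \<in> W" and c: "c \<in> charts_at A p" and d: "d \<in> charts_at B (f p)"
    and v: "v \<in> tangent_space A p"
  shows "tangent_map A B f p v d = frechet_derivative (\<lambda>z. coord d (f (param c z))) (at (coord c p)) (v c)"
proof -
  define c0 where "c0 = (SOME c. c \<in> charts_at A p)"
  have c0: "c0 \<in> charts_at A p" unfolding c0_def using c by (rule someI)
  obtain N where "open N" "coord c0 p \<in> N" "smooth_on N (\<lambda>z. coord d (f (param c0 z)))"
    using smooth_map_in_charts[OF A B f p c0 d] by metis
  then have "(\<lambda>z. coord d (f (param c0 z))) differentiable (at (coord c0 p))"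
    using smooth_on_imp_differentiable by blast
  from frechet_change_chart(1)[OF A c c0 this, of "v c"] show ?thesis
    unfolding tangent_map_def Let_def c0_def[symmetric]
    using d tangent_space_transition[OF v c c0] by (simp add: comp_def)
qed

text \<open>A single chart of the target detects whether a tangent vector is mapped to zero, because the
  components in all other charts are its images under derivatives of transition maps.\<close>

lemma tangent_map_eq_zero_iff:
  fixes A :: "('p, 'a::euclidean_space) chart set" and B :: "('r, 'c::euclidean_space) chart set"
  assumes A: "smooth_atlas A" and B: "smooth_atlas B" and f: "smooth_map A B W f"
    and p: "p \<in> W" and c: "c \<in> charts_at A p" and d: "d \<in> charts_at B (f p)"
    and v: "v \<in> tangent_space A p"
  shows "tangent_map A B f p v = zero_tvec \<longleftrightarrow>
    frechet_derivative (\<lambda>z. coord d (f (param c z))) (at (coord c p)) (v c) = 0"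
proof
  assume "tangent_map A B f p v = zero_tvec"
  then show "frechet_derivative (\<lambda>z. coord d (f (param c z))) (at (coord c p)) (v c) = 0"
    using tangent_map_chart[OF assms] by (simp add: zero_tvec_def)
next
  let ?g = "\<lambda>z. coord d (f (param c z))"
  assume 0: "frechet_derivative ?g (at (coord c p)) (v c) = 0"
  obtain N where N: "open N" "coord c p \<in> N" "N \<subseteq> coord c ` dom_ch c" "f ` param c ` N \<subseteq> dom_ch d" "smooth_on N ?g"
    using smooth_map_in_charts[OF A B f p c d] by metis
  have cp: "param c (coord c p) = p"
    using param_coord smooth_atlas_chart[OF A] charts_at_in[OF c] by metis
  have "tangent_map A B f p v e = 0" for e
  proof (cases "e \<in> charts_at B (f p)")
    case True
    obtain N' where N': "open N'" "coord c p \<in> N'" "f ` param c ` N' \<subseteq> dom_ch e"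
      using smooth_map_in_charts[OF A B f p c True] by metis
    have eq: "coord e (param d (?g z)) = coord e (f (param c z))" if "z \<in> N \<inter> N'" for z
    proof -
      have "f (param c z) \<in> dom_ch d" using that N(4) by blast
      then show ?thesis by (simp add: param_coord[OF smooth_atlas_chart[OF B charts_at_in(1)[OF d]]])
    qed
    have "((\<lambda>z. coord e (param d (?g z))) has_derivative (\<lambda>w.
        frechet_derivative (\<lambda>z. coord e (param d z)) (at (?g (coord c p))) (frechet_derivative ?g (at (coord c p)) w)))
        (at (coord c p))"
      using transition_differentiable[OF B d True] cp smooth_on_imp_differentiable[OF N(5,2)]
      by (intro frechet_derivative_comp) auto
    then have "((\<lambda>z. coord e (f (param c z))) has_derivative (\<lambda>w.
        frechet_derivative (\<lambda>z. coord e (param d z)) (at (?g (coord c p))) (frechet_derivative ?g (at (coord c p)) w)))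
        (at (coord c p))"
      by (rule has_derivative_transform_within_open[of _ _ _ _ "N \<inter> N'"]) (use N N' eq in auto)
    from frechet_derivative_eqI[OF this]
    show ?thesis
      using tangent_map_chart[OF A B f p c True v] 0 cp
        linear_0[OF linear_frechet_derivative[OF transition_differentiable[OF B d True]]] by simp
  qed (simp add: tangent_map_def Let_def)
  then show "tangent_map A B f p v = zero_tvec" by (auto simp: zero_tvec_def)
qed

lemma differential_chart:
  fixes A :: "('p, 'a::euclidean_space) chart set" and F :: "'p \<Rightarrow> 'c::euclidean_space"
  assumes "smooth_atlas A" "smooth_map A euclid W F" "p \<in> W" "c \<in> charts_at A p" "v \<in> tangent_space A p"
  shows "differential A F p v = frechet_derivative (\<lambda>z. F (param c z)) (at (coord c p)) (v c)"
  using tangent_map_chart[OF assms(1) smooth_atlas_euclid assms(2-4), of "(UNIV, \<lambda>x. x)"] assms(5)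
  by (simp add: differential_def charts_at_euclid)

lemma smooth_function_in_chart:
  fixes A :: "('p, 'a::euclidean_space) chart set" and F :: "'p \<Rightarrow> 'c::euclidean_space"
  assumes "smooth_atlas A" "smooth_map A euclid W F" "p \<in> W" "c \<in> charts_at A p"
  obtains N where "open N" "coord c p \<in> N" "N \<subseteq> coord c ` dom_ch c" "param c ` N \<subseteq> W"
    "smooth_on N (\<lambda>z. F (param c z))"
  using smooth_map_in_charts[OF assms(1) smooth_atlas_euclid assms(2-4), of "(UNIV, \<lambda>x. x)"]
  by (auto simp: charts_at_euclid)

subsection \<open>Tangent vectors as velocities\<close>

lemma frechet_vector_derivative_compose:
  assumes "(\<delta> has_vector_derivative w) (at t)" "\<tau> differentiable (at (\<delta> t))"
  shows "((\<lambda>t. \<tau> (\<delta> t)) has_vector_derivative frechet_derivative \<tau> (at (\<delta> t)) w) (at t)"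
proof -
  have "((\<lambda>t. \<tau> (\<delta> t)) has_derivative (\<lambda>h. frechet_derivative \<tau> (at (\<delta> t)) (h *\<^sub>R w))) (at t)"
    using has_derivative_compose[of \<delta> _ t UNIV \<tau>] assms frechet_derivative_works
    unfolding has_vector_derivative_def by blast
  then show ?thesis
    unfolding has_vector_derivative_def linear_scale[OF linear_frechet_derivative[OF assms(2)]] .
qed

text \<open>Velocities can be computed with curves of the coordinate space: such a curve composed with the
  parametrisation is a smooth curve of the manifold, and near its starting point every smooth curve
  of the manifold is of this form.\<close>

lemma tangent_to_iff_curve:
  fixes A :: "('p, 'a::euclidean_space) chart set"
  assumes A: "smooth_atlas A" and c: "c \<in> charts_at A p"
  shows "v \<in> tangent_to A S p \<longleftrightarrow> v \<in> tangent_space A p \<and>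
    (\<exists>N \<delta>. open N \<and> (0::real) \<in> N \<and> smooth_on N \<delta> \<and>
       (\<forall>t\<in>N. \<delta> t \<in> coord c ` dom_ch c \<and> param c (\<delta> t) \<in> S) \<and> \<delta> 0 = coord c p \<and>
       (\<delta> has_vector_derivative v c) (at 0))" (is "_ \<longleftrightarrow> _ \<and> ?curve")
proof
  note c' = charts_at_in[OF c]
  note Ac = smooth_atlas_chart[OF A c'(1)]
  assume "v \<in> tangent_to A S p"
  then obtain \<gamma> \<epsilon> where \<gamma>: "\<epsilon> > 0" "smooth_map euclid A {-\<epsilon><..<\<epsilon>} \<gamma>" "\<gamma> ` {-\<epsilon><..<\<epsilon>} \<subseteq> S" "\<gamma> (0::real) = p"
    and v: "v = (\<lambda>d. if d \<in> charts_at A p then vector_derivative (coord d \<circ> \<gamma>) (at 0) else 0)"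
    unfolding tangent_to_def by blast
  have local: "\<exists>N. open N \<and> 0 \<in> N \<and> N \<subseteq> {-\<epsilon><..<\<epsilon>} \<and> \<gamma> ` N \<subseteq> dom_ch d \<and> smooth_on N (\<lambda>t. coord d (\<gamma> t))"
    if "d \<in> charts_at A p" for d
  proof -
    have 0: "0 \<in> {-\<epsilon><..<\<epsilon>}" using \<gamma>(1) by simp
    have i: "(UNIV, \<lambda>x. x) \<in> charts_at euclid (0::real)" by (simp add: charts_at_euclid)
    have d: "d \<in> charts_at A (\<gamma> 0)" using that \<gamma>(4) by simp
    obtain N where "open N" "coord (UNIV, \<lambda>x. x) 0 \<in> N" "param (UNIV, \<lambda>x. x) ` N \<subseteq> {-\<epsilon><..<\<epsilon>}"
      "\<gamma> ` param (UNIV, \<lambda>x. x) ` N \<subseteq> dom_ch d"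
      "smooth_on N (\<lambda>z. coord d (\<gamma> (param (UNIV, \<lambda>x. x) z)))"
      by (rule smooth_map_in_charts[OF smooth_atlas_euclid A \<gamma>(2) 0 i d])
    then show ?thesis unfolding param_euclid image_ident by (intro exI[of _ N]) simp
  qed
  have vd: "((\<lambda>t. coord d (\<gamma> t)) has_vector_derivative v d) (at 0)" if d: "d \<in> charts_at A p" for d
  proof -
    obtain N where "open N" "0 \<in> N" "smooth_on N (\<lambda>t. coord d (\<gamma> t))" using local[OF d] by blast
    then have "(\<lambda>t. coord d (\<gamma> t)) differentiable (at 0)" using smooth_on_imp_differentiable by blast
    then show ?thesis using d unfolding v by (simp add: comp_def vector_derivative_works)
  qed
  have "v e = frechet_derivative (\<lambda>z. coord e (param d z)) (at (coord d p)) (v d)"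
    if d: "d \<in> charts_at A p" and e: "e \<in> charts_at A p" for d e
  proof -
    obtain N where N: "open N" "0 \<in> N" "\<gamma> ` N \<subseteq> dom_ch d" using local[OF d] by blast
    have eq: "coord e (param d (coord d (\<gamma> t))) = coord e (\<gamma> t)" if "t \<in> N" for t
    proof -
      have "\<gamma> t \<in> dom_ch d" using that N(3) by blast
      then show ?thesis by (simp add: param_coord[OF smooth_atlas_chart[OF A charts_at_in(1)[OF d]]])
    qed
    have "((\<lambda>t. coord e (param d (coord d (\<gamma> t)))) has_vector_derivative
        frechet_derivative (\<lambda>z. coord e (param d z)) (at (coord d p)) (v d)) (at 0)"
      using frechet_vector_derivative_compose[OF vd[OF d], of "\<lambda>z. coord e (param d z)"]
        transition_differentiable[OF A d e] \<gamma>(4) by simp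
    then have "((\<lambda>t. coord e (\<gamma> t)) has_vector_derivative
        frechet_derivative (\<lambda>z. coord e (param d z)) (at (coord d p)) (v d)) (at 0)"
      by (rule has_vector_derivative_transform_within_open[OF _ N(1,2) eq])
    then show ?thesis using vd[OF e] vector_derivative_at by metis
  qed
  moreover have "v d = 0" if "d \<notin> charts_at A p" for d using that by (subst v) simp
  ultimately have "v \<in> tangent_space A p" by (metis tangent_spaceI)
  note vT = this
  obtain N where N: "open N" "0 \<in> N" "N \<subseteq> {-\<epsilon><..<\<epsilon>}" "\<gamma> ` N \<subseteq> dom_ch c" "smooth_on N (\<lambda>t. coord c (\<gamma> t))"
    using local[OF c] by blast
  moreover have "\<gamma> t \<in> dom_ch c" "param c (coord c (\<gamma> t)) \<in> S" if "t \<in> N" for t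
  proof -
    show d: "\<gamma> t \<in> dom_ch c" using N(4) that by blast
    show "param c (coord c (\<gamma> t)) \<in> S" unfolding param_coord[OF Ac d] using N(3) \<gamma>(3) that by blast
  qed
  ultimately have "?curve"
    using vd[OF c] \<gamma>(4) by (intro exI[of _ N] exI[of _ "\<lambda>t. coord c (\<gamma> t)"]) simp
  with vT show "v \<in> tangent_space A p \<and> ?curve" by blast
next
  note c' = charts_at_in[OF c]
  note Ac = smooth_atlas_chart[OF A c'(1)]
  assume "v \<in> tangent_space A p \<and> ?curve"
  then obtain N \<delta> where v: "v \<in> tangent_space A p" and N: "open N" "(0::real) \<in> N" "smooth_on N \<delta>"
    "\<And>t. t \<in> N \<Longrightarrow> \<delta> t \<in> coord c ` dom_ch c" "\<And>t. t \<in> N \<Longrightarrow> param c (\<delta> t) \<in> S" "\<delta> 0 = coord c p"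
    and \<delta>: "(\<delta> has_vector_derivative v c) (at 0)" by blast
  obtain \<epsilon> where \<epsilon>: "\<epsilon> > 0" "{-\<epsilon><..<\<epsilon>} \<subseteq> N"
    using N(1,2) open_contains_ball[of N] by (auto simp: ball_eq_greaterThanLessThan)
  let ?\<gamma> = "\<lambda>t. param c (\<delta> t)"
  have "smooth_map euclid A {-\<epsilon><..<\<epsilon>} ?\<gamma>"
    unfolding smooth_map_def
  proof (intro ballI bexI exI conjI)
    show "atlas_open euclid {-\<epsilon><..<\<epsilon>}" by (simp add: atlas_open_def euclid_def carrier_of_def)
    show "?\<gamma> ` {-\<epsilon><..<\<epsilon>} \<subseteq> dom_ch c"
      by (intro image_subsetI param_in_dom N(4) subsetD[OF \<epsilon>(2)])
    have "smooth_on {-\<epsilon><..<\<epsilon>} (\<lambda>t. coord c (param c (\<delta> t)))"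
      using N(4) \<epsilon>(2)
      by (intro smooth_on_transform[OF smooth_on_subset[OF N(3) \<epsilon>(2)]]) (auto simp: coord_param)
    then show "smooth_on (coord (UNIV, \<lambda>x. x) ` {-\<epsilon><..<\<epsilon>}) (coord c \<circ> ?\<gamma> \<circ> param (UNIV, \<lambda>x. x))"
      by (simp add: param_euclid comp_def)
  qed (use c' in \<open>auto simp: euclid_def\<close>)
  moreover have "?\<gamma> ` {-\<epsilon><..<\<epsilon>} \<subseteq> S" using N(5) \<epsilon>(2) by blast
  moreover have "?\<gamma> 0 = p" using N(6) param_coord[OF Ac c'(2)] by simp
  moreover have "v = (\<lambda>d. if d \<in> charts_at A p then vector_derivative (coord d \<circ> ?\<gamma>) (at 0) else 0)"
  proof
    fix d
    show "v d = (if d \<in> charts_at A p then vector_derivative (coord d \<circ> ?\<gamma>) (at 0) else 0)"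
    proof (cases "d \<in> charts_at A p")
      case True
      have "((\<lambda>t. coord d (param c (\<delta> t))) has_vector_derivative
        frechet_derivative (\<lambda>z. coord d (param c z)) (at (coord c p)) (v c)) (at 0)"
        using frechet_vector_derivative_compose[OF \<delta>, of "\<lambda>z. coord d (param c z)"]
          transition_differentiable[OF A c True] N(6) by simp
      then have "vector_derivative (coord d \<circ> ?\<gamma>) (at 0) = v d"
        unfolding tangent_space_transition[OF v c True] comp_def by (rule vector_derivative_at)
      then show ?thesis using True by simp
    qed (use tangent_space_outside[OF v] in simp)
  qed
  ultimately show "v \<in> tangent_to A S p"
    unfolding tangent_to_def using \<epsilon>(1) by blast
qed


subsection \<open>Submanifolds given by local defining maps\<close>

text \<open>In a chart the differential of a defining map is a linear map \<open>L\<close>. Independence of the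
  differentials of its components makes \<open>L\<close> onto: otherwise a nonzero vector orthogonal to the range
  of \<open>L\<close> would be a linear relation between them.\<close>

lemma local_defining_map_in_chart:
  fixes A :: "('p, 'a::euclidean_space) chart set" and F :: "'p \<Rightarrow> real^'q::finite"
  assumes A: "smooth_atlas A" and F: "local_defining_map A S W F" and p: "p \<in> S \<inter> W"
    and c: "c \<in> charts_at A p"
  obtains N L where "open N" "coord c p \<in> N" "N \<subseteq> coord c ` dom_ch c"
    "smooth_on N (\<lambda>z. F (param c z))" "F (param c (coord c p)) = 0"
    "\<And>z. z \<in> N \<Longrightarrow> param c z \<in> S \<longleftrightarrow> F (param c z) = 0"
    "L = frechet_derivative (\<lambda>z. F (param c z)) (at (coord c p))" "linear L" "range L = UNIV"
    "\<And>v. v \<in> tangent_space A p \<Longrightarrow> differential A F p v = L (v c)"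
proof -
  have F': "smooth_map A euclid W F" "S \<inter> W = {p \<in> W. F p = 0}"
    and all: "\<forall>p\<in>S \<inter> W. \<forall>l::'q \<Rightarrow> real.
      (\<forall>v\<in>tangent_space A p. (\<Sum>a\<in>UNIV. l a * differential A F p v $ a) = 0) \<longrightarrow> (\<forall>a. l a = 0)"
    using F[unfolded local_defining_map_def, THEN conjunct2, THEN conjunct1]
      F[unfolded local_defining_map_def, THEN conjunct2, THEN conjunct2, THEN conjunct1]
      F[unfolded local_defining_map_def, THEN conjunct2, THEN conjunct2, THEN conjunct2] .
  have pW: "p \<in> W" using p by blast
  have ind: "\<forall>a. l a = 0"
    if "\<forall>v\<in>tangent_space A p. (\<Sum>a\<in>UNIV. l a * differential A F p v $ a) = 0" for l :: "'q \<Rightarrow> real"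
    using all[THEN bspec, OF p, THEN spec, THEN mp, OF that] .
  obtain N where N: "open N" "coord c p \<in> N" "N \<subseteq> coord c ` dom_ch c" "param c ` N \<subseteq> W"
    "smooth_on N (\<lambda>z. F (param c z))"
    by (rule smooth_function_in_chart[OF A F'(1) pW c])
  define L where "L = frechet_derivative (\<lambda>z. F (param c z)) (at (coord c p))"
  have linL: "linear L" unfolding L_def
    by (rule linear_frechet_derivative[OF smooth_on_imp_differentiable[OF N(5,2)]])
  have dF: "differential A F p v = L (v c)" if "v \<in> tangent_space A p" for v
    unfolding L_def by (rule differential_chart[OF A F'(1) pW c that])
  have "range L = UNIV"
  proof (rule ccontr)
    assume "range L \<noteq> UNIV"
    moreover have sub: "subspace (range L)"
      using linL linear_subspace_image subspace_UNIV by blast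
    ultimately have "span (range L) \<noteq> UNIV" by (simp add: span_eq_iff[THEN iffD2])
    then have "dim (range L) < DIM(real^'q)"
      by (metis dim_eq_full dim_subset_UNIV le_neq_implies_less)
    then obtain l where l: "l \<noteq> 0" "\<And>y. y \<in> span (range L) \<Longrightarrow> orthogonal l y"
      using orthogonal_to_subspace_exists by blast
    have "(\<Sum>a\<in>UNIV. l $ a * differential A F p v $ a) = 0" if "v \<in> tangent_space A p" for v
      using l(2)[of "L (v c)"] span_base[of "L (v c)" "range L"] dF[OF that]
      by (simp add: orthogonal_def inner_vec_def)
    then have "\<forall>a. l $ a = 0" using ind[of "\<lambda>a. l $ a"] by blast
    then show False using l(1) by (simp add: vec_eq_iff)
  qed
  moreover have "param c z \<in> S \<longleftrightarrow> F (param c z) = 0" if "z \<in> N" for z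
    using N(4) F'(2) that by blast
  moreover have "F (param c (coord c p)) = 0"
    using param_coord[OF smooth_atlas_chart[OF A charts_at_in(1)[OF c]] charts_at_in(2)[OF c]] F'(2) p by auto
  ultimately show ?thesis using that[OF N(1-3,5)] L_def linL dF by blast
qed

text \<open>A vector annihilated by \<open>dF\<close> is the velocity of the curve that the implicit function theorem
  produces over the straight line in its direction.\<close>

lemma tangent_to_eq_ker_differential:
  fixes A :: "('p, 'a::euclidean_space) chart set" and F :: "'p \<Rightarrow> real^'q::finite"
  assumes A: "smooth_atlas A" and F: "local_defining_map A S W F" and p: "p \<in> S \<inter> W"
    and c: "c \<in> charts_at A p"
  shows "tangent_to A S p = {v \<in> tangent_space A p. differential A F p v = 0}"
proof -
  note chart = local_defining_map_in_chart[OF A F p c]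
  obtain N L where N: "open N" "coord c p \<in> N" "N \<subseteq> coord c ` dom_ch c"
    "smooth_on N (\<lambda>z. F (param c z))" "F (param c (coord c p)) = 0"
    "\<And>z. z \<in> N \<Longrightarrow> param c z \<in> S \<longleftrightarrow> F (param c z) = 0"
    and L: "L = frechet_derivative (\<lambda>z. F (param c z)) (at (coord c p))" "linear L" "range L = UNIV"
    and dF: "\<And>v. v \<in> tangent_space A p \<Longrightarrow> differential A F p v = L (v c)"
    using chart by metis
  let ?f = "\<lambda>z. F (param c z)"
  have fdiff: "?f differentiable (at (coord c p))" by (rule smooth_on_imp_differentiable[OF N(4,2)])
  have "v \<in> tangent_to A S p \<longleftrightarrow> L (v c) = 0" if v: "v \<in> tangent_space A p" for v
  proof
    assume "v \<in> tangent_to A S p"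
    then obtain M \<delta> where M: "open M" "(0::real) \<in> M" "smooth_on M \<delta>"
      "\<And>t. t \<in> M \<Longrightarrow> param c (\<delta> t) \<in> S" "\<delta> 0 = coord c p"
      and \<delta>: "(\<delta> has_vector_derivative v c) (at 0)"
      unfolding tangent_to_iff_curve[OF A c] by blast
    let ?M = "{t \<in> M. \<delta> t \<in> N}"
    have "open ?M" by (rule open_preimage_smooth[OF M(3,1) N(1)])
    have "((\<lambda>t. ?f (\<delta> t)) has_vector_derivative L (v c)) (at 0)"
      using frechet_vector_derivative_compose[OF \<delta>, of ?f] fdiff M(5) L(1) by simp
    then have "((\<lambda>t. 0) has_vector_derivative L (v c)) (at (0::real))"
      by (rule has_vector_derivative_transform_within_open[of _ _ 0 ?M])
        (use \<open>open ?M\<close> M N(2,6) in auto)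
    then show "L (v c) = 0"
      using has_vector_derivative_const vector_derivative_unique_at by blast
  next
    assume 0: "L (v c) = 0"
    obtain \<beta> :: "'q \<Rightarrow> 'a" where \<beta>: "inj \<beta>" "range \<beta> \<subseteq> Basis"
      "\<And>w. w \<in> span (range \<beta>) \<Longrightarrow> L w = 0 \<Longrightarrow> w = 0"
      using select_independent_axes[OF L(2) subset_refl] L(3) by auto
    obtain N' D H where H: "open N'" "coord c p \<in> N'" "N' \<subseteq> N" "open D" "smooth_on D H"
      "\<forall>z\<in>N'. kill_axes \<beta> z \<in> D"
      "\<forall>z\<in>N'. ?f z = 0 \<longleftrightarrow> z = H (kill_axes \<beta> z)"
      "\<forall>z\<in>N'. ?f z = 0 \<longleftrightarrow> (\<forall>a. z \<bullet> \<beta> a = H (kill_axes \<beta> z) \<bullet> \<beta> a)"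
      "\<forall>y\<in>D. kill_axes \<beta> y = y \<longrightarrow> H y \<in> N \<and> ?f (H y) = 0 \<and> kill_axes \<beta> (H y) = y"
      by (rule implicit_graph[OF N(1,4,2,5) \<beta>(1,2) \<beta>(3)[unfolded L(1)]]) blast
    let ?P = "kill_axes \<beta>"
    have P: "linear ?P" by (rule linear_kill_axes)
    define line where "line t = ?P (coord c p + t *\<^sub>R v c)" for t
    define M where "M = {t \<in> UNIV. line t \<in> D}"
    have line_alt: "line t = ?P (coord c p) + t *\<^sub>R ?P (v c)" for t
      unfolding line_def by (simp add: linear_add[OF P] linear_scale[OF P])
    have sm_line: "smooth_on UNIV line"
      unfolding line_alt[abs_def] by (intro smooth_on_add smooth_on_const smooth_on_scaleR smooth_on_id open_UNIV)
    have M: "open M" unfolding M_def by (rule open_preimage_smooth[OF sm_line open_UNIV H(4)])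
    have 0: "0 \<in> M" using H(2,6) by (simp add: M_def line_def)
    have sol: "H (line t) \<in> N \<and> ?f (H (line t)) = 0 \<and> ?P (H (line t)) = line t" if "t \<in> M" for t
      using that H(9)[rule_format, of "line t"] kill_axes_idem[OF \<beta>(1,2)] by (simp add: M_def line_def)
    define \<delta> where "\<delta> t = H (line t)" for t
    have sm\<delta>: "smooth_on M \<delta>" unfolding \<delta>_def
      using smooth_on_subset[OF sm_line, of M] by (intro smooth_on_compose[OF M _ H(5)]) (auto simp: M_def)
    have \<delta>0: "\<delta> 0 = coord c p" using H(7)[rule_format, OF H(2)] N(5) by (simp add: \<delta>_def line_def)
    define w where "w = vector_derivative \<delta> (at 0)"
    have w: "(\<delta> has_vector_derivative w) (at 0)"
      unfolding w_def using smooth_on_imp_differentiable[OF sm\<delta> 0] by (simp add: vector_derivative_works)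
    \<comment> \<open>The velocity \<open>w\<close> of the curve is identified by two equations that \<open>v\<close> satisfies as well: \<open>L w = 0\<close>,
      because \<open>f\<close> vanishes on the curve, and \<open>P w = P v\<close>, because \<open>P\<close> maps the curve to the line.\<close>
    have "((\<lambda>t. ?f (\<delta> t)) has_vector_derivative L w) (at 0)"
      using frechet_vector_derivative_compose[OF w, of ?f] fdiff \<delta>0 L(1) by simp
    then have "((\<lambda>t. 0) has_vector_derivative L w) (at (0::real))"
      by (rule has_vector_derivative_transform_within_open[OF _ M 0]) (use sol in \<open>simp add: \<delta>_def\<close>)
    then have Lw: "L w = 0" using has_vector_derivative_const vector_derivative_unique_at by blast
    have "((\<lambda>t. ?P (\<delta> t)) has_vector_derivative ?P w) (at 0)"
      using w P by (simp add: bounded_linear.has_vector_derivative linear_conv_bounded_linear)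
    then have "(line has_vector_derivative ?P w) (at 0)"
      by (rule has_vector_derivative_transform_within_open[OF _ M 0]) (use sol in \<open>simp add: \<delta>_def\<close>)
    moreover have "(line has_vector_derivative ?P (v c)) (at 0)"
      unfolding line_alt[abs_def] by (auto intro!: derivative_eq_intros)
    ultimately have "?P w = ?P (v c)" using vector_derivative_unique_at by blast
    then have "w - v c \<in> span (range \<beta>)"
      by (intro kill_axes_eq_0_span) (simp add: linear_diff[OF P])
    then have "w = v c" using \<beta>(3)[of "w - v c"] Lw \<open>L (v c) = 0\<close> by (simp add: linear_diff[OF L(2)])
    moreover have "\<delta> t \<in> coord c ` dom_ch c \<and> param c (\<delta> t) \<in> S" if "t \<in> M" for t
      using sol[OF that] N(3,6) unfolding \<delta>_def by blast
    moreover note w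
    ultimately show "v \<in> tangent_to A S p"
      unfolding tangent_to_iff_curve[OF A c] using v M 0 sm\<delta> \<delta>0
      by (intro conjI exI[of _ M] exI[of _ \<delta>]) auto
  qed
  moreover have "tangent_to A S p \<subseteq> tangent_space A p"
    using tangent_to_iff_curve[OF A c] by blast
  ultimately show ?thesis using dF by auto
qed

section \<open>Contact of maps and iterated partial derivatives\<close>

text \<open>Equality of the Taylor expansions at \<open>x\<close> up to order \<open>k\<close>. The recursion takes the first
  derivatives innermost, so that the chain rule can be used in inductions on the order without
  changing the types of the maps involved.\<close>

primrec agree :: "nat \<Rightarrow> ('a::euclidean_space \<Rightarrow> 'b::real_normed_vector) \<Rightarrow> ('a \<Rightarrow> 'b) \<Rightarrow> 'a \<Rightarrow> bool" where
  "agree 0 f g x \<longleftrightarrow> f x = g x"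
| "agree (Suc k) f g x \<longleftrightarrow> f x = g x \<and> (\<forall>b\<in>Basis. agree k (dir_deriv b f) (dir_deriv b g) x)"

lemma agree_refl: "agree k f f x"
  by (induction k arbitrary: f) auto

lemma agree_imp_eq: "agree k f g x \<Longrightarrow> f x = g x"
  by (cases k) auto

lemma agree_Suc_imp: "agree (Suc k) f g x \<Longrightarrow> agree k f g x"
proof (induction k arbitrary: f g)
  case (Suc k) then show ?case by (meson agree.simps(2))
qed simp

text \<open>Contact depends on germs only.\<close>

lemma agree_cong:
  assumes "open S" "x \<in> S" "\<And>y. y \<in> S \<Longrightarrow> f y = f' y" "\<And>y. y \<in> S \<Longrightarrow> g y = g' y"
  shows "agree k f g x \<longleftrightarrow> agree k f' g' x"
  using assms(3,4)
proof (induction k arbitrary: f g f' g')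
  case 0 then show ?case using assms(2) by simp
next
  case (Suc k)
  have "agree k (dir_deriv b f) (dir_deriv b g) x \<longleftrightarrow> agree k (dir_deriv b f') (dir_deriv b g') x" for b
    using frechet_derivative_cong_open[OF assms(1) _ Suc.prems(1)]
      frechet_derivative_cong_open[OF assms(1) _ Suc.prems(2)]
    by (intro Suc.IH) simp_all
  then show ?case using Suc.prems assms(2) by simp
qed

lemma agree_transform:
  assumes "agree k f' g' x" "open S" "x \<in> S"
    "\<And>y. y \<in> S \<Longrightarrow> f y = f' y" "\<And>y. y \<in> S \<Longrightarrow> g y = g' y"
  shows "agree k f g x"
  using agree_cong[where f = f and f' = f' and g = g and g' = g', OF assms(2-)] assms(1) by blast

lemma agree_add:
  assumes S: "open S" "x \<in> S" and sm: "smooth_on S f" "smooth_on S f'" "smooth_on S g" "smooth_on S g'"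
    and "agree k f f' x" "agree k g g' x"
  shows "agree k (\<lambda>x. f x + g x) (\<lambda>x. f' x + g' x) x"
  using assms(3-)
proof (induction k arbitrary: f f' g g')
  case (Suc k)
  have D: "dir_deriv b (\<lambda>x. f x + g x) y = dir_deriv b f y + dir_deriv b g y"
    if "smooth_on S f" "smooth_on S g" "y \<in> S" for f g :: "'a \<Rightarrow> 'b" and b y
    using frechet_derivative_eqI[OF has_derivative_add[OF smooth_on_imp_has_derivative[OF that(1,3)]
          smooth_on_imp_has_derivative[OF that(2,3)]]] by simp
  have "agree k (dir_deriv b (\<lambda>x. f x + g x)) (dir_deriv b (\<lambda>x. f' x + g' x)) x" if "b \<in> Basis" for b
  proof -
    have "agree k (\<lambda>x. dir_deriv b f x + dir_deriv b g x) (\<lambda>x. dir_deriv b f' x + dir_deriv b g' x) x"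
      using Suc.prems that by (intro Suc.IH smooth_on_dir_deriv) auto
    then show ?thesis by (rule agree_transform[OF _ S]) (rule D[OF Suc.prems(1,3)] D[OF Suc.prems(2,4)], assumption)+
  qed
  then show ?case using Suc.prems by auto
qed simp

lemma agree_sum:
  assumes S: "open S" "x \<in> S"
    and "\<And>i. i \<in> I \<Longrightarrow> smooth_on S (f i) \<and> smooth_on S (g i) \<and> agree k (f i) (g i) x"
  shows "agree k (\<lambda>x. \<Sum>i\<in>I. f i x) (\<lambda>x. \<Sum>i\<in>I. g i x) x"
  using assms(3)
proof (induction I rule: infinite_finite_induct)
  case (insert i F)
  have "agree k (\<lambda>x. f i x + (\<Sum>i\<in>F. f i x)) (\<lambda>x. g i x + (\<Sum>i\<in>F. g i x)) x"
    using insert by (intro agree_add[OF S] smooth_on_sum S) auto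
  then show ?case using insert by simp
qed (auto simp: agree_refl)

lemma agree_scaleR:
  fixes f f' :: "'a::euclidean_space \<Rightarrow> real" and g g' :: "'a \<Rightarrow> 'b::real_normed_vector"
  assumes S: "open S" "x \<in> S" and sm: "smooth_on S f" "smooth_on S f'" "smooth_on S g" "smooth_on S g'"
    and "agree k f f' x" "agree k g g' x"
  shows "agree k (\<lambda>x. f x *\<^sub>R g x) (\<lambda>x. f' x *\<^sub>R g' x) x"
  using assms(3-)
proof (induction k arbitrary: f f' g g')
  case (Suc k)
  have D: "dir_deriv b (\<lambda>x. f x *\<^sub>R g x) y = f y *\<^sub>R dir_deriv b g y + dir_deriv b f y *\<^sub>R g y"
    if "smooth_on S f" "smooth_on S g" "y \<in> S" for f :: "'a \<Rightarrow> real" and g :: "'a \<Rightarrow> 'b" and b y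
    using frechet_derivative_eqI[OF has_derivative_scaleR[OF smooth_on_imp_has_derivative[OF that(1,3)]
          smooth_on_imp_has_derivative[OF that(2,3)]]] by simp
  have "agree k (dir_deriv b (\<lambda>x. f x *\<^sub>R g x)) (dir_deriv b (\<lambda>x. f' x *\<^sub>R g' x)) x" if "b \<in> Basis" for b
  proof -
    have "agree k (\<lambda>x. f x *\<^sub>R dir_deriv b g x + dir_deriv b f x *\<^sub>R g x)
        (\<lambda>x. f' x *\<^sub>R dir_deriv b g' x + dir_deriv b f' x *\<^sub>R g' x) x"
      using Suc.prems that agree_Suc_imp[OF Suc.prems(5)] agree_Suc_imp[OF Suc.prems(6)]
      by (intro agree_add[OF S] Suc.IH smooth_on_dir_deriv smooth_on_scaleR S) auto
    then show ?thesis by (rule agree_transform[OF _ S]) (rule D[OF Suc.prems(1,3)] D[OF Suc.prems(2,4)], assumption)+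
  qed
  then show ?case using Suc.prems by auto
qed simp

lemma agree_bounded_linear:
  assumes S: "open S" "x \<in> S" and L: "bounded_linear L" and "smooth_on S f" "smooth_on S f'" "agree k f f' x"
  shows "agree k (\<lambda>x. L (f x)) (\<lambda>x. L (f' x)) x"
  using assms(4-)
proof (induction k arbitrary: f f')
  case (Suc k)
  have D: "dir_deriv b (\<lambda>x. L (f x)) y = L (dir_deriv b f y)" if "smooth_on S f" "y \<in> S" for f b y
    using frechet_derivative_eqI[OF bounded_linear.has_derivative[OF L smooth_on_imp_has_derivative[OF that]]]
    by simp
  have "agree k (dir_deriv b (\<lambda>x. L (f x))) (dir_deriv b (\<lambda>x. L (f' x))) x" if "b \<in> Basis" for b
  proof -
    have "agree k (\<lambda>x. L (dir_deriv b f x)) (\<lambda>x. L (dir_deriv b f' x)) x"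
      using Suc.prems that by (intro Suc.IH smooth_on_dir_deriv) auto
    then show ?thesis by (rule agree_transform[OF _ S]) (rule D[OF Suc.prems(1)] D[OF Suc.prems(2)], assumption)+
  qed
  then show ?case using Suc.prems by auto
qed simp

text \<open>The chain rule reduces the derivatives of both composites to products covered by the rules
  above; a composite with a derivative of \<open>\<Phi>\<close> is covered by the induction hypothesis, which therefore
  quantifies over the outer map.\<close>

lemma agree_compose_left:
  fixes f f' :: "'a::euclidean_space \<Rightarrow> 'b::euclidean_space" and \<Phi> :: "'b \<Rightarrow> 'c::real_normed_vector"
  assumes S: "open S" "x \<in> S" and f: "smooth_on S f" "smooth_on S f'" "f ` S \<subseteq> T" "f' ` S \<subseteq> T"
    and "smooth_on T \<Phi>" "agree k f f' x"
  shows "agree k (\<lambda>x. \<Phi> (f x)) (\<lambda>x. \<Phi> (f' x)) x"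
  using assms(7,8)
proof (induction k arbitrary: \<Phi>)
  case (Suc k)
  have D: "dir_deriv b (\<lambda>x. \<Phi> (f x)) y = (\<Sum>j\<in>Basis. (dir_deriv b f y \<bullet> j) *\<^sub>R dir_deriv j \<Phi> (f y))"
    if "smooth_on S f" "f ` S \<subseteq> T" "y \<in> S" for f b y
    using that Suc.prems(1)
    by (intro dir_deriv_comp smooth_on_imp_differentiable[of S f] smooth_on_imp_differentiable[of T \<Phi>]) auto
  have "agree k (dir_deriv b (\<lambda>x. \<Phi> (f x))) (dir_deriv b (\<lambda>x. \<Phi> (f' x))) x" if b: "b \<in> Basis" for b
  proof -
    have "agree k (\<lambda>x. \<Sum>j\<in>Basis. (dir_deriv b f x \<bullet> j) *\<^sub>R dir_deriv j \<Phi> (f x))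
      (\<lambda>x. \<Sum>j\<in>Basis. (dir_deriv b f' x \<bullet> j) *\<^sub>R dir_deriv j \<Phi> (f' x)) x"
    proof (intro agree_sum[OF S] conjI)
      fix j :: 'b
      have sm: "smooth_on S (\<lambda>x. dir_deriv b g x \<bullet> j)" "smooth_on S (\<lambda>x. dir_deriv j \<Phi> (g x))"
        if "smooth_on S g" "g ` S \<subseteq> T" for g
        using smooth_on_bounded_linear_comp[OF bounded_linear_inner_left S(1) smooth_on_dir_deriv[OF that(1)]]
          smooth_on_compose[OF S(1) that(1) smooth_on_dir_deriv[OF Suc.prems(1)] that(2)] by auto
      show "smooth_on S (\<lambda>x. (dir_deriv b f x \<bullet> j) *\<^sub>R dir_deriv j \<Phi> (f x))"
        "smooth_on S (\<lambda>x. (dir_deriv b f' x \<bullet> j) *\<^sub>R dir_deriv j \<Phi> (f' x))"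
        by (intro smooth_on_scaleR[OF S(1)] sm f)+
      have "agree k (\<lambda>x. dir_deriv b f x \<bullet> j) (\<lambda>x. dir_deriv b f' x \<bullet> j) x"
        using Suc.prems(2) b
        by (intro agree_bounded_linear[OF S bounded_linear_inner_left] smooth_on_dir_deriv f) auto
      moreover have "agree k (\<lambda>x. dir_deriv j \<Phi> (f x)) (\<lambda>x. dir_deriv j \<Phi> (f' x)) x"
        by (rule Suc.IH[OF smooth_on_dir_deriv[OF Suc.prems(1)] agree_Suc_imp[OF Suc.prems(2)]])
      ultimately show "agree k (\<lambda>x. (dir_deriv b f x \<bullet> j) *\<^sub>R dir_deriv j \<Phi> (f x))
          (\<lambda>x. (dir_deriv b f' x \<bullet> j) *\<^sub>R dir_deriv j \<Phi> (f' x)) x"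
        by (intro agree_scaleR[OF S] sm f)
    qed
    then show ?thesis by (rule agree_transform[OF _ S]) (rule D[OF f(1,3)] D[OF f(2,4)], assumption)+
  qed
  then show ?case using Suc.prems by auto
qed simp

text \<open>The same argument, with the roles exchanged: now the inner map is common to both sides and the
  induction runs over the pair of outer maps.\<close>

lemma agree_compose_right:
  fixes f f' :: "'b::euclidean_space \<Rightarrow> 'c::real_normed_vector" and \<xi> :: "'a::euclidean_space \<Rightarrow> 'b"
  assumes S: "open S" "x \<in> S" and \<xi>: "smooth_on S \<xi>" "\<xi> ` S \<subseteq> T"
    and "smooth_on T f" "smooth_on T f'" "agree k f f' (\<xi> x)"
  shows "agree k (\<lambda>x. f (\<xi> x)) (\<lambda>x. f' (\<xi> x)) x"
  using assms(5-)
proof (induction k arbitrary: f f')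
  case (Suc k)
  have D: "dir_deriv b (\<lambda>x. f (\<xi> x)) y = (\<Sum>j\<in>Basis. (dir_deriv b \<xi> y \<bullet> j) *\<^sub>R dir_deriv j f (\<xi> y))"
    if "smooth_on T f" "y \<in> S" for f :: "'b \<Rightarrow> 'c" and b y
    using that \<xi>
    by (intro dir_deriv_comp smooth_on_imp_differentiable[of S \<xi>] smooth_on_imp_differentiable[of T f]) auto
  have "agree k (dir_deriv b (\<lambda>x. f (\<xi> x))) (dir_deriv b (\<lambda>x. f' (\<xi> x))) x" if b: "b \<in> Basis" for b
  proof -
    have "agree k (\<lambda>x. \<Sum>j\<in>Basis. (dir_deriv b \<xi> x \<bullet> j) *\<^sub>R dir_deriv j f (\<xi> x))
      (\<lambda>x. \<Sum>j\<in>Basis. (dir_deriv b \<xi> x \<bullet> j) *\<^sub>R dir_deriv j f' (\<xi> x)) x"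
    proof (intro agree_sum[OF S] conjI)
      fix j :: 'b assume j: "j \<in> Basis"
      have sm: "smooth_on S (\<lambda>x. dir_deriv b \<xi> x \<bullet> j)"
        by (rule smooth_on_bounded_linear_comp[OF bounded_linear_inner_left S(1) smooth_on_dir_deriv[OF \<xi>(1)]])
      have sm': "smooth_on S (\<lambda>x. dir_deriv j g (\<xi> x))" if "smooth_on T g" for g :: "'b \<Rightarrow> 'c"
        by (rule smooth_on_compose[OF S(1) \<xi>(1) smooth_on_dir_deriv[OF that] \<xi>(2)])
      show "smooth_on S (\<lambda>x. (dir_deriv b \<xi> x \<bullet> j) *\<^sub>R dir_deriv j f (\<xi> x))"
        "smooth_on S (\<lambda>x. (dir_deriv b \<xi> x \<bullet> j) *\<^sub>R dir_deriv j f' (\<xi> x))"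
        by (intro smooth_on_scaleR[OF S(1)] sm sm' Suc.prems)+
      have "agree k (\<lambda>x. dir_deriv j f (\<xi> x)) (\<lambda>x. dir_deriv j f' (\<xi> x)) x"
        using Suc.prems j by (intro Suc.IH smooth_on_dir_deriv) auto
      then show "agree k (\<lambda>x. (dir_deriv b \<xi> x \<bullet> j) *\<^sub>R dir_deriv j f (\<xi> x))
          (\<lambda>x. (dir_deriv b \<xi> x \<bullet> j) *\<^sub>R dir_deriv j f' (\<xi> x)) x"
        by (intro agree_scaleR[OF S] sm sm' Suc.prems agree_refl)
    qed
    then show ?thesis by (rule agree_transform[OF _ S]) (rule D[OF Suc.prems(1)] D[OF Suc.prems(2)], assumption)+
  qed
  then show ?case using Suc.prems agree_imp_eq by auto
qed simp

lemma Basis_real_vec: "(Basis :: (real^'n) set) = range (\<lambda>i. axis i 1)"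
  by (auto simp: Basis_vec_def)

lemma iter_pd_snoc: "iter_pd (js @ [i]) f = iter_pd js (dir_deriv (axis i 1) f)"
  by (induction js) auto

lemma agree_iff_iter_pd:
  "agree k f g x \<longleftrightarrow> (\<forall>js. length js \<le> k \<longrightarrow> iter_pd js f x = iter_pd js g x)"
proof (induction k arbitrary: f g)
  case (Suc k)
  have "(\<forall>js. length js \<le> Suc k \<longrightarrow> iter_pd js f x = iter_pd js g x) \<longleftrightarrow>
    iter_pd [] f x = iter_pd [] g x \<and>
    (\<forall>i js. length js \<le> k \<longrightarrow> iter_pd (js @ [i]) f x = iter_pd (js @ [i]) g x)"
    (is "?l \<longleftrightarrow> ?r")
  proof (rule iffI[rotated])
    assume ?r
    show ?l
    proof (intro allI impI)
      fix js :: "'a list" assume "length js \<le> Suc k"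
      then show "iter_pd js f x = iter_pd js g x"
        using \<open>?r\<close> by (cases js rule: rev_cases) auto
    qed
  next
    assume l: ?l
    show ?r using l[rule_format, of "[]"] l by simp
  qed
  then show ?case unfolding iter_pd_snoc using Suc by (auto simp: Basis_real_vec)
qed simp

text \<open>Iterated derivatives in arbitrary directions. For a family of maps depending smoothly on a
  parameter \<open>z\<close>, its partial derivatives are derivatives of the joint map in directions \<open>(0, v)\<close>
  and thus depend smoothly on \<open>z\<close>.\<close>

primrec iter_dir :: "'a list \<Rightarrow> ('a::real_normed_vector \<Rightarrow> 'b::real_normed_vector) \<Rightarrow> 'a \<Rightarrow> 'b" where
  "iter_dir [] f = f"
| "iter_dir (v # vs) f = dir_deriv v (iter_dir vs f)"

lemma iter_pd_eq_iter_dir: "iter_pd js f = iter_dir (map (\<lambda>i. axis i 1) js) f"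
  by (induction js) auto

lemma smooth_on_iter_dir: "smooth_on S f \<Longrightarrow> smooth_on S (iter_dir vs f)"
  by (induction vs) (auto intro: smooth_on_dir_deriv)

lemma iter_dir_cong:
  assumes "open S" "x \<in> S" "\<And>y. y \<in> S \<Longrightarrow> f y = g y"
  shows "iter_dir vs f x = iter_dir vs g x"
  using assms(2)
proof (induction vs arbitrary: x)
  case (Cons v vs)
  show ?case using frechet_derivative_cong_open[OF assms(1) Cons.prems Cons.IH] by simp
qed (simp add: assms)

lemma iter_dir_slice:
  fixes K :: "'z::real_normed_vector \<times> 'a::real_normed_vector \<Rightarrow> 'b::real_normed_vector"
  assumes \<Omega>: "open \<Omega>" and K: "smooth_on \<Omega> K" and "(z, t) \<in> \<Omega>"
  shows "iter_dir vs (\<lambda>t. K (z, t)) t = iter_dir (map (Pair 0) vs) K (z, t)"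
  using assms(3)
proof (induction vs arbitrary: t)
  case (Cons v vs)
  let ?G = "iter_dir (map (Pair 0) vs) K"
  have slice: "open {t. (z, t) \<in> \<Omega>}"
    using continuous_open_vimage[OF \<Omega>, of "Pair z"] by (auto simp: vimage_def intro: continuous_intros)
  have "frechet_derivative (iter_dir vs (\<lambda>t. K (z, t))) (at t) = frechet_derivative (\<lambda>t. ?G (z, t)) (at t)"
    using Cons by (intro frechet_derivative_cong_open[OF slice]) auto
  moreover have "((\<lambda>t. ?G (z, t)) has_derivative (\<lambda>v. frechet_derivative ?G (at (z, t)) (0, v))) (at t)"
    by (rule has_derivative_compose[OF has_derivative_Pair[OF has_derivative_const has_derivative_ident]
          smooth_on_imp_has_derivative[OF smooth_on_iter_dir[OF K] Cons.prems]])
  ultimately show ?case using frechet_derivative_eqI by fastforce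
qed simp

text \<open>By symmetry of second derivatives, an occurrence of \<open>i\<close> moves outwards past the other indices.\<close>

lemma iter_pd_remove1:
  assumes S: "open S" and f: "smooth_on S f" and "x \<in> S" "i \<in> set js"
  shows "iter_pd js f x = iter_pd (i # remove1 i js) f x"
  using assms(3,4)
proof (induction js arbitrary: x)
  case (Cons j js)
  show ?case
  proof (cases "i = j")
    case False
    then have i: "i \<in> set js" using Cons.prems by simp
    let ?g = "iter_pd (remove1 i js) f"
    have g: "smooth_on S ?g" unfolding iter_pd_eq_iter_dir by (rule smooth_on_iter_dir[OF f])
    have "iter_pd (j # js) f x = dir_deriv (axis j 1) (dir_deriv (axis i 1) ?g) x"
      using frechet_derivative_cong_open[OF S Cons.prems(1), of "iter_pd js f" "dir_deriv (axis i 1) ?g"]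
        Cons.IH[OF _ i] by simp
    also have "\<dots> = dir_deriv (axis i 1) (dir_deriv (axis j 1) ?g) x"
      by (rule dir_deriv_commute[OF g S Cons.prems(1)])
    finally show ?thesis using False by simp
  qed simp
qed simp

lemma iter_pd_mset_eq:
  assumes S: "open S" and f: "smooth_on S f" and "x \<in> S" "mset js = mset js'"
  shows "iter_pd js f x = iter_pd js' f x"
  using assms(3,4)
proof (induction js arbitrary: x js')
  case (Cons i js)
  have i: "i \<in> set js'" using Cons.prems(2) by (metis list.set_intros(1) mset_eq_setD)
  have "iter_pd js f y = iter_pd (remove1 i js') f y" if "y \<in> S" for y
    using Cons.prems(2) by (intro Cons.IH[OF that]) (metis add_mset_remove_trivial mset.simps(2) mset_remove1)
  then have "iter_pd (i # js) f x = iter_pd (i # remove1 i js') f x"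
    using frechet_derivative_cong_open[OF S Cons.prems(1), of "iter_pd js f"] by simp
  then show ?case using iter_pd_remove1[OF S f Cons.prems(1) i] by simp
qed simp

section \<open>Taylor polynomials with prescribed coefficients\<close>

text \<open>The normalised monomial \<open>y\<^sup>I / I!\<close>.\<close>

definition taylor_monomial :: "'n::finite multiset \<Rightarrow> real^'n \<Rightarrow> real" where
  "taylor_monomial I y = (\<Prod>i\<in>UNIV. (1 / fact (count I i)) *\<^sub>R (y $ i ^ count I i))"

lemma smooth_on_taylor_monomial: "smooth_on UNIV (taylor_monomial I)"
  unfolding taylor_monomial_def
  by (intro smooth_on_prod smooth_on_scaleR smooth_on_power smooth_on_vec_nth smooth_on_id
      smooth_on_const open_UNIV)

lemma taylor_monomial_0: "taylor_monomial I 0 = (if I = {#} then 1 else 0)"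
proof (cases "I = {#}")
  case False
  then obtain i where "i \<in># I" by blast
  then have "(0::real) ^ count I i = 0" by (simp add: count_eq_zero_iff)
  then have "\<exists>i. (1 / fact (count I i)) *\<^sub>R ((0::real^'a) $ i ^ count I i) = 0" by (intro exI[of _ i]) simp
  then show ?thesis using False by (auto simp: taylor_monomial_def prod_zero_iff)
qed (simp add: taylor_monomial_def)

text \<open>Along the line through \<open>t\<close> in direction \<open>j\<close> only the factor with index \<open>j\<close> varies, so this is a
  derivative of a power of one real variable; the factorials absorb the exponent.\<close>

lemma dir_deriv_taylor_monomial:
  "dir_deriv (axis j 1) (\<lambda>t. taylor_monomial I (t - y)) t = (if j \<in># I then taylor_monomial (I - {#j#}) (t - y) else 0)"
proof -
  define w where "w = t - y"
  define R where "R = (\<Prod>i\<in>UNIV - {j}. (1 / fact (count I i)) *\<^sub>R (w $ i ^ count I i))"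
  have sm: "smooth_on UNIV (\<lambda>t. taylor_monomial I (t - y))"
    by (intro smooth_on_compose[OF open_UNIV _ smooth_on_taylor_monomial] smooth_on_diff smooth_on_id smooth_on_const) auto
  have split: "taylor_monomial K w' = (1 / fact (count K j)) * (w' $ j ^ count K j) *
      (\<Prod>i\<in>UNIV - {j}. (1 / fact (count K i)) *\<^sub>R (w' $ i ^ count K i))" for K w'
    unfolding taylor_monomial_def by (subst prod.remove[of UNIV j]) auto
  have line: "taylor_monomial I (t + s *\<^sub>R axis j 1 - y) = (1 / fact (count I j)) * ((w $ j + s) ^ count I j) * R" for s
  proof -
    have "(\<Prod>i\<in>UNIV - {j}. (1 / fact (count I i)) *\<^sub>R ((t + s *\<^sub>R axis j 1 - y) $ i ^ count I i)) = R"
      unfolding R_def w_def by (intro prod.cong) (auto simp: axis_def)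
    then show ?thesis unfolding split[of I "t + s *\<^sub>R axis j 1 - y"] by (simp add: w_def axis_def algebra_simps)
  qed
  have "((\<lambda>s. taylor_monomial I (t + s *\<^sub>R axis j 1 - y)) has_vector_derivative
      dir_deriv (axis j 1) (\<lambda>t. taylor_monomial I (t - y)) (t + 0 *\<^sub>R axis j 1)) (at 0)"
    by (rule has_vector_derivative_line) (rule smooth_on_imp_differentiable[OF sm UNIV_I])
  then have 1: "((\<lambda>s. (1 / fact (count I j)) * ((w $ j + s) ^ count I j) * R) has_real_derivative
      dir_deriv (axis j 1) (\<lambda>t. taylor_monomial I (t - y)) t) (at 0)"
    by (simp add: line has_real_derivative_iff_has_vector_derivative)
  have 2: "((\<lambda>s. (1 / fact (count I j)) * ((w $ j + s) ^ count I j) * R) has_real_derivative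
      (1 / fact (count I j)) * (real (count I j) * w $ j ^ (count I j - 1)) * R) (at 0)"
    by (auto intro!: derivative_eq_intros)
  have eq: "dir_deriv (axis j 1) (\<lambda>t. taylor_monomial I (t - y)) t =
      (1 / fact (count I j)) * (real (count I j) * w $ j ^ (count I j - 1)) * R"
    using DERIV_unique[OF 1 2] .
  show ?thesis
  proof (cases "j \<in># I")
    case True
    then obtain c where c: "count I j = Suc c" by (metis Suc_pred count_greater_zero_iff)
    have "(\<Prod>i\<in>UNIV - {j}. (1 / fact (count (I - {#j#}) i)) *\<^sub>R (w $ i ^ count (I - {#j#}) i)) = R"
      unfolding R_def by (intro prod.cong) auto
    moreover have "(1 / fact (Suc c)) * (real (Suc c) * w $ j ^ c) = (1 / fact c) * w $ j ^ c"
      by (simp del: of_nat_Suc)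
    ultimately show ?thesis unfolding eq using True c split[of "I - {#j#}" w] by (simp add: w_def)
  next
    case False
    then have "count I j = 0" by (simp add: not_in_iff)
    then show ?thesis unfolding eq using False by simp
  qed
qed

text \<open>The polynomial whose derivatives at the base point \<open>fst z\<close> are the jet coordinates \<open>snd z\<close>.\<close>

definition taylor :: "('n::finite, 'm::finite, 'k::finite) jet_space \<Rightarrow> real^'n \<Rightarrow> real^'m" where
  "taylor z t = (\<Sum>I\<in>UNIV. taylor_monomial (Rep_mindex I) (t - fst z) *\<^sub>R snd z $ I)"

lemma smooth_on_taylor: "smooth_on UNIV (\<lambda>p. taylor (fst p) (snd p))"
  unfolding taylor_def
  by (intro smooth_on_sum smooth_on_scaleR smooth_on_vec_nth smooth_on_snd smooth_on_fst smooth_on_diff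
      smooth_on_compose[OF open_UNIV _ smooth_on_taylor_monomial] smooth_on_id open_UNIV subset_UNIV)

lemma smooth_on_taylor_slice: "smooth_on UNIV (taylor z)"
proof -
  have "smooth_on UNIV (\<lambda>t. taylor (fst (z, t)) (snd (z, t)))"
    by (rule smooth_on_compose[OF open_UNIV _ smooth_on_taylor])
      (intro smooth_on_Pair smooth_on_const smooth_on_id open_UNIV, simp)
  then show ?thesis by simp
qed

lemma iter_pd_taylor:
  fixes z :: "('n::finite, 'm::finite, 'k::finite) jet_space"
  shows "iter_pd js (taylor z) t = (\<Sum>I\<in>UNIV. (if mset js \<subseteq># Rep_mindex I
     then taylor_monomial (Rep_mindex I - mset js) (t - fst z) else 0) *\<^sub>R snd z $ I)"
proof (induction js arbitrary: t)
  case Nil then show ?case by (simp add: taylor_def)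
next
  case (Cons j js)
  let ?c = "\<lambda>I t. if mset js \<subseteq># Rep_mindex I then taylor_monomial (Rep_mindex I - mset js) (t - fst z) else 0"
  have sm: "smooth_on UNIV (?c I)" for I
  proof -
    have "smooth_on UNIV (\<lambda>t. taylor_monomial J (t - fst z))" for J
      by (intro smooth_on_compose[OF open_UNIV _ smooth_on_taylor_monomial] smooth_on_diff smooth_on_id smooth_on_const) auto
    then show ?thesis by (cases "mset js \<subseteq># Rep_mindex I") (auto intro: smooth_on_const)
  qed
  have "((\<lambda>t. \<Sum>I\<in>UNIV. ?c I t *\<^sub>R snd z $ I) has_derivative
      (\<lambda>v. \<Sum>I\<in>UNIV. dir_deriv v (?c I) t *\<^sub>R snd z $ I)) (at t)"
    by (intro has_derivative_sum has_derivative_scaleR_left smooth_on_imp_has_derivative[OF sm UNIV_I])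
  moreover have "iter_pd js (taylor z) = (\<lambda>t. \<Sum>I\<in>UNIV. ?c I t *\<^sub>R snd z $ I)" using Cons by blast
  ultimately have A: "iter_pd (j # js) (taylor z) t = (\<Sum>I\<in>UNIV. dir_deriv (axis j 1) (?c I) t *\<^sub>R snd z $ I)"
    using frechet_derivative_eqI by fastforce
  have B: "dir_deriv (axis j 1) (?c I) t = (if mset (j # js) \<subseteq># Rep_mindex I
     then taylor_monomial (Rep_mindex I - mset (j # js)) (t - fst z) else 0)" for I
  proof (cases "mset js \<subseteq># Rep_mindex I")
    case True
    then have "mset (j # js) \<subseteq># Rep_mindex I \<longleftrightarrow> j \<in># Rep_mindex I - mset js"
      by (auto simp: subseteq_mset_def in_diff_count Suc_le_eq)
    then show ?thesis using True dir_deriv_taylor_monomial[where j = j and I = "Rep_mindex I - mset js" and y = "fst z" and t = t]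
      by (simp add: diff_diff_add_mset)
  next
    case False
    then have "\<not> mset (j # js) \<subseteq># Rep_mindex I" by (metis mset_subset_eq_insertD mset.simps(2) subset_mset.less_imp_le)
    then show ?thesis using False by simp
  qed
  show ?case unfolding A by (intro sum.cong refl) (simp only: B)
qed

lemma iter_pd_taylor_center:
  fixes z :: "('n::finite, 'm::finite, 'k::finite) jet_space"
  assumes "length js < CARD('k)"
  shows "iter_pd js (taylor z) (fst z) = snd z $ Abs_mindex (mset js)"
proof -
  have "Rep_mindex (Abs_mindex (mset js) :: ('n, 'k) mindex) = mset js"
    using assms by (intro Abs_mindex_inverse) simp
  then have Rep: "mset js = Rep_mindex I \<longleftrightarrow> I = Abs_mindex (mset js)" for I :: "('n, 'k) mindex"
    using Rep_mindex_inverse[of I] by auto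
  have "iter_pd js (taylor z) (fst z) = (\<Sum>I\<in>UNIV. if I = Abs_mindex (mset js) then snd z $ I else 0)"
    unfolding iter_pd_taylor
  proof (rule sum.cong[OF refl])
    fix I :: "('n, 'k) mindex"
    have "Rep_mindex I - mset js = {#} \<and> mset js \<subseteq># Rep_mindex I \<longleftrightarrow> I = Abs_mindex (mset js)"
      unfolding Rep[symmetric] by (metis Diff_eq_empty_iff_mset subset_mset.antisym subset_mset.order_refl)
    then show "(if mset js \<subseteq># Rep_mindex I then taylor_monomial (Rep_mindex I - mset js) (fst z - fst z) else 0) *\<^sub>R snd z $ I
      = (if I = Abs_mindex (mset js) then snd z $ I else 0)"
      by (auto simp: taylor_monomial_0)
  qed
  then show ?thesis by simp
qed

section \<open>Jets of sections\<close>

lemma same_jet_refl: "same_jet Q E pr k x s s"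
  by (auto simp: same_jet_def)

lemma same_jet_sym: "same_jet Q E pr k x s s' \<Longrightarrow> same_jet Q E pr k x s' s"
  unfolding same_jet_def by fastforce

lemma same_jet_trans: "same_jet Q E pr k x s s' \<Longrightarrow> same_jet Q E pr k x s' s'' \<Longrightarrow> same_jet Q E pr k x s s''"
  unfolding same_jet_def by fastforce

lemma jet_eqI: "same_jet Q E pr k x s s' \<Longrightarrow> jet Q E pr k x s = jet Q E pr k x s'"
  by (simp add: jet_def set_eq_iff) (metis same_jet_sym same_jet_trans)

lemma fst_jet [simp]: "fst (jet Q E pr k x s) = x"
  by (simp add: jet_def)

lemma jet_rep_jet:
  assumes "local_section Q E pr x s"
  shows "local_section Q E pr x (jet_rep (jet Q E pr k x s))" "same_jet Q E pr k x s (jet_rep (jet Q E pr k x s))"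
proof -
  have "s \<in> snd (jet Q E pr k x s)" using assms same_jet_refl by (auto simp: jet_def)
  then have "jet_rep (jet Q E pr k x s) \<in> snd (jet Q E pr k x s)"
    unfolding jet_rep_def some_in_eq by blast
  then show "local_section Q E pr x (jet_rep (jet Q E pr k x s))" "same_jet Q E pr k x s (jet_rep (jet Q E pr k x s))"
    by (auto simp: jet_def)
qed

lemma jet_target_jet: "local_section Q E pr x s \<Longrightarrow> jet_target (jet Q E pr k x s) = s x"
  using jet_rep_jet(2)[of Q E pr x s k] by (simp add: jet_target_def same_jet_def)

lemma jets_cases:
  assumes "\<theta> \<in> jets Q E pr k"
  shows "fst \<theta> \<in> carrier_of Q" "local_section Q E pr (fst \<theta>) (jet_rep \<theta>)"
    "jet Q E pr k (fst \<theta>) (jet_rep \<theta>) = \<theta>"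
proof -
  obtain x s where s: "x \<in> carrier_of Q" "local_section Q E pr x s" "\<theta> = jet Q E pr k x s"
    using assms by (auto simp: jets_def)
  then show "fst \<theta> \<in> carrier_of Q" "local_section Q E pr (fst \<theta>) (jet_rep \<theta>)"
    "jet Q E pr k (fst \<theta>) (jet_rep \<theta>) = \<theta>"
    using jet_rep_jet[OF s(2), of k] jet_eqI[OF jet_rep_jet(2)[OF s(2), of k]] by simp_all
qed

lemma jet_in_jets: "x \<in> carrier_of Q \<Longrightarrow> local_section Q E pr x s \<Longrightarrow> jet Q E pr k x s \<in> jets Q E pr k"
  by (auto simp: jets_def)

text \<open>The section whose local representative is \<open>f\<close>.\<close>

definition chart_section :: "('b, real^'n) chart \<Rightarrow> ('e, (real^'n) \<times> (real^'m)) chart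
    \<Rightarrow> (real^'n \<Rightarrow> real^'m) \<Rightarrow> 'b \<Rightarrow> 'e" where
  "chart_section b c f x = param c (coord b x, f (coord b x))"

definition zero_mindex :: "('n::finite, 'k::finite) mindex" where
  "zero_mindex = Abs_mindex {#}"

text \<open>The enumeration of a multi-index used by \<open>partial_deriv\<close>.\<close>

definition multi_enum :: "('n::finite, 'k::finite) mindex \<Rightarrow> 'n list" where
  "multi_enum I = (SOME js. mset js = Rep_mindex I)"

lemma mset_multi_enum: "mset (multi_enum I) = Rep_mindex I"
  unfolding multi_enum_def by (rule someI_ex) (rule ex_mset)

lemma length_multi_enum: "length (multi_enum (I :: ('n::finite, 'k::finite) mindex)) < CARD('k)"
  using Rep_mindex[of I] by (simp add: mset_multi_enum flip: size_mset)

lemma partial_deriv_multi_enum: "partial_deriv I f = iter_pd (multi_enum I) f"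
  by (simp add: partial_deriv_def multi_enum_def)

lemma Abs_mindex_multi_enum: "Abs_mindex (mset (multi_enum I)) = I"
  by (simp add: mset_multi_enum Rep_mindex_inverse)

lemma partial_deriv_zero: "partial_deriv (zero_mindex :: ('n::finite, 'k::finite) mindex) f = f"
proof -
  have "Rep_mindex (zero_mindex :: ('n, 'k) mindex) = {#}"
    unfolding zero_mindex_def by (rule Abs_mindex_inverse) simp
  then show ?thesis by (simp add: partial_deriv_def)
qed

lemma partial_deriv_Abs_mindex:
  assumes "open S" "smooth_on S f" "y \<in> S" "length js < CARD('k::finite)"
  shows "partial_deriv (Abs_mindex (mset js) :: ('n::finite, 'k) mindex) f y = iter_pd js f y"
proof -
  have "Rep_mindex (Abs_mindex (mset js) :: ('n, 'k) mindex) = mset js"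
    using assms(4) by (intro Abs_mindex_inverse) simp
  then show ?thesis
    unfolding partial_deriv_multi_enum using iter_pd_mset_eq[OF assms(1-3)] mset_multi_enum by metis
qed

locale adapted_charts =
  fixes Q :: "('b, real^'n::finite) chart set"
    and E :: "('e, (real^'n) \<times> (real^'m::finite)) chart set" and pr :: "'e \<Rightarrow> 'b"
  assumes Q: "smooth_atlas Q" and E: "smooth_atlas E"
begin

lemma adaptedD:
  assumes "(b, c) \<in> adapted Q E pr"
  shows "b \<in> Q" "c \<in> E" "is_chart b" "is_chart c"
    "e \<in> dom_ch c \<Longrightarrow> pr e \<in> dom_ch b" "e \<in> dom_ch c \<Longrightarrow> fst (coord c e) = coord b (pr e)"
  using assms smooth_atlas_chart[OF Q] smooth_atlas_chart[OF E] unfolding adapted_def by auto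

lemma local_sectionD:
  assumes "local_section Q E pr x s" shows "pr (s x) = x"
  using assms by (auto simp: local_section_def)

lemma section_in_chart:
  assumes s: "local_section Q E pr x s" and bc: "(b, c) \<in> adapted Q E pr" and x: "s x \<in> dom_ch c"
  obtains S where "open S" "coord b x \<in> S" "S \<subseteq> coord b ` dom_ch b" "smooth_on S (local_rep b c s)"
    "\<And>y. y \<in> S \<Longrightarrow> s (param b y) \<in> dom_ch c"
    "\<And>y. y \<in> S \<Longrightarrow> coord c (s (param b y)) = (y, local_rep b c s y)"
proof -
  obtain U where U: "atlas_open Q U" "x \<in> U" "smooth_map Q E U s" "\<And>y. y \<in> U \<Longrightarrow> pr (s y) = y"
    using s unfolding local_section_def by blast
  note bc' = adaptedD[OF bc]
  have "x \<in> dom_ch b" using bc'(5)[OF x] U by simp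
  then have b: "b \<in> charts_at Q x" and c: "c \<in> charts_at E (s x)"
    using bc' x by (simp_all add: charts_at_def)
  obtain S where S: "open S" "coord b x \<in> S" "S \<subseteq> coord b ` dom_ch b" "param b ` S \<subseteq> U"
    "s ` param b ` S \<subseteq> dom_ch c" "smooth_on S (\<lambda>z. coord c (s (param b z)))"
    by (rule smooth_map_in_charts[OF Q E U(3,2) b c])
  show ?thesis
  proof (rule that[OF S(1-3)])
    show "smooth_on S (local_rep b c s)"
      unfolding local_rep_def by (rule smooth_on_snd[OF S(1,6)])
    fix y assume y: "y \<in> S"
    show "s (param b y) \<in> dom_ch c" using S(5) y by blast
    then have "fst (coord c (s (param b y))) = coord b (pr (s (param b y)))" using bc'(6) by blast
    also have "\<dots> = coord b (param b y)" using U(4) S(4) y by (simp add: subset_eq)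
    also have "\<dots> = y" using S(3) y by (intro coord_param) blast
    finally show "coord c (s (param b y)) = (y, local_rep b c s y)"
      by (simp add: local_rep_def prod_eq_iff)
  qed
qed

text \<open>The value of the representative need only be a point of the chart: its base coordinate then is
  the given one because the charts are adapted, and this makes the map a section.\<close>

lemma local_section_chart_section:
  assumes bc: "(b, c) \<in> adapted Q E pr" and S: "open S" "y0 \<in> S" and f: "smooth_on S f"
    and graph: "\<And>y. y \<in> S \<Longrightarrow> (y, f y) \<in> coord c ` dom_ch c"
  shows "param b y0 \<in> dom_ch b" "coord b (param b y0) = y0" "param b y0 \<in> carrier_of Q"
    "local_section Q E pr (param b y0) (chart_section b c f)"
    "chart_section b c f (param b y0) = param c (y0, f y0)"
    "y \<in> S \<Longrightarrow> local_rep b c (chart_section b c f) y = f y"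
proof -
  note bc' = adaptedD[OF bc]
  have Sb: "y \<in> coord b ` dom_ch b" if y: "y \<in> S" for y
  proof -
    obtain e where e: "e \<in> dom_ch c" "(y, f y) = coord c e" using graph[OF y] by blast
    then have "y = coord b (pr e)" using bc'(6)[OF e(1)] by (metis fst_conv)
    then show ?thesis using bc'(5)[OF e(1)] by blast
  qed
  have cb: "coord b (param b y) = y" "param b y \<in> dom_ch b" if "y \<in> S" for y
    using coord_param[OF Sb[OF that]] param_in_dom[OF Sb[OF that]] by auto
  show "param b y0 \<in> dom_ch b" "coord b (param b y0) = y0" using cb S by auto
  show "param b y0 \<in> carrier_of Q" using cb S bc'(1) unfolding carrier_of_def by blast
  show "chart_section b c f (param b y0) = param c (y0, f y0)" using cb S by (simp add: chart_section_def)
  have eq: "coord c (chart_section b c f (param b y)) = (y, f y)" "chart_section b c f (param b y) \<in> dom_ch c" if "y \<in> S" for y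
    using cb[OF that] coord_param[OF graph[OF that]] param_in_dom[OF graph[OF that]] by (simp_all add: chart_section_def)
  then show "y \<in> S \<Longrightarrow> local_rep b c (chart_section b c f) y = f y" by (simp add: local_rep_def)
  have sub: "S \<subseteq> coord b ` dom_ch b" using Sb by blast
  have op: "atlas_open Q (param b ` S)" by (rule atlas_open_param_image[OF Q bc'(1) S(1) sub])
  have img: "coord b ` param b ` S = S" using cb by (force simp: image_image)
  have "smooth_map Q E (param b ` S) (chart_section b c f)"
    unfolding smooth_map_def
  proof (intro ballI bexI exI conjI)
    show "atlas_open Q (param b ` S)" by (rule op)
    show "param b ` S \<subseteq> param b ` S \<inter> dom_ch b" using cb by blast
    show "chart_section b c f ` param b ` S \<subseteq> dom_ch c" using eq by blast
    have "smooth_on S (\<lambda>y. (y, f y))" by (intro smooth_on_Pair smooth_on_id S f)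
    then show "smooth_on (coord b ` param b ` S) (coord c \<circ> chart_section b c f \<circ> param b)"
      unfolding img by (rule smooth_on_transform[OF _ S(1)]) (simp add: eq)
  qed (use bc' in auto)
  moreover have "pr (chart_section b c f (param b y)) = param b y" if "y \<in> S" for y
  proof -
    have "coord b (pr (chart_section b c f (param b y))) = coord b (param b y)"
      using bc'(6)[OF eq(2)[OF that]] eq(1)[OF that] cb(1)[OF that] by simp
    then show ?thesis using bc'(3) bc'(5)[OF eq(2)[OF that]] cb(2)[OF that]
      unfolding is_chart_def by (auto dest: inj_onD)
  qed
  ultimately show "local_section Q E pr (param b y0) (chart_section b c f)"
    unfolding local_section_def using op S(2) by blast
qed

text \<open>It suffices to compare two sections in one pair of adapted charts: a change of adapted charts
  composes the local representatives with fixed smooth maps on both sides.\<close>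

lemma agree_local_rep_change:
  assumes s: "local_section Q E pr x s" "local_section Q E pr x s'" and sx: "s x = s' x"
    and bc: "(b, c) \<in> adapted Q E pr" "s x \<in> dom_ch c"
    and bc': "(b', c') \<in> adapted Q E pr" "s x \<in> dom_ch c'"
    and ag: "agree k (local_rep b c s) (local_rep b c s') (coord b x)"
  shows "agree k (local_rep b' c' s) (local_rep b' c' s') (coord b' x)"
proof -
  note B = adaptedD[OF bc(1)] and B' = adaptedD[OF bc'(1)]
  let ?f = "local_rep b c s" and ?f' = "local_rep b c s'"
  obtain S1 where S1: "open S1" "coord b x \<in> S1" "S1 \<subseteq> coord b ` dom_ch b" "smooth_on S1 ?f"
    "\<And>y. y \<in> S1 \<Longrightarrow> s (param b y) \<in> dom_ch c" "\<And>y. y \<in> S1 \<Longrightarrow> coord c (s (param b y)) = (y, ?f y)"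
    using section_in_chart[OF s(1) bc] by metis
  obtain S2 where S2: "open S2" "coord b x \<in> S2" "S2 \<subseteq> coord b ` dom_ch b" "smooth_on S2 ?f'"
    "\<And>y. y \<in> S2 \<Longrightarrow> s' (param b y) \<in> dom_ch c" "\<And>y. y \<in> S2 \<Longrightarrow> coord c (s' (param b y)) = (y, ?f' y)"
    using section_in_chart[OF s(2) bc(1)] bc(2) sx by metis
  have xb: "x \<in> dom_ch b" "x \<in> dom_ch b'"
    using B(5)[OF bc(2)] B'(5)[OF bc'(2)] local_sectionD[OF s(1)] by auto
  let ?T = "coord c ` (dom_ch c \<inter> dom_ch c')" and ?\<Phi> = "\<lambda>p. snd (coord c' (param c p))"
  have T: "open ?T" by (rule open_overlap[OF E B(2) B'(2)])
  have \<Phi>: "smooth_on ?T ?\<Phi>" by (rule smooth_on_snd[OF T smooth_transition[OF E B(2) B'(2)]])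
  \<comment> \<open>The points over which both graphs lie in the overlap of the charts \<open>c\<close> and \<open>c'\<close>; below, \<open>S'\<close> is
    the same set in the new base coordinates.\<close>
  define S where "S = {y \<in> {y \<in> S1 \<inter> S2. (y, ?f y) \<in> ?T}. (y, ?f' y) \<in> ?T}"
  have g: "smooth_on R (\<lambda>y. (y, h y))" if "open R" "smooth_on R h" for R and h :: "real^'n \<Rightarrow> real^'m"
    by (intro smooth_on_Pair smooth_on_id that)
  have o12: "open (S1 \<inter> S2)" using S1 S2 by blast
  have o': "open {y \<in> S1 \<inter> S2. (y, ?f y) \<in> ?T}"
    by (rule open_preimage_smooth[OF g[OF o12 smooth_on_subset[OF S1(4)]] o12 T]) blast
  have S: "open S" unfolding S_def
    by (rule open_preimage_smooth[OF g[OF o' smooth_on_subset[OF S2(4)]] o' T]) blast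
  have pbx: "param b (coord b x) = x" by (rule param_coord[OF B(3) xb(1)])
  have xS: "coord b x \<in> S"
  proof -
    have "coord c (s x) = (coord b x, ?f (coord b x))" "coord c (s x) = (coord b x, ?f' (coord b x))"
      using S1(6)[OF S1(2)] S2(6)[OF S2(2)] pbx sx by simp_all
    then have "(coord b x, ?f (coord b x)) \<in> ?T" "(coord b x, ?f' (coord b x)) \<in> ?T"
      using bc(2) bc'(2) by (metis IntI image_eqI)+
    then show ?thesis using S1(2) S2(2) by (simp add: S_def)
  qed
  have smf: "smooth_on S ?f" "smooth_on S ?f'"
    by (rule smooth_on_subset[OF S1(4)], auto simp: S_def) (rule smooth_on_subset[OF S2(4)], auto simp: S_def)
  let ?O = "coord b' ` (dom_ch b' \<inter> dom_ch b)" and ?\<xi> = "\<lambda>y. coord b (param b' y)"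
  have \<xi>: "smooth_on ?O ?\<xi>" and O: "open ?O"
    by (rule smooth_transition[OF Q B'(1) B(1)]) (rule open_overlap[OF Q B'(1) B(1)])
  define S' where "S' = {y \<in> ?O. ?\<xi> y \<in> S}"
  have S': "open S'" unfolding S'_def by (rule open_preimage_smooth[OF \<xi> O S])
  have \<xi>x: "?\<xi> (coord b' x) = coord b x" using param_coord[OF B'(3) xb(2)] by simp
  have xS': "coord b' x \<in> S'" using xb xS \<xi>x by (auto simp: S'_def)
  have pair: "agree k (\<lambda>y. (y, ?f y)) (\<lambda>y. (y, ?f' y)) (coord b x)"
  proof -
    have L: "bounded_linear (\<lambda>y::real^'n. (y, 0::real^'m))" "bounded_linear (\<lambda>v::real^'m. (0::real^'n, v))"
      by (intro bounded_linear_Pair bounded_linear_ident bounded_linear_zero)+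
    have "agree k (\<lambda>y. (y, 0) + (0, ?f y)) (\<lambda>y. (y, 0) + (0, ?f' y)) (coord b x)"
      by (intro agree_add[OF S xS] agree_bounded_linear[OF S xS L(2)] agree_refl ag smf S
          smooth_on_bounded_linear[OF L(1)] smooth_on_bounded_linear_comp[OF L(2)])
    then show ?thesis by simp
  qed
  have inT: "(\<lambda>y. (y, ?f y)) ` S \<subseteq> ?T" "(\<lambda>y. (y, ?f' y)) ` S \<subseteq> ?T" by (auto simp: S_def)
  have sm\<Phi>: "smooth_on S (\<lambda>y. ?\<Phi> (y, ?f y))" "smooth_on S (\<lambda>y. ?\<Phi> (y, ?f' y))"
    by (rule smooth_on_compose[OF S g[OF S smf(1)] \<Phi> inT(1)],
        rule smooth_on_compose[OF S g[OF S smf(2)] \<Phi> inT(2)])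
  have "agree k (\<lambda>y. ?\<Phi> (y, ?f y)) (\<lambda>y. ?\<Phi> (y, ?f' y)) (?\<xi> (coord b' x))"
    unfolding \<xi>x by (rule agree_compose_left[OF S xS g[OF S smf(1)] g[OF S smf(2)] inT \<Phi> pair])
  then have "agree k (\<lambda>y. ?\<Phi> (?\<xi> y, ?f (?\<xi> y))) (\<lambda>y. ?\<Phi> (?\<xi> y, ?f' (?\<xi> y))) (coord b' x)"
    using smooth_on_subset[OF \<xi>, of S'] sm\<Phi>
    by (intro agree_compose_right[OF S' xS', of ?\<xi> S "\<lambda>y. ?\<Phi> (y, ?f y)" "\<lambda>y. ?\<Phi> (y, ?f' y)"]) (auto simp: S'_def)
  then show ?thesis
  proof (rule agree_transform[OF _ S' xS'])
    fix y assume y: "y \<in> S'"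
    have "param b' y \<in> dom_ch b' \<inter> dom_ch b" using y param_in_Int[OF B'(3)] by (auto simp: S'_def)
    then have py: "param b (?\<xi> y) = param b' y" using param_coord[OF B(3)] by auto
    have yS: "?\<xi> y \<in> S1" "?\<xi> y \<in> S2" using y by (auto simp: S'_def S_def)
    show "local_rep b' c' s y = ?\<Phi> (?\<xi> y, ?f (?\<xi> y))"
      using S1(6)[OF yS(1)] param_coord[OF B(4) S1(5)[OF yS(1)]] py by (simp add: local_rep_def)
    show "local_rep b' c' s' y = ?\<Phi> (?\<xi> y, ?f' (?\<xi> y))"
      using S2(6)[OF yS(2)] param_coord[OF B(4) S2(5)[OF yS(2)]] py by (simp add: local_rep_def)
  qed
qed

lemma same_jet_iff_agree:
  assumes s: "local_section Q E pr x s" "local_section Q E pr x s'"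
    and bc: "(b, c) \<in> adapted Q E pr" "s x \<in> dom_ch c"
  shows "same_jet Q E pr k x s s' \<longleftrightarrow> s x = s' x \<and> agree k (local_rep b c s) (local_rep b c s') (coord b x)"
proof
  assume "same_jet Q E pr k x s s'"
  then show "s x = s' x \<and> agree k (local_rep b c s) (local_rep b c s') (coord b x)"
    unfolding same_jet_def agree_iff_iter_pd using bc by fastforce
next
  assume *: "s x = s' x \<and> agree k (local_rep b c s) (local_rep b c s') (coord b x)"
  then have "agree k (local_rep b' c' s) (local_rep b' c' s') (coord b' x)"
    if "(b', c') \<in> adapted Q E pr" "s x \<in> dom_ch c'" for b' c'
    using agree_local_rep_change[OF s _ bc that] by blast
  then show "same_jet Q E pr k x s s'"
    unfolding same_jet_def agree_iff_iter_pd using * by blast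
qed

subsection \<open>Jet charts\<close>

lemma dom_jet_chart:
  "dom_ch (jet_chart Q E pr (b, c) :: (('b, 'e) jet, ('n, 'm, 'k::finite) jet_space) chart)
    = {\<theta> \<in> jets Q E pr (CARD('k) - 1). jet_target \<theta> \<in> dom_ch c}"
  by (simp add: jet_chart_def)

lemma coord_jet_chart:
  "coord (jet_chart Q E pr (b, c) :: (('b, 'e) jet, ('n, 'm, 'k::finite) jet_space) chart) \<theta>
    = (coord b (fst \<theta>), \<chi> I. partial_deriv I (local_rep b c (jet_rep \<theta>)) (coord b (fst \<theta>)))"
  by (simp add: jet_chart_def)

text \<open>Jet coordinates are defined by a chosen representative of the jet, but involve only derivatives
  on which all representatives agree. The order \<open>k\<close> of the jet may exceed that of the coordinates, so
  that this also computes the coordinates of a projected jet.\<close>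

lemma coord_jet_chart_jet:
  assumes bc: "(b, c) \<in> adapted Q E pr" and s: "local_section Q E pr x s" "s x \<in> dom_ch c"
    and k: "CARD('k::finite) - 1 \<le> k"
  shows "coord (jet_chart Q E pr (b, c) :: (('b, 'e) jet, ('n, 'm, 'k) jet_space) chart) (jet Q E pr k x s)
    = (coord b x, \<chi> I. partial_deriv I (local_rep b c s) (coord b x))"
proof -
  let ?s' = "jet_rep (jet Q E pr k x s)"
  have "agree k (local_rep b c s) (local_rep b c ?s') (coord b x)"
    using same_jet_iff_agree[OF s(1) jet_rep_jet(1)[OF s(1)] bc s(2)] jet_rep_jet(2)[OF s(1), of k] by blast
  then have "partial_deriv I (local_rep b c ?s') (coord b x) = partial_deriv I (local_rep b c s) (coord b x)"
    for I :: "('n, 'k) mindex"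
    unfolding agree_iff_iter_pd partial_deriv_multi_enum using length_multi_enum[of I] k by simp
  then show ?thesis by (simp add: coord_jet_chart)
qed

text \<open>Every point of the coordinate space over the domain of \<open>c\<close> is realised by the jet of a
  section that is polynomial in the chart.\<close>

definition poly_jet :: "('b, real^'n) chart \<Rightarrow> ('e, (real^'n) \<times> (real^'m)) chart
    \<Rightarrow> ('n, 'm, 'k::finite) jet_space \<Rightarrow> ('b, 'e) jet" where
  "poly_jet b c z = jet Q E pr (CARD('k) - 1) (param b (fst z)) (chart_section b c (taylor z))"

lemma taylor_center: "taylor z (fst z) = snd z $ zero_mindex"
  using iter_pd_taylor_center[of "[]" z] by (simp add: zero_mindex_def)

lemma poly_section:
  fixes z :: "('n, 'm, 'k::finite) jet_space"
  assumes bc: "(b, c) \<in> adapted Q E pr" and z: "(fst z, snd z $ zero_mindex) \<in> coord c ` dom_ch c"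
  shows "param b (fst z) \<in> dom_ch b" "coord b (param b (fst z)) = fst z"
    "param b (fst z) \<in> carrier_of Q"
    "local_section Q E pr (param b (fst z)) (chart_section b c (taylor z))"
    "chart_section b c (taylor z) (param b (fst z)) = param c (fst z, snd z $ zero_mindex)"
    "\<exists>S. open S \<and> fst z \<in> S \<and> (\<forall>y\<in>S. local_rep b c (chart_section b c (taylor z)) y = taylor z y)"
proof -
  define S where "S = {t \<in> UNIV. (t, taylor z t) \<in> coord c ` dom_ch c}"
  have "open S" unfolding S_def
    by (intro open_preimage_smooth[OF smooth_on_Pair[OF open_UNIV smooth_on_id[OF open_UNIV] smooth_on_taylor_slice]]
      open_UNIV open_chart_image[OF E adaptedD(2)[OF bc]])
  moreover have "fst z \<in> S" using z by (simp add: S_def taylor_center)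
  moreover have "smooth_on S (taylor z)" by (rule smooth_on_subset[OF smooth_on_taylor_slice]) simp
  moreover have "(y, taylor z y) \<in> coord c ` dom_ch c" if "y \<in> S" for y using that by (simp add: S_def)
  ultimately show "param b (fst z) \<in> dom_ch b" "coord b (param b (fst z)) = fst z"
    "param b (fst z) \<in> carrier_of Q"
    "local_section Q E pr (param b (fst z)) (chart_section b c (taylor z))"
    "chart_section b c (taylor z) (param b (fst z)) = param c (fst z, snd z $ zero_mindex)"
    "\<exists>S. open S \<and> fst z \<in> S \<and> (\<forall>y\<in>S. local_rep b c (chart_section b c (taylor z)) y = taylor z y)"
    using local_section_chart_section[OF bc, of S "fst z" "taylor z"] by (auto simp: taylor_center)
qed

lemma poly_jet_coordinates:
  fixes z :: "('n, 'm, 'k::finite) jet_space"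
  assumes bc: "(b, c) \<in> adapted Q E pr" and z: "(fst z, snd z $ zero_mindex) \<in> coord c ` dom_ch c"
  shows "poly_jet b c z \<in> dom_ch (jet_chart Q E pr (b, c) :: (('b, 'e) jet, ('n, 'm, 'k) jet_space) chart)"
    "coord (jet_chart Q E pr (b, c)) (poly_jet b c z) = z"
    "jet_target (poly_jet b c z) = param c (fst z, snd z $ zero_mindex)"
proof -
  note p = poly_section[OF bc z]
  let ?s = "chart_section b c (taylor z)"
  show t: "jet_target (poly_jet b c z) = param c (fst z, snd z $ zero_mindex)"
    using jet_target_jet[OF p(4)] p(5) by (simp add: poly_jet_def)
  have d: "param c (fst z, snd z $ zero_mindex) \<in> dom_ch c" by (rule param_in_dom[OF z])
  show "poly_jet b c z \<in> dom_ch (jet_chart Q E pr (b, c) :: (('b, 'e) jet, ('n, 'm, 'k) jet_space) chart)"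
    unfolding dom_jet_chart using t d jet_in_jets[OF p(3,4)] by (simp add: poly_jet_def)
  obtain S where S: "open S" "fst z \<in> S" "\<And>y. y \<in> S \<Longrightarrow> local_rep b c ?s y = taylor z y"
    using p(6) by blast
  have "partial_deriv I (local_rep b c ?s) (fst z) = snd z $ I" for I :: "('n, 'k) mindex"
    unfolding partial_deriv_multi_enum
    using iter_dir_cong[OF S, of "\<lambda>y. y"] iter_pd_taylor_center[OF length_multi_enum[of I], of z]
    by (simp add: iter_pd_eq_iter_dir Abs_mindex_multi_enum)
  then have "(fst z, \<chi> I. partial_deriv I (local_rep b c ?s) (fst z)) = z"
    by (simp add: prod_eq_iff vec_eq_iff)
  moreover have "?s (param b (fst z)) \<in> dom_ch c" using d p(5) by simp
  ultimately show "coord (jet_chart Q E pr (b, c)) (poly_jet b c z) = z"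
    using coord_jet_chart_jet[OF bc p(4), where 'k = 'k and k = "CARD('k) - 1"] p(2)
    unfolding poly_jet_def by simp
qed

lemma jet_chart_point:
  fixes \<theta> :: "('b, 'e) jet" and b :: "('b, real^'n) chart" and c :: "('e, (real^'n) \<times> (real^'m)) chart"
  defines "C \<equiv> (jet_chart Q E pr (b, c) :: (('b, 'e) jet, ('n, 'm, 'k::finite) jet_space) chart)"
  assumes bc: "(b, c) \<in> adapted Q E pr" and \<theta>: "\<theta> \<in> dom_ch C"
  shows "fst \<theta> \<in> dom_ch b" "fst (coord C \<theta>) = coord b (fst \<theta>)"
    "coord c (jet_target \<theta>) = (fst (coord C \<theta>), snd (coord C \<theta>) $ zero_mindex)"
    "local_section Q E pr (fst \<theta>) (jet_rep \<theta>)" "jet_rep \<theta> (fst \<theta>) \<in> dom_ch c"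
    "jet Q E pr (CARD('k) - 1) (fst \<theta>) (jet_rep \<theta>) = \<theta>"
proof -
  have *: "\<theta> \<in> jets Q E pr (CARD('k) - 1)" "jet_target \<theta> \<in> dom_ch c"
    using \<theta> by (simp_all add: C_def dom_jet_chart)
  note j = jets_cases[OF *(1)]
  show "local_section Q E pr (fst \<theta>) (jet_rep \<theta>)" "jet_rep \<theta> (fst \<theta>) \<in> dom_ch c"
    "jet Q E pr (CARD('k) - 1) (fst \<theta>) (jet_rep \<theta>) = \<theta>"
    using j *(2) by (simp_all add: jet_target_def)
  have p: "pr (jet_target \<theta>) = fst \<theta>" using local_sectionD[OF j(2)] by (simp add: jet_target_def)
  show x: "fst \<theta> \<in> dom_ch b" using adaptedD(5)[OF bc *(2)] p by simp
  show "fst (coord C \<theta>) = coord b (fst \<theta>)" by (simp add: C_def coord_jet_chart)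
  have "snd (coord C \<theta>) $ zero_mindex = snd (coord c (jet_target \<theta>))"
    using param_coord[OF adaptedD(3)[OF bc] x]
    by (simp add: C_def coord_jet_chart partial_deriv_zero local_rep_def jet_target_def)
  then show "coord c (jet_target \<theta>) = (fst (coord C \<theta>), snd (coord C \<theta>) $ zero_mindex)"
    using adaptedD(6)[OF bc *(2)] p by (simp add: prod_eq_iff C_def coord_jet_chart)
qed

text \<open>Jet coordinates of order greater than zero are unconstrained: the polynomial sections take
  all values. So the image of a jet chart is the preimage of the image of the underlying chart.\<close>

lemma jet_chart_image:
  assumes bc: "(b, c) \<in> adapted Q E pr"
  shows "coord (jet_chart Q E pr (b, c) :: (('b, 'e) jet, ('n, 'm, 'k::finite) jet_space) chart) `
      (dom_ch (jet_chart Q E pr (b, c) :: (('b, 'e) jet, ('n, 'm, 'k) jet_space) chart) \<inter> {\<theta>. jet_target \<theta> \<in> D})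
    = {z. (fst z, snd z $ zero_mindex) \<in> coord c ` (dom_ch c \<inter> D)}"
  (is "coord ?C ` _ = ?R")
proof (intro equalityI subsetI)
  fix z assume "z \<in> coord ?C ` (dom_ch ?C \<inter> {\<theta>. jet_target \<theta> \<in> D})"
  then obtain \<theta> where \<theta>: "\<theta> \<in> dom_ch ?C" "jet_target \<theta> \<in> D" "z = coord ?C \<theta>" by blast
  have "coord c (jet_target \<theta>) = (fst z, snd z $ zero_mindex)"
    using jet_chart_point(3)[OF bc \<theta>(1)] \<theta>(3) by simp
  moreover have "jet_target \<theta> \<in> dom_ch c" using \<theta>(1) by (simp add: dom_jet_chart)
  ultimately show "z \<in> ?R" using \<theta>(2) by (metis (no_types, lifting) CollectI IntI image_eqI)
next
  fix z :: "('n, 'm, 'k) jet_space" assume "z \<in> ?R"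
  then have z: "(fst z, snd z $ zero_mindex) \<in> coord c ` (dom_ch c \<inter> D)" by simp
  then have z': "(fst z, snd z $ zero_mindex) \<in> coord c ` dom_ch c" by blast
  have "jet_target (poly_jet b c z) \<in> D"
    using poly_jet_coordinates(3)[OF bc z'] param_in_Int[OF adaptedD(4)[OF bc] z] by simp
  then show "z \<in> coord ?C ` (dom_ch ?C \<inter> {\<theta>. jet_target \<theta> \<in> D})"
    using poly_jet_coordinates(1,2)[OF bc z'] by (metis (no_types, lifting) CollectI IntI image_eqI)
qed

lemma open_jet_chart_image:
  fixes V :: "((real^'n) \<times> (real^'m)) set"
  assumes "open V"
  shows "open {z :: ('n, 'm, 'k::finite) jet_space. (fst z, snd z $ zero_mindex) \<in> V}"
proof -
  have "open {z \<in> UNIV. (fst z, snd (z :: ('n, 'm, 'k) jet_space) $ zero_mindex) \<in> V}"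
    by (intro open_preimage_smooth[OF _ open_UNIV assms] smooth_on_Pair smooth_on_fst smooth_on_snd
        smooth_on_vec_nth smooth_on_id open_UNIV)
  then show ?thesis by simp
qed

text \<open>Equal coordinates give contact in the one chart at hand, for every order of differentiation by
  the symmetry of partial derivatives, and hence equality of jets.\<close>

lemma inj_on_jet_chart:
  assumes bc: "(b, c) \<in> adapted Q E pr"
  shows "inj_on (coord (jet_chart Q E pr (b, c) :: (('b, 'e) jet, ('n, 'm, 'k::finite) jet_space) chart))
    (dom_ch (jet_chart Q E pr (b, c) :: (('b, 'e) jet, ('n, 'm, 'k) jet_space) chart))"
    (is "inj_on (coord ?C) _")
proof (rule inj_onI)
  fix \<theta> \<theta>' assume \<theta>: "\<theta> \<in> dom_ch ?C" and \<theta>': "\<theta>' \<in> dom_ch ?C" and eq: "coord ?C \<theta> = coord ?C \<theta>'"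
  note p = jet_chart_point[OF bc \<theta>] and p' = jet_chart_point[OF bc \<theta>']
  have x: "fst \<theta> = fst \<theta>'"
    using p(1,2) p'(1,2) eq adaptedD(3)[OF bc] unfolding is_chart_def by (metis inj_onD)
  have "jet_target \<theta> = jet_target \<theta>'"
    using p(3,5) p'(3,5) eq adaptedD(4)[OF bc] unfolding is_chart_def jet_target_def by (metis inj_onD)
  then have t: "jet_rep \<theta> (fst \<theta>) = jet_rep \<theta>' (fst \<theta>)" using x by (simp add: jet_target_def)
  note s' = p'(4)[folded x]
  let ?y = "coord b (fst \<theta>)" and ?f = "local_rep b c (jet_rep \<theta>)" and ?f' = "local_rep b c (jet_rep \<theta>')"
  obtain S where S: "open S" "?y \<in> S" "smooth_on S ?f" using section_in_chart[OF p(4) bc p(5)] by metis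
  obtain S' where S': "open S'" "?y \<in> S'" "smooth_on S' ?f'"
    using section_in_chart[OF s' bc] p'(5) x by metis
  have "agree (CARD('k) - 1) ?f ?f' ?y"
    unfolding agree_iff_iter_pd
  proof (intro allI impI)
    fix js :: "'n list" assume "length js \<le> CARD('k) - 1"
    then have js: "length js < CARD('k)" using zero_less_card_finite[where 'a = 'k] by linarith
    let ?I = "Abs_mindex (mset js) :: ('n, 'k) mindex"
    have "partial_deriv ?I ?f ?y = partial_deriv ?I ?f' ?y"
      using eq x by (simp add: coord_jet_chart vec_eq_iff)
    then show "iter_pd js ?f ?y = iter_pd js ?f' ?y"
      using partial_deriv_Abs_mindex[OF S(1,3,2) js] partial_deriv_Abs_mindex[OF S'(1,3,2) js] by simp
  qed
  then have "same_jet Q E pr (CARD('k) - 1) (fst \<theta>) (jet_rep \<theta>) (jet_rep \<theta>')"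
    using same_jet_iff_agree[OF p(4) s' bc p(5)] t by blast
  then show "\<theta> = \<theta>'" using jet_eqI p(6) p'(6) x by metis
qed

lemma is_chart_jet_chart:
  assumes bc: "(b, c) \<in> adapted Q E pr"
  shows "is_chart (jet_chart Q E pr (b, c) :: (('b, 'e) jet, ('n, 'm, 'k::finite) jet_space) chart)"
  using inj_on_jet_chart[OF bc, where 'k = 'k] jet_chart_image[OF bc, where D = UNIV and 'k = 'k]
    open_jet_chart_image[OF open_chart_image[OF E adaptedD(2)[OF bc]], where 'k = 'k]
  by (simp add: is_chart_def)

lemma param_jet_chart:
  fixes z :: "('n, 'm, 'k::finite) jet_space"
  assumes bc: "(b, c) \<in> adapted Q E pr" and z: "(fst z, snd z $ zero_mindex) \<in> coord c ` dom_ch c"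
  shows "param (jet_chart Q E pr (b, c)) z = poly_jet b c z"
  using param_coord[OF is_chart_jet_chart[OF bc] poly_jet_coordinates(1)[OF bc z]] poly_jet_coordinates(2)[OF bc z] by metis

text \<open>In new coordinates, the representatives of the polynomial sections form a family \<open>K (z, t)\<close>
  that is smooth jointly in the jet coordinates \<open>z\<close> and the new base coordinates \<open>t\<close>; the new jet
  coordinates are iterated derivatives of \<open>K\<close> in directions of \<open>t\<close>.\<close>

lemma smooth_jet_transition:
  assumes bc: "(b, c) \<in> adapted Q E pr" and bc': "(b', c') \<in> adapted Q E pr"
  shows "smooth_on {z :: ('n, 'm, 'k::finite) jet_space. (fst z, snd z $ zero_mindex) \<in> coord c ` (dom_ch c \<inter> dom_ch c')}
    (\<lambda>z. coord (jet_chart Q E pr (b', c') :: (('b, 'e) jet, ('n, 'm, 'k) jet_space) chart)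
       (param (jet_chart Q E pr (b, c)) z))" (is "smooth_on ?R _")
proof -
  note B = adaptedD[OF bc] and B' = adaptedD[OF bc']
  let ?T = "coord c ` (dom_ch c \<inter> dom_ch c')" and ?\<Phi> = "\<lambda>p. snd (coord c' (param c p))"
  let ?O = "coord b' ` (dom_ch b' \<inter> dom_ch b)" and ?\<xi> = "\<lambda>y. coord b (param b' y)"
  have T: "open ?T" by (rule open_overlap[OF E B(2) B'(2)])
  have \<Phi>: "smooth_on ?T ?\<Phi>" by (rule smooth_on_snd[OF T smooth_transition[OF E B(2) B'(2)]])
  have \<xi>: "smooth_on ?O ?\<xi>" and O: "open ?O"
    by (rule smooth_transition[OF Q B'(1) B(1)]) (rule open_overlap[OF Q B'(1) B(1)])
  have R: "open ?R" by (rule open_jet_chart_image[OF T])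
  let ?g = "\<lambda>p :: ('n, 'm, 'k) jet_space \<times> (real^'n). (?\<xi> (snd p), taylor (fst p) (?\<xi> (snd p)))"
  define \<Omega>0 where "\<Omega>0 = {p :: ('n, 'm, 'k) jet_space \<times> (real^'n). snd p \<in> ?O}"
  have \<Omega>0: "open \<Omega>0"
  proof -
    have "open {p \<in> UNIV. snd (p :: ('n, 'm, 'k) jet_space \<times> (real^'n)) \<in> ?O}"
      by (rule open_preimage_smooth[OF smooth_on_snd[OF open_UNIV smooth_on_id[OF open_UNIV]] open_UNIV O])
    then show ?thesis by (simp add: \<Omega>0_def)
  qed
  have sm\<xi>: "smooth_on \<Omega>0 (\<lambda>p. ?\<xi> (snd p))"
    by (rule smooth_on_compose[OF \<Omega>0 smooth_on_snd[OF \<Omega>0 smooth_on_id[OF \<Omega>0]] \<xi>]) (auto simp: \<Omega>0_def)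
  have "smooth_on \<Omega>0 (\<lambda>p. (fst p, ?\<xi> (snd p)))"
    by (intro smooth_on_Pair smooth_on_fst smooth_on_id sm\<xi> \<Omega>0)
  from smooth_on_compose[OF \<Omega>0 this smooth_on_taylor subset_UNIV]
  have smg: "smooth_on \<Omega>0 ?g" by (intro smooth_on_Pair \<Omega>0 sm\<xi>) simp
  \<comment> \<open>The pairs \<open>(z, t)\<close> such that the polynomial section with jet \<open>z\<close> takes over \<open>t\<close> a value in the overlap
    of \<open>c\<close> and \<open>c'\<close>. On this open set \<open>K\<close> is smooth, and it contains the graph of \<open>?\<phi>\<close> over \<open>?R\<close>.\<close>
  define \<Omega> where "\<Omega> = {p \<in> \<Omega>0. ?g p \<in> ?T}"
  have \<Omega>: "open \<Omega>" unfolding \<Omega>_def by (rule open_preimage_smooth[OF smg \<Omega>0 T])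
  define K where "K p = ?\<Phi> (?g p)" for p
  have K: "smooth_on \<Omega> K"
    unfolding K_def using smooth_on_subset[OF smg, of \<Omega>]
    by (intro smooth_on_compose[OF \<Omega> _ \<Phi>]) (auto simp: \<Omega>_def)
  let ?\<phi> = "\<lambda>z :: ('n, 'm, 'k) jet_space. coord b' (param b (fst z))"
  have inb: "fst z \<in> coord b ` (dom_ch b \<inter> dom_ch b')" if z: "z \<in> ?R" for z :: "('n, 'm, 'k) jet_space"
  proof -
    obtain e where e: "e \<in> dom_ch c" "e \<in> dom_ch c'" "(fst z, snd z $ zero_mindex) = coord c e" using z by blast
    then have "fst z = coord b (pr e)" using B(6)[OF e(1)] by (metis fst_conv)
    then show ?thesis using B(5)[OF e(1)] B'(5)[OF e(2)] by blast
  qed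
  have \<phi>: "smooth_on ?R ?\<phi>"
    using inb by (intro smooth_on_compose[OF R smooth_on_fst[OF R smooth_on_id[OF R]] smooth_transition[OF Q B(1) B'(1)]]) auto
  have \<xi>\<phi>: "?\<xi> (?\<phi> z) = fst z" "?\<phi> z \<in> ?O" if z: "z \<in> ?R" for z
  proof -
    have pb: "param b (fst z) \<in> dom_ch b \<inter> dom_ch b'" by (rule param_in_Int[OF B(3) inb[OF z]])
    then show "?\<xi> (?\<phi> z) = fst z"
      using param_coord[OF B'(3)] coord_param[of "fst z" b] inb[OF z] by auto
    show "?\<phi> z \<in> ?O" using pb by blast
  qed
  have in\<Omega>: "(z, ?\<phi> z) \<in> \<Omega>" if z: "z \<in> ?R" for z
    using \<xi>\<phi>[OF z] z unfolding \<Omega>_def \<Omega>0_def by (simp add: taylor_center)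
  let ?D = "\<lambda>I. iter_dir (map (Pair 0) (map (\<lambda>i. axis i 1) (multi_enum (I :: ('n, 'k) mindex)))) K"
  have "smooth_on ?R (\<lambda>z. (?\<phi> z, \<chi> I. ?D I (z, ?\<phi> z)))"
  proof (intro smooth_on_Pair smooth_on_vec_lambda R \<phi>)
    fix I :: "('n, 'k) mindex"
    show "smooth_on ?R (\<lambda>z. ?D I (z, ?\<phi> z))"
      by (rule smooth_on_compose[OF R smooth_on_Pair[OF R smooth_on_id[OF R] \<phi>] smooth_on_iter_dir[OF K]])
        (use in\<Omega> in blast)
  qed
  then show ?thesis
  proof (rule smooth_on_transform[OF _ R])
    fix z assume z: "z \<in> ?R"
    then have z': "(fst z, snd z $ zero_mindex) \<in> coord c ` dom_ch c" by blast
    note p = poly_section[OF bc z']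
    let ?s = "chart_section b c (taylor z)"
    have "?s (param b (fst z)) \<in> dom_ch c'"
      using p(5) param_in_Int[OF B(4), of "(fst z, snd z $ zero_mindex)" "dom_ch c'"] z by simp
    from coord_jet_chart_jet[OF bc' p(4) this, of "CARD('k) - 1", where 'k = 'k]
    have "coord (jet_chart Q E pr (b', c') :: (('b, 'e) jet, ('n, 'm, 'k) jet_space) chart) (poly_jet b c z)
      = (?\<phi> z, \<chi> I. partial_deriv I (local_rep b' c' ?s) (?\<phi> z))"
      by (simp add: poly_jet_def)
    moreover have "local_rep b' c' ?s = (\<lambda>t. K (z, t))"
      by (auto simp: local_rep_def chart_section_def K_def)
    moreover have "partial_deriv I (\<lambda>t. K (z, t)) (?\<phi> z) = ?D I (z, ?\<phi> z)" for I :: "('n, 'k) mindex"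
      unfolding partial_deriv_multi_enum iter_pd_eq_iter_dir by (rule iter_dir_slice[OF \<Omega> K in\<Omega>[OF z]])
    ultimately show "(?\<phi> z, \<chi> I. ?D I (z, ?\<phi> z)) =
      coord (jet_chart Q E pr (b', c') :: (('b, 'e) jet, ('n, 'm, 'k) jet_space) chart) (param (jet_chart Q E pr (b, c)) z)"
      unfolding param_jet_chart[OF bc z'] by simp
  qed
qed

lemma jet_chart_overlap:
  "dom_ch (jet_chart Q E pr (b, c) :: (('b, 'e) jet, ('n, 'm, 'k::finite) jet_space) chart)
    \<inter> dom_ch (jet_chart Q E pr (b', c') :: (('b, 'e) jet, ('n, 'm, 'k) jet_space) chart)
   = dom_ch (jet_chart Q E pr (b, c) :: (('b, 'e) jet, ('n, 'm, 'k) jet_space) chart) \<inter> {\<theta>. jet_target \<theta> \<in> dom_ch c'}"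
  by (auto simp: dom_jet_chart)

theorem smooth_atlas_jet_atlas:
  "smooth_atlas (jet_atlas Q E pr :: (('b, 'e) jet, ('n, 'm, 'k::finite) jet_space) chart set)"
proof -
  have half: "open (coord C ` (dom_ch C \<inter> dom_ch C'))"
    "smooth_on (coord C ` (dom_ch C \<inter> dom_ch C')) (coord C' \<circ> param C)"
    if bc: "(b, c) \<in> adapted Q E pr" "(b', c') \<in> adapted Q E pr"
      and C: "C = (jet_chart Q E pr (b, c) :: (('b, 'e) jet, ('n, 'm, 'k) jet_space) chart)"
        "C' = (jet_chart Q E pr (b', c') :: (('b, 'e) jet, ('n, 'm, 'k) jet_space) chart)" for b c b' c' C C'
  proof -
    have eq: "coord C ` (dom_ch C \<inter> dom_ch C') = {z. (fst z, snd z $ zero_mindex) \<in> coord c ` (dom_ch c \<inter> dom_ch c')}"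
      unfolding C jet_chart_overlap by (rule jet_chart_image[OF bc(1)])
    show "open (coord C ` (dom_ch C \<inter> dom_ch C'))"
      unfolding eq by (rule open_jet_chart_image[OF open_overlap[OF E adaptedD(2)[OF bc(1)] adaptedD(2)[OF bc(2)]]])
    show "smooth_on (coord C ` (dom_ch C \<inter> dom_ch C')) (coord C' \<circ> param C)"
      unfolding eq unfolding comp_def C by (rule smooth_jet_transition[OF bc])
  qed
  let ?J = "jet_atlas Q E pr :: (('b, 'e) jet, ('n, 'm, 'k) jet_space) chart set"
  have J: "\<exists>b c. (b, c) \<in> adapted Q E pr \<and> C = jet_chart Q E pr (b, c)" if "C \<in> ?J" for C
    using that unfolding jet_atlas_def by (metis imageE surj_pair)
  show ?thesis
    unfolding smooth_atlas_def
  proof (intro conjI ballI)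
    fix C assume "C \<in> ?J"
    then show "is_chart C" using J[of C] is_chart_jet_chart by blast
  next
    fix C C' assume "C \<in> ?J" "C' \<in> ?J"
    then obtain b c b' c' where bc: "(b, c) \<in> adapted Q E pr" "C = jet_chart Q E pr (b, c)"
      "(b', c') \<in> adapted Q E pr" "C' = jet_chart Q E pr (b', c')" using J by metis
    show "compatible_charts C C'"
      unfolding compatible_charts_def
      using half[OF bc(1,3,2,4)] half[OF bc(3,1,4,2)] by (simp only: Int_commute simp_thms)
  qed
qed

end

section \<open>Truncation of jets and the vertical bundle\<close>

definition raise_mindex :: "('n::finite, 'r::finite) mindex \<Rightarrow> ('n, 'r option) mindex" where
  "raise_mindex I = Abs_mindex (Rep_mindex I)"

definition lower_mindex :: "('n::finite, 'r::finite option) mindex \<Rightarrow> ('n, 'r) mindex" where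
  "lower_mindex I = Abs_mindex (Rep_mindex I)"

lemma Rep_raise_mindex: "Rep_mindex (raise_mindex I) = Rep_mindex I"
  unfolding raise_mindex_def using Rep_mindex[of I] by (intro Abs_mindex_inverse) simp

lemma lower_raise_mindex: "lower_mindex (raise_mindex I) = I"
  by (simp add: lower_mindex_def Rep_raise_mindex Rep_mindex_inverse)

lemma raise_lower_mindex:
  assumes "deg (I :: ('n::finite, 'r::finite option) mindex) < CARD('r)"
  shows "raise_mindex (lower_mindex I) = I"
proof -
  have "Rep_mindex (Abs_mindex (Rep_mindex I) :: ('n, 'r) mindex) = Rep_mindex I"
    using assms by (intro Abs_mindex_inverse) (simp add: deg_def)
  then show ?thesis by (simp add: raise_mindex_def lower_mindex_def Rep_mindex_inverse)
qed

lemma deg_raise_mindex: "deg (raise_mindex (I :: ('n::finite, 'r::finite) mindex)) < CARD('r)"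
  using Rep_mindex[of I] by (simp add: deg_def Rep_raise_mindex)

lemma deg_le: "deg (I :: ('n::finite, 'r::finite option) mindex) \<le> CARD('r)"
  using Rep_mindex[of I] by (simp add: deg_def)

lemma raise_zero_mindex: "raise_mindex zero_mindex = zero_mindex"
proof -
  have "Rep_mindex (zero_mindex :: ('a, 'b) mindex) = {#}"
    unfolding zero_mindex_def by (rule Abs_mindex_inverse) simp
  then show ?thesis by (simp add: raise_mindex_def zero_mindex_def)
qed

lemma partial_deriv_raise_mindex: "partial_deriv (raise_mindex I) f = partial_deriv I f"
  by (simp add: partial_deriv_def Rep_raise_mindex)

text \<open>Multi-indices of order at most \<open>r - 1\<close> and \<open>r\<close> form different types; \<open>truncate\<close> is the
  coordinate expression of the projection of jets, and \<open>extend\<close> its linear section that fills in zeros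
  in order \<open>r\<close>.\<close>

definition truncate :: "('n::finite, 'm::finite, 'r::finite option) jet_space \<Rightarrow> ('n, 'm, 'r) jet_space" where
  "truncate z = (fst z, \<chi> I. snd z $ raise_mindex I)"

definition extend :: "('n::finite, 'm::finite, 'r::finite) jet_space \<Rightarrow> ('n, 'm, 'r option) jet_space" where
  "extend y = (fst y, \<chi> I. if deg I < CARD('r) then snd y $ lower_mindex I else 0)"

lemma linear_truncate: "linear truncate"
  unfolding truncate_def by (intro linearI) (simp_all add: vec_eq_iff)

lemma linear_extend: "linear extend"
  unfolding extend_def by (intro linearI) (simp_all add: vec_eq_iff)

lemma truncate_extend: "truncate (extend y) = y"
  by (simp add: truncate_def extend_def deg_raise_mindex lower_raise_mindex)

definition jet_axis :: "('n::finite, 'k::finite) mindex \<times> 'm::finite \<Rightarrow> ('n, 'm, 'k) jet_space" where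
  "jet_axis p = (0, axis (fst p) (axis (snd p) 1))"

definition top_axes :: "('n::finite, 'm::finite, 'r::finite option) jet_space set" where
  "top_axes = jet_axis ` {(I, \<alpha>). deg I = CARD('r)}"

lemma jet_axis_in_Basis: "jet_axis p \<in> Basis"
  by (auto simp: jet_axis_def Basis_prod_def Basis_vec_def image_iff)

lemma inner_jet_axis: "z \<bullet> jet_axis p = snd z $ fst p $ snd p"
  by (simp add: jet_axis_def inner_prod_def inner_axis)

lemma top_axes_subset_Basis: "top_axes \<subseteq> Basis"
  using jet_axis_in_Basis by (auto simp: top_axes_def)

lemma sum_jet_axis_component:
  "finite S \<Longrightarrow> snd (\<Sum>p\<in>S. c p *\<^sub>R jet_axis p) $ I $ \<alpha> = (if (I, \<alpha>) \<in> S then c (I, \<alpha>) else 0)"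
proof -
  assume S: "finite S"
  have "snd (\<Sum>p\<in>S. c p *\<^sub>R jet_axis p) $ I $ \<alpha> = (\<Sum>p\<in>S. if p = (I, \<alpha>) then c p else 0)"
    by (simp add: snd_sum sum_component jet_axis_def axis_def if_distrib prod_eq_iff cong: if_cong)
      (rule sum.cong, auto)
  then show ?thesis using S by simp
qed

lemma fst_sum_jet_axis: "fst (\<Sum>p\<in>S. c p *\<^sub>R jet_axis p) = 0"
  by (simp add: fst_sum jet_axis_def)

lemma drop_coords_eq: "drop_coords S z = z - (\<Sum>p\<in>S. (z \<bullet> jet_axis p) *\<^sub>R jet_axis p)"
  by (simp add: drop_coords_def prod_eq_iff vec_eq_iff fst_sum_jet_axis sum_jet_axis_component inner_jet_axis)

lemma linear_drop_coords: "linear (drop_coords S)"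
  unfolding drop_coords_def by (intro linearI) (simp_all add: vec_eq_iff)

lemma drop_coords_add_axes:
  "drop_coords S (drop_coords S z + (\<Sum>p\<in>S. c p *\<^sub>R jet_axis p)) = drop_coords S z"
  by (simp add: drop_coords_def prod_eq_iff vec_eq_iff fst_sum_jet_axis sum_jet_axis_component)

lemma truncate_drop_coords:
  assumes "\<forall>(I, \<alpha>)\<in>S. deg (I :: ('n::finite, 'r::finite option) mindex) = CARD('r)"
  shows "truncate (drop_coords S z) = truncate z"
proof -
  have "(raise_mindex I, \<alpha>) \<notin> S" for I :: "('n, 'r) mindex" and \<alpha>
    using assms deg_raise_mindex[of I] by fastforce
  then show ?thesis by (simp add: truncate_def drop_coords_def prod_eq_iff vec_eq_iff)
qed

text \<open>A multi-index of order less than \<open>r\<close> comes from the smaller type, so a vector with zero truncation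
  has components of order exactly \<open>r\<close> only.\<close>

lemma truncate_eq_0_iff: "truncate w = 0 \<longleftrightarrow> w \<in> span top_axes"
proof
  assume 0: "truncate (w :: ('a, 'b, 'c option) jet_space) = 0"
  have low: "snd w $ I = 0" if "deg I < CARD('c)" for I
    using 0 raise_lower_mindex[OF that] by (simp add: truncate_def prod_eq_iff vec_eq_iff) metis
  let ?S = "{(I, \<alpha>). deg (I :: ('a, 'c option) mindex) = CARD('c)} :: (('a, 'c option) mindex \<times> 'b) set"
  have "snd w $ I = 0" if "deg I \<noteq> CARD('c)" for I using low that deg_le[of I] by (metis le_neq_implies_less)
  then have "w = (\<Sum>p\<in>?S. (w \<bullet> jet_axis p) *\<^sub>R jet_axis p)"
    using 0 by (auto simp: prod_eq_iff vec_eq_iff fst_sum_jet_axis sum_jet_axis_component inner_jet_axis truncate_def)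
  also have "\<dots> \<in> span top_axes"
    by (intro span_sum span_scale span_base) (simp add: top_axes_def)
  finally show "w \<in> span top_axes" .
next
  assume "w \<in> span (top_axes :: ('a, 'b, 'c option) jet_space set)"
  moreover have "truncate x = 0" if x: "x \<in> (top_axes :: ('a, 'b, 'c option) jet_space set)" for x
  proof -
    obtain I \<alpha> where I: "x = jet_axis (I, \<alpha>)" "deg I = CARD('c)" using x by (auto simp: top_axes_def)
    have "raise_mindex K \<noteq> I" for K :: "('a, 'c) mindex" using deg_raise_mindex[of K] I(2) by auto
    then show ?thesis using I(1) by (simp add: truncate_def jet_axis_def axis_def prod_eq_iff vec_eq_iff)
  qed
  ultimately show "truncate w = 0" using linear_eq_0_on_span[OF linear_truncate] by blast
qed

context adapted_charts
begin

context
  fixes b :: "('b, real^'n) chart" and c :: "('e, (real^'n) \<times> (real^'m)) chart"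
    and C :: "(('b, 'e) jet, ('n, 'm, 'r::finite option) jet_space) chart"
    and C' :: "(('b, 'e) jet, ('n, 'm, 'r) jet_space) chart"
  assumes bc: "(b, c) \<in> adapted Q E pr" and C: "C = jet_chart Q E pr (b, c)" and C': "C' = jet_chart Q E pr (b, c)"
begin

lemma jet_proj_in_chart:
  assumes "\<theta> \<in> dom_ch C"
  shows "jet_proj Q E pr (CARD('r) - 1) \<theta> \<in> dom_ch C'"
    "coord C' (jet_proj Q E pr (CARD('r) - 1) \<theta>) = truncate (coord C \<theta>)"
proof -
  note p = jet_chart_point[OF bc assms[unfolded C]]
  have "fst \<theta> \<in> carrier_of Q" using p(1) adaptedD(1)[OF bc] unfolding carrier_of_def by blast
  then show "jet_proj Q E pr (CARD('r) - 1) \<theta> \<in> dom_ch C'"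
    unfolding C' dom_jet_chart jet_proj_def using p(4,5) jet_in_jets jet_target_jet[OF p(4)] by simp
  show "coord C' (jet_proj Q E pr (CARD('r) - 1) \<theta>) = truncate (coord C \<theta>)"
    unfolding C' C jet_proj_def coord_jet_chart_jet[OF bc p(4,5) order_refl]
    by (simp add: coord_jet_chart truncate_def partial_deriv_raise_mindex)
qed

lemma truncate_in_image:
  assumes "z \<in> coord C ` dom_ch C" shows "truncate z \<in> coord C' ` dom_ch C'"
    "coord C' (jet_proj Q E pr (CARD('r) - 1) (param C z)) = truncate z"
proof -
  note d = param_in_dom[OF assms] and eq = coord_param[OF assms]
  show "coord C' (jet_proj Q E pr (CARD('r) - 1) (param C z)) = truncate z"
    using jet_proj_in_chart(2)[OF d] eq by simp
  then show "truncate z \<in> coord C' ` dom_ch C'" using jet_proj_in_chart(1)[OF d] by (metis imageI)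
qed

end

lemma jet_atlas_cases:
  assumes "C \<in> jet_atlas Q E pr"
  obtains b c where "(b, c) \<in> adapted Q E pr" "C = jet_chart Q E pr (b, c)"
  using assms unfolding jet_atlas_def by (metis imageE surj_pair)

lemma atlas_open_dom:
  assumes A: "smooth_atlas A" and c: "c \<in> A" shows "atlas_open A (dom_ch c)"
proof -
  have "param c ` coord c ` dom_ch c = dom_ch c"
    using param_coord[OF smooth_atlas_chart[OF A c]] by (force simp: image_image)
  then show ?thesis using atlas_open_param_image[OF A c open_chart_image[OF A c] subset_refl] by simp
qed

lemma smooth_map_jet_proj:
  fixes J :: "(('b, 'e) jet, ('n, 'm, 'r::finite option) jet_space) chart set"
    and J' :: "(('b, 'e) jet, ('n, 'm, 'r) jet_space) chart set"
  assumes J: "J = jet_atlas Q E pr" and J': "J' = jet_atlas Q E pr"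
  shows "smooth_map J J' (carrier_of J) (jet_proj Q E pr (CARD('r) - 1))"
  unfolding smooth_map_def
proof
  fix \<theta> assume "\<theta> \<in> carrier_of J"
  then obtain C where CJ: "C \<in> J" "\<theta> \<in> dom_ch C" by (auto simp: carrier_of_def)
  then obtain b c where bc: "(b, c) \<in> adapted Q E pr" "C = jet_chart Q E pr (b, c)"
    unfolding J by (elim jet_atlas_cases)
  let ?C' = "jet_chart Q E pr (b, c) :: (('b, 'e) jet, ('n, 'm, 'r) jet_space) chart"
  have A: "smooth_atlas J" unfolding J by (rule smooth_atlas_jet_atlas)
  have oC: "open (coord C ` dom_ch C)" by (rule open_chart_image[OF A CJ(1)])
  have C'J: "?C' \<in> J'" unfolding J' jet_atlas_def using bc(1) by (rule imageI)
  note t = truncate_in_image[OF bc refl]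
  have "smooth_on (coord C ` dom_ch C) (coord ?C' \<circ> jet_proj Q E pr (CARD('r) - 1) \<circ> param C)"
    by (rule smooth_on_transform[OF smooth_on_linear[OF linear_truncate oC] oC])
      (simp only: comp_apply t(2))
  moreover have "jet_proj Q E pr (CARD('r) - 1) ` dom_ch C \<subseteq> dom_ch ?C'"
    using jet_proj_in_chart(1)[OF bc refl] by blast
  moreover have "dom_ch C \<subseteq> carrier_of J \<inter> dom_ch C" using CJ(1) unfolding carrier_of_def by blast
  ultimately show "\<exists>c\<in>J. \<exists>d\<in>J'. \<exists>N. atlas_open J N \<and> \<theta> \<in> N \<and> N \<subseteq> carrier_of J \<inter> dom_ch c \<and>
      jet_proj Q E pr (CARD('r) - 1) ` N \<subseteq> dom_ch d \<and>
      smooth_on (coord c ` N) (coord d \<circ> jet_proj Q E pr (CARD('r) - 1) \<circ> param c)"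
    using atlas_open_dom[OF A CJ(1)] CJ C'J by blast
qed

text \<open>Read in the two jet charts of the same adapted charts, the projection is the linear map
  \<open>truncate\<close>, which is its own derivative.\<close>

lemma vertical_space_iff:
  fixes J :: "(('b, 'e) jet, ('n, 'm, 'r::finite option) jet_space) chart set"
  assumes J: "J = jet_atlas Q E pr" and C: "C \<in> charts_at J \<theta>"
  shows "v \<in> vertical_space Q E pr \<theta> \<longleftrightarrow> v \<in> tangent_space J \<theta> \<and> truncate (v C) = 0"
proof -
  let ?J' = "jet_atlas Q E pr :: (('b, 'e) jet, ('n, 'm, 'r) jet_space) chart set"
  let ?p = "jet_proj Q E pr (CARD('r) - 1)"
  note CJ = charts_at_in[OF C]
  obtain b c where bc: "(b, c) \<in> adapted Q E pr" "C = jet_chart Q E pr (b, c)"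
    using CJ(1) unfolding J by (elim jet_atlas_cases)
  let ?C' = "jet_chart Q E pr (b, c) :: (('b, 'e) jet, ('n, 'm, 'r) jet_space) chart"
  have A: "smooth_atlas J" unfolding J by (rule smooth_atlas_jet_atlas)
  have A': "smooth_atlas ?J'" by (rule smooth_atlas_jet_atlas)
  have C': "?C' \<in> charts_at ?J' (?p \<theta>)"
    using jet_proj_in_chart(1)[OF bc refl CJ(2)] bc(1) unfolding charts_at_def jet_atlas_def by blast
  have \<theta>: "\<theta> \<in> carrier_of J" using CJ unfolding carrier_of_def by blast
  have oC: "open (coord C ` dom_ch C)" by (rule open_chart_image[OF A CJ(1)])
  have "frechet_derivative (\<lambda>z. coord ?C' (?p (param C z))) (at (coord C \<theta>)) = frechet_derivative truncate (at (coord C \<theta>))"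
    using truncate_in_image(2)[OF bc refl] CJ(2) by (intro frechet_derivative_cong_open[OF oC]) auto
  also have "\<dots> = truncate"
    by (intro frechet_derivative_eqI bounded_linear_imp_has_derivative)
      (simp add: linear_conv_bounded_linear[symmetric] linear_truncate)
  finally show ?thesis
    unfolding vertical_space_def
    using tangent_map_eq_zero_iff[OF A A' smooth_map_jet_proj[OF J refl] \<theta> C C'] J by auto
qed

end

section \<open>Transversality, normal forms and graphs\<close>

text \<open>The implicit function theorem speaks of axes indexed by \<open>'q\<close>, normal forms of a set of pairs
  \<open>(I, \<alpha>)\<close>; this translates the former into the latter.\<close>

lemma range_top_axes:
  fixes \<beta> :: "'q::finite \<Rightarrow> ('n::finite, 'm::finite, 'r::finite option) jet_space"
  assumes "inj \<beta>" "range \<beta> \<subseteq> top_axes"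
  obtains \<sigma> where "inj \<sigma>" "\<forall>a. \<beta> a = jet_axis (\<sigma> a)" "\<forall>(I, \<alpha>)\<in>range \<sigma>. deg I = CARD('r)"
    "\<forall>z. kill_axes \<beta> z = drop_coords (range \<sigma>) z"
proof -
  have "\<exists>p. \<beta> a = jet_axis p \<and> (case p of (I, \<alpha>) \<Rightarrow> deg I = CARD('r))" for a
    using assms(2) unfolding top_axes_def by blast
  then obtain \<sigma> where \<sigma>: "\<And>a. \<beta> a = jet_axis (\<sigma> a)" "\<And>a. case \<sigma> a of (I, \<alpha>) \<Rightarrow> deg I = CARD('r)"
    by metis
  have inj: "inj \<sigma>" using assms(1) \<sigma>(1) unfolding inj_def by metis
  have "kill_axes \<beta> z = drop_coords (range \<sigma>) z" for z
    unfolding kill_axes_def drop_coords_eq by (simp add: sum.reindex[OF inj] \<sigma>(1))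
  moreover have "\<forall>(I, \<alpha>)\<in>range \<sigma>. deg I = CARD('r)"
  proof
    fix p assume "p \<in> range \<sigma>"
    then obtain a where "p = \<sigma> a" by blast
    then show "case p of (I, \<alpha>) \<Rightarrow> deg I = CARD('r)" using \<sigma>(2)[of a] by simp
  qed
  moreover have "\<forall>a. \<beta> a = jet_axis (\<sigma> a)" using \<sigma>(1) by blast
  ultimately show ?thesis using that[OF inj] by blast
qed

lemma linear_image_ker_eq_UNIV_iff:
  fixes L :: "'a::euclidean_space \<Rightarrow> real^'q::finite"
  assumes "linear L" "subspace K"
  shows "dim (L ` K) = CARD('q) \<longleftrightarrow> L ` K = UNIV"
proof -
  have "span (L ` K) = L ` K" using linear_subspace_image[OF assms] by (simp add: span_eq_iff)
  then show ?thesis using dim_eq_full[of "L ` K"] by (simp only: DIM_cart DIM_real mult_1_right)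
qed

lemma ker_truncate: "{w. truncate w = 0} = span top_axes"
  using truncate_eq_0_iff by blast

lemma subspace_ker_truncate: "subspace {w. truncate w = 0}"
  using linear_subspace_kernel[OF linear_truncate] .

context adapted_charts
begin

text \<open>The two spaces are \<open>ker L\<close> and \<open>ker truncate\<close>. A vector \<open>v\<close> is a sum of elements of
  these if and only if \<open>L v\<close> is attained on \<open>ker truncate\<close>; as \<open>L\<close> is onto, this holds for all \<open>v\<close> if
  and only if \<open>L\<close> maps \<open>ker truncate\<close> onto \<open>\<real>\<^sup>q\<close>.\<close>

lemma transversal_iff_symbol_onto:
  fixes J :: "(('b, 'e) jet, ('n, 'm, 'r::finite option) jet_space) chart set"
    and F :: "('b, 'e) jet \<Rightarrow> real^'q::finite"
  assumes J: "J = jet_atlas Q E pr" and F: "local_defining_map J \<E> W F" and \<theta>: "\<theta> \<in> \<E> \<inter> W"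
    and C: "C \<in> charts_at J \<theta>" and L: "linear L" "range L = UNIV"
    and dF: "\<And>v. v \<in> tangent_space J \<theta> \<Longrightarrow> differential J F \<theta> v = L (v C)"
  shows "tvec_sum (tangent_to J \<E> \<theta>) (vertical_space Q E pr \<theta>) = tangent_space J \<theta> \<longleftrightarrow>
      L ` {w. truncate w = 0} = UNIV"
    and "symbol_rank TYPE('r) Q E pr F \<theta> = CARD('q) \<longleftrightarrow> L ` {w. truncate w = 0} = UNIV"
proof -
  have A: "smooth_atlas J" unfolding J by (rule smooth_atlas_jet_atlas)
  let ?K = "{w. truncate w = 0} :: ('n, 'm, 'r option) jet_space set"
  have TE: "v \<in> tangent_to J \<E> \<theta> \<longleftrightarrow> v \<in> tangent_space J \<theta> \<and> L (v C) = 0" for v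
    using tangent_to_eq_ker_differential[OF A F \<theta> C] dF by auto
  note V = vertical_space_iff[OF J C]
  note lift = lift_tvec_in[OF A C] lift_tvec_apply[OF A C]
  show "tvec_sum (tangent_to J \<E> \<theta>) (vertical_space Q E pr \<theta>) = tangent_space J \<theta> \<longleftrightarrow> L ` ?K = UNIV"
  proof
    assume eq: "tvec_sum (tangent_to J \<E> \<theta>) (vertical_space Q E pr \<theta>) = tangent_space J \<theta>"
    have "y \<in> L ` ?K" for y
    proof -
      obtain w where w: "y = L w" using L(2) by (metis rangeE UNIV_I)
      have "lift_tvec J \<theta> C w \<in> tvec_sum (tangent_to J \<E> \<theta>) (vertical_space Q E pr \<theta>)"
        unfolding eq by (rule lift)
      then obtain u u' where u: "u \<in> tangent_to J \<E> \<theta>" "u' \<in> vertical_space Q E pr \<theta>"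
        "lift_tvec J \<theta> C w = (\<lambda>c. u c + u' c)" unfolding tvec_sum_def by blast
      have "w = u C + u' C" using lift(2)[of w] u(3) by metis
      then have "y = L (u' C)" using u(1) TE w by (simp add: linear_add[OF L(1)])
      then show ?thesis using u(2) V by blast
    qed
    then show "L ` ?K = UNIV" by blast
  next
    assume onto: "L ` ?K = UNIV"
    have "v \<in> tvec_sum (tangent_to J \<E> \<theta>) (vertical_space Q E pr \<theta>)" if v: "v \<in> tangent_space J \<theta>" for v
    proof -
      obtain w where w: "truncate w = 0" "L (v C) = L w" using onto by (metis (mono_tags) UNIV_I imageE mem_Collect_eq)
      let ?u = "lift_tvec J \<theta> C (v C - w)" and ?u' = "lift_tvec J \<theta> C w"
      have "?u \<in> tangent_to J \<E> \<theta>" using lift w(2) by (simp add: TE linear_diff[OF L(1)])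
      moreover have "?u' \<in> vertical_space Q E pr \<theta>" using lift w(1) by (simp add: V)
      moreover have "v = (\<lambda>c. ?u c + ?u' c)"
        by (rule tvec_eqI[OF v tangent_space_add[OF A lift(1) lift(1)] C]) (simp add: lift)
      ultimately show ?thesis unfolding tvec_sum_def by blast
    qed
    moreover have "tvec_sum (tangent_to J \<E> \<theta>) (vertical_space Q E pr \<theta>) \<subseteq> tangent_space J \<theta>"
      unfolding tvec_sum_def using TE V tangent_space_add[OF A] by blast
    ultimately show "tvec_sum (tangent_to J \<E> \<theta>) (vertical_space Q E pr \<theta>) = tangent_space J \<theta>" by blast
  qed
  have "differential J F \<theta> ` vertical_space Q E pr \<theta> = L ` ?K"
  proof (intro equalityI subsetI)
    fix y assume "y \<in> differential J F \<theta> ` vertical_space Q E pr \<theta>"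
    then show "y \<in> L ` ?K" using V dF by blast
  next
    fix y assume "y \<in> L ` ?K"
    then obtain w where w: "truncate w = 0" "y = L w" by blast
    then have "lift_tvec J \<theta> C w \<in> vertical_space Q E pr \<theta>" "y = differential J F \<theta> (lift_tvec J \<theta> C w)"
      using lift dF by (simp_all add: V)
    then show "y \<in> differential J F \<theta> ` vertical_space Q E pr \<theta>" by blast
  qed
  then show "symbol_rank TYPE('r) Q E pr F \<theta> = CARD('q) \<longleftrightarrow> L ` ?K = UNIV"
    unfolding symbol_rank_def J[symmetric] using linear_image_ker_eq_UNIV_iff[OF L(1) subspace_ker_truncate] by simp
qed

text \<open>A normal form lets one correct the straight line in a direction \<open>v\<close> to a curve in the equation by
  changing highest-order coordinates only; so \<open>v\<close> is tangent to the equation up to a vertical vector.\<close>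

lemma normal_form_imp_transversal:
  fixes J :: "(('b, 'e) jet, ('n, 'm, 'r::finite option) jet_space) chart set"
    and S :: "(('n, 'r option) mindex \<times> 'm) set" and bc C
  assumes J: "J = jet_atlas Q E pr" and CJ: "C \<in> J" and \<theta>: "\<theta> \<in> \<E>"
    and S: "\<forall>(I, \<alpha>)\<in>S. deg I = CARD('r)"
    and W: "atlas_open J W" "\<theta> \<in> W" "W \<subseteq> dom_ch C"
    and D: "open D" "drop_coords S ` coord C ` W \<subseteq> D"
    and h: "\<forall>(I, \<alpha>)\<in>S. smooth_on D (h I \<alpha> :: ('n, 'm, 'r option) jet_space \<Rightarrow> real)"
    and eq: "\<E> \<inter> W = {\<eta> \<in> W. \<forall>(I, \<alpha>)\<in>S. snd (coord C \<eta>) $ I $ \<alpha> = h I \<alpha> (drop_coords S (coord C \<eta>))}"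
  shows "tangent_space J \<theta> \<subseteq> tvec_sum (tangent_to J \<E> \<theta>) (vertical_space Q E pr \<theta>)"
proof
  fix v assume v: "v \<in> tangent_space J \<theta>"
  have A: "smooth_atlas J" unfolding J by (rule smooth_atlas_jet_atlas)
  have C: "C \<in> charts_at J \<theta>" using CJ W by (auto simp: charts_at_def)
  note Cc = smooth_atlas_chart[OF A CJ]
  let ?P = "drop_coords S" and ?z0 = "coord C \<theta>"
  have P: "linear ?P" by (rule linear_drop_coords)
  define line where "line t = ?P (?z0 + t *\<^sub>R v C)" for t
  have line_alt: "line t = ?P ?z0 + t *\<^sub>R ?P (v C)" for t
    unfolding line_def by (simp add: linear_add[OF P] linear_scale[OF P])
  have sm_line: "smooth_on UNIV line"
    unfolding line_alt[abs_def] by (intro smooth_on_add smooth_on_const smooth_on_scaleR smooth_on_id open_UNIV)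
  define M0 where "M0 = {t \<in> UNIV. line t \<in> D}"
  have M0: "open M0" unfolding M0_def by (rule open_preimage_smooth[OF sm_line open_UNIV D(1)])
  have 00: "0 \<in> M0" using D(2) W(2) by (auto simp: M0_def line_def)
  \<comment> \<open>The line, with the coordinates in \<open>S\<close> replaced by the values that the normal form prescribes.\<close>
  define \<delta> where "\<delta> t = line t + (\<Sum>p\<in>S. h (fst p) (snd p) (line t) *\<^sub>R jet_axis p)" for t
  have sm\<delta>: "smooth_on M0 \<delta>"
  proof -
    have sl: "smooth_on M0 line" by (rule smooth_on_subset[OF sm_line]) simp
    have "smooth_on M0 (\<lambda>t. h (fst p) (snd p) (line t))" if "p \<in> S" for p
      by (rule smooth_on_compose[OF M0 sl, of D]) (use h that in \<open>auto simp: M0_def split: prod.splits\<close>)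
    then show ?thesis unfolding \<delta>_def
      by (intro smooth_on_add smooth_on_sum smooth_on_scaleR smooth_on_const M0 sl)
  qed
  have P\<delta>: "?P (\<delta> t) = line t" for t
    unfolding \<delta>_def line_def by (rule drop_coords_add_axes)
  have \<delta>S: "snd (\<delta> t) $ I $ \<alpha> = h I \<alpha> (line t)" if "(I, \<alpha>) \<in> S" for I \<alpha> t
    using that unfolding \<delta>_def line_def by (simp add: sum_jet_axis_component) (simp add: drop_coords_def)
  have \<delta>0: "\<delta> 0 = ?z0"
  proof -
    have "snd ?z0 $ I $ \<alpha> = h I \<alpha> (?P ?z0)" if "(I, \<alpha>) \<in> S" for I \<alpha> using eq \<theta> W(2) that by blast
    then have "\<delta> 0 = ?P ?z0 + (\<Sum>p\<in>S. (?z0 \<bullet> jet_axis p) *\<^sub>R jet_axis p)"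
      unfolding \<delta>_def by (simp add: line_def inner_jet_axis)
    then show ?thesis by (simp add: drop_coords_eq)
  qed
  have oW: "open (coord C ` W)" using atlas_open_chart[OF W(1) CJ] W(3) by (simp add: Int_absorb2)
  define M where "M = {t \<in> M0. \<delta> t \<in> coord C ` W}"
  have M: "open M" unfolding M_def by (rule open_preimage_smooth[OF sm\<delta> M0 oW])
  have 0: "0 \<in> M" using 00 \<delta>0 W(2) by (simp add: M_def)
  have inE: "\<delta> t \<in> coord C ` dom_ch C \<and> param C (\<delta> t) \<in> \<E>" if t: "t \<in> M" for t
  proof -
    obtain \<eta> where \<eta>: "\<eta> \<in> W" "\<delta> t = coord C \<eta>" using t by (auto simp: M_def)
    have "snd (coord C \<eta>) $ I $ \<alpha> = h I \<alpha> (?P (coord C \<eta>))" if "(I, \<alpha>) \<in> S" for I \<alpha>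
      using \<delta>S[OF that, of t] P\<delta>[of t] \<eta>(2) by simp
    then have "\<eta> \<in> \<E>" using eq \<eta>(1) by blast
    moreover have "\<eta> \<in> dom_ch C" using \<eta>(1) W(3) by blast
    ultimately show ?thesis unfolding \<eta>(2) using param_coord[OF Cc] by simp
  qed
  define w where "w = vector_derivative \<delta> (at 0)"
  have w: "(\<delta> has_vector_derivative w) (at 0)"
    unfolding w_def using smooth_on_imp_differentiable[OF sm\<delta> 00] by (simp add: vector_derivative_works)
  have "((\<lambda>t. ?P (\<delta> t)) has_vector_derivative ?P w) (at 0)"
    using w P by (simp add: bounded_linear.has_vector_derivative linear_conv_bounded_linear)
  then have "(line has_vector_derivative ?P w) (at 0)" by (simp add: P\<delta>)
  moreover have "(line has_vector_derivative ?P (v C)) (at 0)"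
    unfolding line_alt[abs_def] by (auto intro!: derivative_eq_intros)
  ultimately have Pw: "?P w = ?P (v C)" using vector_derivative_unique_at by blast
  have "truncate (v C - w) = 0"
    using truncate_drop_coords[OF S, of "v C"] truncate_drop_coords[OF S, of w] Pw
    by (simp add: linear_diff[OF linear_truncate])
  then have "lift_tvec J \<theta> C (v C - w) \<in> vertical_space Q E pr \<theta>"
    unfolding vertical_space_iff[OF J C] by (simp add: lift_tvec_in[OF A C] lift_tvec_apply[OF A C])
  moreover have "lift_tvec J \<theta> C w \<in> tangent_to J \<E> \<theta>"
    unfolding tangent_to_iff_curve[OF A C] lift_tvec_apply[OF A C]
    using lift_tvec_in[OF A C] M 0 smooth_on_subset[OF sm\<delta>, of M] inE \<delta>0 w
    by (intro conjI exI[of _ M] exI[of _ \<delta>]) (auto simp: M_def)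
  moreover have "v = (\<lambda>c. lift_tvec J \<theta> C w c + lift_tvec J \<theta> C (v C - w) c)"
    by (rule tvec_eqI[OF v tangent_space_add[OF A lift_tvec_in[OF A C] lift_tvec_in[OF A C]] C])
      (simp add: lift_tvec_apply[OF A C])
  ultimately show "v \<in> tvec_sum (tangent_to J \<E> \<theta>) (vertical_space Q E pr \<theta>)"
    unfolding tvec_sum_def by blast
qed

text \<open>Conversely, if the symbol has rank \<open>q\<close>, some \<open>q\<close> highest-order axes already span the target,
  and the implicit function theorem solves the equation for the corresponding coordinates.\<close>

lemma symbol_onto_imp_normal_form:
  fixes J :: "(('b, 'e) jet, ('n, 'm, 'r::finite option) jet_space) chart set"
    and F :: "('b, 'e) jet \<Rightarrow> real^'q::finite"
  assumes J: "J = jet_atlas Q E pr" and F: "local_defining_map J \<E> W F" and \<theta>: "\<theta> \<in> \<E> \<inter> W"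
    and C: "C \<in> charts_at J \<theta>"
    and onto: "frechet_derivative (\<lambda>z. F (param C z)) (at (coord C \<theta>)) ` {w. truncate w = 0} = UNIV"
  shows "\<exists>(S :: (('n, 'r option) mindex \<times> 'm) set) W D h.
      card S = CARD('q) \<and> (\<forall>(I, \<alpha>)\<in>S. deg I = CARD('r)) \<and>
      atlas_open J W \<and> \<theta> \<in> W \<and> W \<subseteq> dom_ch C \<and> open D \<and> drop_coords S ` coord C ` W \<subseteq> D \<and>
      (\<forall>(I, \<alpha>)\<in>S. smooth_on D (h I \<alpha> :: ('n, 'm, 'r option) jet_space \<Rightarrow> real)) \<and>
      \<E> \<inter> W = {\<eta> \<in> W. \<forall>(I, \<alpha>)\<in>S. snd (coord C \<eta>) $ I $ \<alpha> = h I \<alpha> (drop_coords S (coord C \<eta>))}"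
proof -
  have A: "smooth_atlas J" unfolding J by (rule smooth_atlas_jet_atlas)
  note CJ = charts_at_in[OF C]
  note Cc = smooth_atlas_chart[OF A CJ(1)]
  let ?f = "\<lambda>z. F (param C z)"
  obtain N L where N: "open N" "coord C \<theta> \<in> N" "N \<subseteq> coord C ` dom_ch C" "smooth_on N ?f"
    "F (param C (coord C \<theta>)) = 0" "\<And>z. z \<in> N \<Longrightarrow> param C z \<in> \<E> \<longleftrightarrow> ?f z = 0"
    and L: "L = frechet_derivative ?f (at (coord C \<theta>))" "linear L"
    using local_defining_map_in_chart[OF A F \<theta> C] by metis
  have "L ` span top_axes = UNIV" using onto unfolding L(1) ker_truncate .
  then obtain \<beta> :: "'q \<Rightarrow> ('n, 'm, 'r option) jet_space" where \<beta>: "inj \<beta>" "range \<beta> \<subseteq> top_axes"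
    "\<And>w. w \<in> span (range \<beta>) \<Longrightarrow> L w = 0 \<Longrightarrow> w = 0"
    using select_independent_axes[OF L(2) top_axes_subset_Basis] by metis
  have \<beta>B: "range \<beta> \<subseteq> Basis" using \<beta>(2) top_axes_subset_Basis by blast
  obtain \<sigma> where \<sigma>: "inj \<sigma>" "\<forall>a. \<beta> a = jet_axis (\<sigma> a)" "\<forall>(I, \<alpha>)\<in>range \<sigma>. deg I = CARD('r)"
    "\<forall>z. kill_axes \<beta> z = drop_coords (range \<sigma>) z"
    by (rule range_top_axes[OF \<beta>(1,2)]) blast
  obtain N' D H where H: "open N'" "coord C \<theta> \<in> N'" "N' \<subseteq> N" "open D" "smooth_on D H"
    "\<forall>z\<in>N'. kill_axes \<beta> z \<in> D"
    "\<forall>z\<in>N'. ?f z = 0 \<longleftrightarrow> z = H (kill_axes \<beta> z)"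
    "\<forall>z\<in>N'. ?f z = 0 \<longleftrightarrow> (\<forall>a. z \<bullet> \<beta> a = H (kill_axes \<beta> z) \<bullet> \<beta> a)"
    "\<forall>y\<in>D. kill_axes \<beta> y = y \<longrightarrow> H y \<in> N \<and> ?f (H y) = 0 \<and> kill_axes \<beta> (H y) = y"
    by (rule implicit_graph[OF N(1,4,2,5) \<beta>(1) \<beta>B \<beta>(3)[unfolded L(1)]]) blast
  have N'C: "z \<in> coord C ` dom_ch C" if "z \<in> N'" for z using that H(3) N(3) by blast
  note cp = coord_param[OF N'C] and pd = param_in_dom[OF N'C]
  define h where "h I \<alpha> y = snd (H y) $ I $ \<alpha>" for I \<alpha> y
  have graph: "param C z \<in> \<E> \<longleftrightarrow> (\<forall>(I, \<alpha>)\<in>range \<sigma>. snd z $ I $ \<alpha> = h I \<alpha> (drop_coords (range \<sigma>) z))"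
    if z: "z \<in> N'" for z
  proof -
    have "param C z \<in> \<E> \<longleftrightarrow> (\<forall>a. z \<bullet> \<beta> a = H (kill_axes \<beta> z) \<bullet> \<beta> a)"
      using N(6) H(3,8) z by blast
    also have "\<dots> \<longleftrightarrow> (\<forall>p\<in>range \<sigma>. snd z $ fst p $ snd p = h (fst p) (snd p) (drop_coords (range \<sigma>) z))"
      unfolding \<sigma>(4)[rule_format] by (simp add: \<sigma>(2) inner_jet_axis h_def)
    finally show ?thesis by (simp add: case_prod_beta)
  qed
  show ?thesis
  proof (intro exI[of _ "range \<sigma>"] exI[of _ "param C ` N'"] exI[of _ D] exI[of _ h] conjI)
    show "card (range \<sigma>) = CARD('q)" using \<sigma>(1) by (rule card_image)
    show "\<forall>(I, \<alpha>)\<in>range \<sigma>. deg I = CARD('r)" by (rule \<sigma>(3))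
    show "atlas_open J (param C ` N')"
      by (rule atlas_open_param_image[OF A CJ(1) H(1)]) (use N'C in blast)
    show "\<theta> \<in> param C ` N'" using H(2) param_coord[OF Cc CJ(2)] by (metis imageI)
    show "param C ` N' \<subseteq> dom_ch C" using pd by blast
    show "open D" by (rule H(4))
    show "drop_coords (range \<sigma>) ` coord C ` param C ` N' \<subseteq> D"
      using H(6) cp unfolding \<sigma>(4)[rule_format] by auto
    show "\<forall>(I, \<alpha>)\<in>range \<sigma>. smooth_on D (h I \<alpha>)"
      unfolding h_def by (intro ballI) (simp add: case_prod_beta smooth_on_vec_nth smooth_on_snd H(4,5))
    show "\<E> \<inter> param C ` N' = {\<eta> \<in> param C ` N'. \<forall>(I, \<alpha>)\<in>range \<sigma>.
        snd (coord C \<eta>) $ I $ \<alpha> = h I \<alpha> (drop_coords (range \<sigma>) (coord C \<eta>))}"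
    proof (rule set_eqI)
      fix \<eta>
      show "\<eta> \<in> \<E> \<inter> param C ` N' \<longleftrightarrow> \<eta> \<in> {\<eta> \<in> param C ` N'. \<forall>(I, \<alpha>)\<in>range \<sigma>.
        snd (coord C \<eta>) $ I $ \<alpha> = h I \<alpha> (drop_coords (range \<sigma>) (coord C \<eta>))}"
      proof (cases "\<eta> \<in> param C ` N'")
        case True
        then obtain z where "z \<in> N'" "\<eta> = param C z" by blast
        then show ?thesis using graph[of z] cp[of z] True by simp
      qed simp
    qed
  qed
qed

text \<open>The fibre dimension of the vertical bundle is the same at all points, as it can be read off from
  the coordinate space.\<close>

lemma tdim_vertical_space:
  fixes J :: "(('b, 'e) jet, ('n, 'm, 'r::finite option) jet_space) chart set"
  assumes J: "J = jet_atlas Q E pr" and \<theta>: "\<theta> \<in> carrier_of J"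
  shows "tdim J \<theta> (vertical_space Q E pr \<theta>) = dim {w :: ('n, 'm, 'r option) jet_space. truncate w = 0}"
proof -
  have A: "smooth_atlas J" unfolding J by (rule smooth_atlas_jet_atlas)
  define C where "C = (SOME c. c \<in> charts_at J \<theta>)"
  have "\<exists>c. c \<in> charts_at J \<theta>" using \<theta> by (auto simp: carrier_of_def charts_at_def)
  then have C: "C \<in> charts_at J \<theta>" unfolding C_def by (rule someI_ex)
  have "(\<lambda>v. v C) ` vertical_space Q E pr \<theta> = {w. truncate w = 0}"
  proof (intro equalityI subsetI)
    fix w assume "w \<in> {w. truncate w = (0 :: ('n, 'm, 'r) jet_space)}"
    then have "lift_tvec J \<theta> C w \<in> vertical_space Q E pr \<theta>"
      unfolding vertical_space_iff[OF J C] by (simp add: lift_tvec_in[OF A C] lift_tvec_apply[OF A C])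
    then show "w \<in> (\<lambda>v. v C) ` vertical_space Q E pr \<theta>"
      by (metis (no_types, lifting) image_eqI lift_tvec_apply[OF A C])
  qed (use vertical_space_iff[OF J C] in blast)
  then show ?thesis unfolding tdim_def C_def by simp
qed

text \<open>Over a point of a section of the projection, curves in its image are determined by their
  projections, so the image has no vertical tangent vectors.\<close>

lemma section_graph_imp_no_vertical:
  fixes J :: "(('b, 'e) jet, ('n, 'm, 'r::finite option) jet_space) chart set"
    and J' :: "(('b, 'e) jet, ('n, 'm, 'r) jet_space) chart set"
  assumes J: "J = jet_atlas Q E pr" and J': "J' = jet_atlas Q E pr"
    and graph: "locally_section_graph J J' (jet_proj Q E pr (CARD('r) - 1)) \<E>" and \<theta>: "\<theta> \<in> \<E>"
    and v: "v \<in> tangent_to J \<E> \<theta>" "v \<in> vertical_space Q E pr \<theta>"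
  shows "v = zero_tvec"
proof -
  let ?p = "jet_proj Q E pr (CARD('r) - 1)"
  have A: "smooth_atlas J" "smooth_atlas J'" unfolding J J' by (rule smooth_atlas_jet_atlas)+
  obtain W V s where W: "atlas_open J W" "\<theta> \<in> W" and V: "atlas_open J' V" "smooth_map J' J V s"
    "\<forall>y\<in>V. ?p (s y) = y" and eq: "\<E> \<inter> W = s ` V"
    using graph[unfolded locally_section_graph_def, THEN bspec, OF \<theta>] by (elim exE conjE)
  have "\<theta> \<in> carrier_of J" using W by (auto simp: atlas_open_def)
  then obtain C where C: "C \<in> charts_at J \<theta>" by (auto simp: carrier_of_def charts_at_def)
  note CJ = charts_at_in[OF C]
  note Cc = smooth_atlas_chart[OF A(1) CJ(1)]
  obtain b c where bc: "(b, c) \<in> adapted Q E pr" "C = jet_chart Q E pr (b, c)"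
    using CJ(1) unfolding J by (elim jet_atlas_cases)
  define C' where "C' = (jet_chart Q E pr (b, c) :: (('b, 'e) jet, ('n, 'm, 'r) jet_space) chart)"
  note proj = jet_proj_in_chart[OF bc C'_def]
  have p\<theta>: "?p \<theta> \<in> V" "s (?p \<theta>) = \<theta>" using V(3) eq \<theta> W(2) by force+
  have C'J: "C' \<in> J'" unfolding C'_def J' jet_atlas_def using bc(1) by (rule imageI)
  then have C': "C' \<in> charts_at J' (?p \<theta>)" using proj(1)[OF CJ(2)] by (simp add: charts_at_def)
  note C'c = smooth_atlas_chart[OF A(2) C'J]
  have Cs: "C \<in> charts_at J (s (?p \<theta>))" using C p\<theta>(2) by simp
  define g where "g y = coord C (s (param C' y))" for y
  obtain N where N: "open N" "coord C' (?p \<theta>) \<in> N" "smooth_on N g"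
    unfolding g_def by (rule smooth_map_in_charts[OF A(2,1) V(2) p\<theta>(1) C' Cs])
  obtain M \<delta> where M: "open M" "(0::real) \<in> M" "smooth_on M \<delta>"
    "\<And>t. t \<in> M \<Longrightarrow> \<delta> t \<in> coord C ` dom_ch C \<and> param C (\<delta> t) \<in> \<E>" "\<delta> 0 = coord C \<theta>"
    and \<delta>: "(\<delta> has_vector_derivative v C) (at 0)"
    using v(1) unfolding tangent_to_iff_curve[OF A(1) C] by blast
  define M' where "M' = {t \<in> M. \<delta> t \<in> coord C ` (W \<inter> dom_ch C)}"
  have M': "open M'" unfolding M'_def
    by (rule open_preimage_smooth[OF M(3,1) atlas_open_chart[OF W(1) CJ(1)]])
  have 0: "0 \<in> M'" using M(2,5) W(2) CJ(2) by (simp add: M'_def)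
  \<comment> \<open>Points of the equation near \<open>\<theta>\<close> are recovered from their projections through the section.\<close>
  have retract: "g (truncate (\<delta> t)) = \<delta> t" if t: "t \<in> M'" for t
  proof -
    obtain \<eta> where \<eta>: "\<eta> \<in> W" "\<eta> \<in> dom_ch C" "\<delta> t = coord C \<eta>" using t by (auto simp: M'_def)
    have "\<eta> \<in> \<E>" using M(4)[of t] t \<eta> param_coord[OF Cc \<eta>(2)] by (simp add: M'_def)
    then have "s (?p \<eta>) = \<eta>" using V(3) eq \<eta>(1) by force
    moreover have "param C' (truncate (\<delta> t)) = ?p \<eta>"
      using proj[OF \<eta>(2)] \<eta>(3) param_coord[OF C'c] by metis
    ultimately show ?thesis using \<eta>(3) by (simp add: g_def)
  qed
  have T0: "truncate (v C) = 0" using v(2) vertical_space_iff[OF J C] by blast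
  have trunc0: "truncate (\<delta> 0) = coord C' (?p \<theta>)" using proj(2)[OF CJ(2)] M(5) by simp
  have "((\<lambda>t. truncate (\<delta> t)) has_vector_derivative truncate (v C)) (at 0)"
    by (rule bounded_linear.has_vector_derivative[OF _ \<delta>])
      (simp add: linear_conv_bounded_linear[symmetric] linear_truncate)
  moreover have gd: "g differentiable (at (truncate (\<delta> 0)))"
    unfolding trunc0 by (rule smooth_on_imp_differentiable[OF N(3,2)])
  ultimately have "((\<lambda>t. g (truncate (\<delta> t))) has_vector_derivative frechet_derivative g (at (truncate (\<delta> 0))) (truncate (v C))) (at 0)"
    by (rule frechet_vector_derivative_compose)
  then have "((\<lambda>t. g (truncate (\<delta> t))) has_vector_derivative 0) (at 0)"
    by (simp add: T0 linear_0[OF linear_frechet_derivative[OF gd]])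
  then have "(\<delta> has_vector_derivative 0) (at 0)"
    by (rule has_vector_derivative_transform_within_open[OF _ M' 0 retract])
  then have "v C = zero_tvec C" using \<delta> vector_derivative_unique_at by (auto simp: zero_tvec_def)
  moreover have "v \<in> tangent_space J \<theta>" using v(2) vertical_space_iff[OF J C] by blast
  ultimately show ?thesis using tvec_eqI[OF _ zero_tvec_in[OF A(1)] C] by blast
qed

text \<open>If the fibres of the projection have dimension \<open>q\<close> and the equation has no vertical tangent
  vectors, the equation can be solved for all highest-order coordinates; the remaining coordinates
  are those of the projected jet, so that the solution is a section.\<close>

lemma no_vertical_imp_section_graph:
  fixes J :: "(('b, 'e) jet, ('n, 'm, 'r::finite option) jet_space) chart set"
    and J' :: "(('b, 'e) jet, ('n, 'm, 'r) jet_space) chart set"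
    and F :: "('b, 'e) jet \<Rightarrow> real^'q::finite"
  assumes J: "J = jet_atlas Q E pr" and J': "J' = jet_atlas Q E pr"
    and F: "local_defining_map J \<E> W0 F" and \<theta>: "\<theta> \<in> \<E> \<inter> W0"
    and dimV: "dim {w :: ('n, 'm, 'r option) jet_space. truncate w = 0} = CARD('q)"
    and triv: "tangent_to J \<E> \<theta> \<inter> vertical_space Q E pr \<theta> = {zero_tvec}"
  shows "\<exists>W V s. atlas_open J W \<and> \<theta> \<in> W \<and> atlas_open J' V \<and> smooth_map J' J V s \<and>
    (\<forall>y\<in>V. jet_proj Q E pr (CARD('r) - 1) (s y) = y) \<and> \<E> \<inter> W = s ` V"
proof -
  let ?p = "jet_proj Q E pr (CARD('r) - 1)"
  let ?K = "{w :: ('n, 'm, 'r option) jet_space. truncate w = 0}"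
  have A: "smooth_atlas J" "smooth_atlas J'" unfolding J J' by (rule smooth_atlas_jet_atlas)+
  have "\<theta> \<in> carrier_of J" using F \<theta> unfolding local_defining_map_def atlas_open_def by blast
  then obtain C where C: "C \<in> charts_at J \<theta>" by (auto simp: carrier_of_def charts_at_def)
  note CJ = charts_at_in[OF C]
  note Cc = smooth_atlas_chart[OF A(1) CJ(1)]
  obtain b c where bc: "(b, c) \<in> adapted Q E pr" "C = jet_chart Q E pr (b, c)"
    using CJ(1) unfolding J by (elim jet_atlas_cases)
  define C' where "C' = (jet_chart Q E pr (b, c) :: (('b, 'e) jet, ('n, 'm, 'r) jet_space) chart)"
  have C'J: "C' \<in> J'" unfolding C'_def J' jet_atlas_def using bc(1) by (rule imageI)
  note C'c = smooth_atlas_chart[OF A(2) C'J]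
  let ?f = "\<lambda>z. F (param C z)"
  obtain N L where N: "open N" "coord C \<theta> \<in> N" "N \<subseteq> coord C ` dom_ch C" "smooth_on N ?f"
    "F (param C (coord C \<theta>)) = 0" "\<And>z. z \<in> N \<Longrightarrow> param C z \<in> \<E> \<longleftrightarrow> ?f z = 0"
    and L: "L = frechet_derivative ?f (at (coord C \<theta>))" "linear L"
    and dF: "\<And>v. v \<in> tangent_space J \<theta> \<Longrightarrow> differential J F \<theta> v = L (v C)"
    using local_defining_map_in_chart[OF A(1) F \<theta> C] by metis
  \<comment> \<open>A common zero of \<open>L\<close> and \<open>truncate\<close> is the component of a vertical vector tangent to the equation.\<close>
  have inj0: "w = 0" if "truncate w = 0" "L w = 0" for w
  proof -
    let ?v = "lift_tvec J \<theta> C w"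
    have v: "?v \<in> tangent_space J \<theta>" "?v C = w" by (rule lift_tvec_in[OF A(1) C], rule lift_tvec_apply[OF A(1) C])
    have "?v \<in> tangent_to J \<E> \<theta> \<inter> vertical_space Q E pr \<theta>"
      using v that dF[OF v(1)] tangent_to_eq_ker_differential[OF A(1) F \<theta> C] vertical_space_iff[OF J C] by auto
    then have "?v = zero_tvec" using triv by blast
    then show "w = 0" using v(2) by (metis zero_tvec_def)
  qed
  have "inj_on L ?K"
  proof (rule inj_onI)
    fix x y assume "x \<in> ?K" "y \<in> ?K" "L x = L y"
    then have "x - y = 0" by (intro inj0) (simp_all add: linear_diff[OF linear_truncate] linear_diff[OF L(2)])
    then show "x = y" by simp
  qed
  then have "dim (L ` ?K) = CARD('q)"
    using dim_image_eq[OF L(2), of ?K] dimV unfolding span_eq_iff[THEN iffD2, OF subspace_ker_truncate] by simp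
  then have "L ` ?K = UNIV" using linear_image_ker_eq_UNIV_iff[OF L(2) subspace_ker_truncate] by blast
  then have "L ` span top_axes = UNIV" unfolding ker_truncate .
  then obtain \<beta> :: "'q \<Rightarrow> ('n, 'm, 'r option) jet_space" where \<beta>: "inj \<beta>" "range \<beta> \<subseteq> top_axes"
    "\<And>w. w \<in> span (range \<beta>) \<Longrightarrow> L w = 0 \<Longrightarrow> w = 0"
    using select_independent_axes[OF L(2) top_axes_subset_Basis] by metis
  have \<beta>B: "range \<beta> \<subseteq> Basis" using \<beta>(2) top_axes_subset_Basis by blast
  \<comment> \<open>Both spans have dimension \<open>q\<close>, so the selected axes are all the highest-order ones.\<close>
  have spanK: "w \<in> span (range \<beta>)" if "truncate w = 0" for w
  proof -
    have "range \<beta> \<subseteq> ?K" using \<beta>(2) truncate_eq_0_iff span_base by blast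
    moreover have "dim (range \<beta>) = CARD('q)"
      using dim_eq_card_independent[OF independent_mono[OF independent_Basis \<beta>B]] card_image[OF \<beta>(1)] by simp
    ultimately have "span (range \<beta>) = span ?K" using dim_eq_span[of "range \<beta>" ?K] dimV by simp
    then show ?thesis using that span_base[of w ?K] by simp
  qed
  \<comment> \<open>Hence the coordinates that remain free are those of the projected jet.\<close>
  have kill_ext: "kill_axes \<beta> z = extend (truncate z)" for z
  proof -
    let ?z = "extend (truncate z)"
    have "truncate (z - ?z) = 0" by (simp add: linear_diff[OF linear_truncate] truncate_extend)
    then have "z - ?z \<in> span (range \<beta>)" by (rule spanK)
    moreover have "kill_axes \<beta> (\<beta> a) = 0" for a
    proof -
      have "kill_axes \<beta> (kill_axes \<beta> 0 + (\<Sum>a'\<in>UNIV. (if a' = a then 1 else 0) *\<^sub>R \<beta> a')) = kill_axes \<beta> 0"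
        by (rule kill_axes_add[OF \<beta>(1) \<beta>B])
      then show ?thesis by (simp add: linear_0[OF linear_kill_axes] if_distrib[of "\<lambda>c. c *\<^sub>R _"] cong: if_cong)
    qed
    ultimately have "kill_axes \<beta> (z - ?z) = 0" using linear_eq_0_on_span[OF linear_kill_axes, of "range \<beta>"] by blast
    then have "kill_axes \<beta> z = kill_axes \<beta> ?z" by (simp add: linear_diff[OF linear_kill_axes])
    moreover have "?z \<bullet> \<beta> a = 0" for a
    proof -
      obtain I \<alpha> where I: "\<beta> a = jet_axis (I, \<alpha>)" "deg I = CARD('r)"
        using subsetD[OF \<beta>(2) rangeI[of \<beta> a]] by (auto simp: top_axes_def)
      then show ?thesis by (simp add: inner_jet_axis extend_def)
    qed
    then have "kill_axes \<beta> ?z = ?z" by (simp add: kill_axes_def)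
    ultimately show ?thesis by simp
  qed
  obtain N' D H where H: "open N'" "coord C \<theta> \<in> N'" "N' \<subseteq> N" "open D" "smooth_on D H"
    "\<forall>z\<in>N'. kill_axes \<beta> z \<in> D"
    "\<forall>z\<in>N'. ?f z = 0 \<longleftrightarrow> z = H (kill_axes \<beta> z)"
    "\<forall>z\<in>N'. ?f z = 0 \<longleftrightarrow> (\<forall>a. z \<bullet> \<beta> a = H (kill_axes \<beta> z) \<bullet> \<beta> a)"
    "\<forall>y\<in>D. kill_axes \<beta> y = y \<longrightarrow> H y \<in> N \<and> ?f (H y) = 0 \<and> kill_axes \<beta> (H y) = y"
    by (rule implicit_graph[OF N(1,4,2,5) \<beta>(1) \<beta>B \<beta>(3)[unfolded L(1)]]) blast
  have N'C: "z \<in> coord C ` dom_ch C" if "z \<in> N'" for z using that H(3) N(3) by blast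
  define D' where "D' = {y :: ('n, 'm, 'r) jet_space. extend y \<in> D}"
  have D': "open D'"
  proof -
    have "open {y \<in> UNIV. extend (y :: ('n, 'm, 'r) jet_space) \<in> D}"
      by (rule open_preimage_smooth[OF smooth_on_linear[OF linear_extend open_UNIV] open_UNIV H(4)])
    then show ?thesis by (simp add: D'_def)
  qed
  have smH: "smooth_on D' (\<lambda>y. H (extend y))"
    by (rule smooth_on_compose[OF D' smooth_on_linear[OF linear_extend D'] H(5)]) (auto simp: D'_def)
  define V0 where "V0 = {y \<in> D'. H (extend y) \<in> N'}"
  have V0: "open V0" unfolding V0_def by (rule open_preimage_smooth[OF smH D' H(1)])
  have sol: "?f (H (extend y)) = 0" "truncate (H (extend y)) = y" if "y \<in> V0" for y
  proof -
    have "kill_axes \<beta> (extend y) = extend y" by (simp add: kill_ext truncate_extend)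
    then have *: "?f (H (extend y)) = 0 \<and> kill_axes \<beta> (H (extend y)) = extend y"
      using H(9) that by (simp add: V0_def D'_def)
    then show "?f (H (extend y)) = 0" by blast
    have "extend (truncate (H (extend y))) = extend y" using * by (simp add: kill_ext)
    then show "truncate (H (extend y)) = y" by (metis truncate_extend)
  qed
  have V0C': "y \<in> coord C' ` dom_ch C'" if "y \<in> V0" for y
    using truncate_in_image(1)[OF bc C'_def N'C[of "H (extend y)"]] sol(2)[OF that] that by (simp add: V0_def)
  have V0img: "V0 \<subseteq> coord C' ` dom_ch C'" using V0C' by blast
  define s where "s \<eta> = param C (H (extend (coord C' \<eta>)))" for \<eta>
  have sp: "s (param C' y) = param C (H (extend y))" if "y \<in> V0" for y
    using coord_param[OF V0C'[OF that]] by (simp add: s_def)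
  let ?W = "param C ` N'" and ?V = "param C' ` V0"
  have opV: "atlas_open J' ?V" by (rule atlas_open_param_image[OF A(2) C'J V0 V0img])
  show ?thesis
  proof (rule exI[of _ ?W], rule exI[of _ ?V], rule exI[of _ s], intro conjI)
    show "atlas_open J ?W" by (rule atlas_open_param_image[OF A(1) CJ(1) H(1)]) (use N'C in blast)
    show "\<theta> \<in> ?W" using H(2) param_coord[OF Cc CJ(2)] by (metis imageI)
    show "atlas_open J' ?V" by (rule opV)
    show "smooth_map J' J ?V s"
      unfolding smooth_map_def
    proof (intro ballI bexI exI conjI)
      show "atlas_open J' ?V" by (rule opV)
      show "?V \<subseteq> ?V \<inter> dom_ch C'" using param_in_dom[OF V0C'] by blast
      have "s (param C' y) \<in> dom_ch C" if "y \<in> V0" for y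
        using sp[OF that] param_in_dom[OF N'C[of "H (extend y)"]] that by (simp add: V0_def)
      then show "s ` ?V \<subseteq> dom_ch C" by blast
      have img: "coord C' ` ?V = V0" using coord_param[OF V0C'] by (force simp: image_image)
      have "smooth_on V0 (\<lambda>y. H (extend y))" by (rule smooth_on_subset[OF smH]) (auto simp: V0_def)
      then show "smooth_on (coord C' ` ?V) (coord C \<circ> s \<circ> param C')"
        unfolding img
      proof (rule smooth_on_transform[OF _ V0])
        fix y assume y: "y \<in> V0"
        then have "H (extend y) \<in> N'" by (simp add: V0_def)
        then show "H (extend y) = (coord C \<circ> s \<circ> param C') y" using coord_param[OF N'C] sp[OF y] by simp
      qed
    qed (use CJ C'J in auto)
    show "\<forall>\<eta>\<in>?V. ?p (s \<eta>) = \<eta>"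
    proof
      fix \<eta> assume "\<eta> \<in> ?V"
      then obtain y where y: "y \<in> V0" "\<eta> = param C' y" by blast
      have z: "H (extend y) \<in> coord C ` dom_ch C" using y(1) N'C by (simp add: V0_def)
      have "coord C' (?p (s \<eta>)) = y"
        using truncate_in_image(2)[OF bc C'_def z] sp[OF y(1)] sol(2)[OF y(1)] y(2) by simp
      moreover have "?p (s \<eta>) \<in> dom_ch C'"
        using jet_proj_in_chart(1)[OF bc C'_def param_in_dom[OF z]] sp[OF y(1)] y(2) by simp
      ultimately show "?p (s \<eta>) = \<eta>" using param_coord[OF C'c] y(2) by metis
    qed
    show "\<E> \<inter> ?W = s ` ?V"
    proof (intro equalityI subsetI)
      fix \<eta> assume "\<eta> \<in> \<E> \<inter> ?W"
      then obtain z where z: "z \<in> N'" "\<eta> = param C z" "\<eta> \<in> \<E>" by blast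
      then have "?f z = 0" using N(6) H(3) by blast
      then have fixz: "H (extend (truncate z)) = z" using H(7) z(1) kill_ext by metis
      have "truncate z \<in> V0" using H(6) z(1) fixz by (simp add: V0_def D'_def kill_ext)
      then show "\<eta> \<in> s ` ?V" using sp[of "truncate z"] fixz z(2) by (metis imageI)
    next
      fix \<eta> assume "\<eta> \<in> s ` ?V"
      then obtain y where y: "y \<in> V0" "\<eta> = param C (H (extend y))" using sp by auto
      have "H (extend y) \<in> N'" using y(1) by (simp add: V0_def)
      then show "\<eta> \<in> \<E> \<inter> ?W" using sol(1)[OF y(1)] N(6) H(3) y(2) by blast
    qed
  qed
qed

end

theorem proposition10p15:
  fixes Q :: "('b, real^'n::finite) chart set"
    and E :: "('e, (real^'n) \<times> (real^'m::finite)) chart set"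
    and pr :: "'e \<Rightarrow> 'b"
    and J :: "(('b, 'e) jet, ('n, 'm, 'r::finite option) jet_space) chart set"
    and J' :: "(('b, 'e) jet, ('n, 'm, 'r) jet_space) chart set"
    and \<E> :: "('b, 'e) jet set"
    and r q :: nat
  assumes "r = CARD('r)" and "q = CARD('q::finite)"
    and "fibred_manifold Q E pr"
    and "J = jet_atlas Q E pr" and "J' = jet_atlas Q E pr"
    and "regular_pde TYPE('r option) TYPE('q) Q E pr \<E>"
  shows "(locally_normal_form TYPE('r option) q Q E pr \<E> \<longleftrightarrow>
            (\<forall>\<theta>\<in>\<E>. tvec_sum (tangent_to J \<E> \<theta>) (vertical_space Q E pr \<theta>) = tangent_space J \<theta>))
       \<and> ((\<forall>\<theta>\<in>\<E>. tvec_sum (tangent_to J \<E> \<theta>) (vertical_space Q E pr \<theta>) = tangent_space J \<theta>) \<longleftrightarrow>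
            (\<forall>W (F :: ('b, 'e) jet \<Rightarrow> real^'q). local_defining_map J \<E> W F \<longrightarrow>
               (\<forall>\<theta>\<in>\<E> \<inter> W. symbol_rank TYPE('r) Q E pr F \<theta> = q)))
       \<and> (locally_normal_form TYPE('r option) q Q E pr \<E> \<longrightarrow>
            (\<forall>W (F :: ('b, 'e) jet \<Rightarrow> real^'q). local_defining_map J \<E> W F \<longrightarrow>
               (\<forall>\<theta>\<in>\<E> \<inter> W.
                  residual_polarisation Q E pr \<E> \<theta> = tangent_to J \<E> \<theta> \<inter> vertical_space Q E pr \<theta> \<and>
                  tangent_to J \<E> \<theta> \<inter> vertical_space Q E pr \<theta> = symbol_ker Q E pr F \<theta>)))
       \<and> ((\<forall>\<theta>\<in>carrier_of J. tdim J \<theta> (vertical_space Q E pr \<theta>) = q) \<longrightarrow>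
            (locally_section_graph J J' (jet_proj Q E pr (r - 1)) \<E> \<longleftrightarrow>
               (\<forall>\<theta>\<in>\<E>. tangent_to J \<E> \<theta> \<inter> vertical_space Q E pr \<theta> = {zero_tvec})))"
proof -
  note r = assms(1) and q = assms(2) and J = assms(4) and J' = assms(5)
  interpret adapted_charts Q E pr
    using assms(3) unfolding fibred_manifold_def
    by unfold_locales (blast intro: smooth_manifold_imp_smooth_atlas)+
  have A: "smooth_atlas J" unfolding J by (rule smooth_atlas_jet_atlas)
  have pde: "\<exists>W (F :: ('b, 'e) jet \<Rightarrow> real^'q). \<theta> \<in> \<E> \<inter> W \<and> local_defining_map J \<E> W F" if "\<theta> \<in> \<E>" for \<theta>
    using assms(6) that unfolding regular_pde_def pde_def J by blast
  let ?transversal = "\<lambda>\<theta>. tvec_sum (tangent_to J \<E> \<theta>) (vertical_space Q E pr \<theta>) = tangent_space J \<theta>"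
  have chart: "\<exists>C. C \<in> charts_at J \<theta>"
    if "local_defining_map J \<E> W F" "\<theta> \<in> \<E> \<inter> W" for W \<theta> and F :: "('b, 'e) jet \<Rightarrow> real^'q"
    using that unfolding local_defining_map_def atlas_open_def carrier_of_def charts_at_def by blast
  have in_chart: "\<exists>C L. C \<in> charts_at J \<theta> \<and> L = frechet_derivative (\<lambda>z. F (param C z)) (at (coord C \<theta>)) \<and>
      (?transversal \<theta> \<longleftrightarrow> L ` {w. truncate w = 0} = UNIV) \<and>
      (symbol_rank TYPE('r) Q E pr F \<theta> = q \<longleftrightarrow> L ` {w. truncate w = 0} = UNIV)"
    if F: "local_defining_map J \<E> W F" and \<theta>: "\<theta> \<in> \<E> \<inter> W" for W \<theta> and F :: "('b, 'e) jet \<Rightarrow> real^'q"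
  proof -
    obtain C where C: "C \<in> charts_at J \<theta>" using chart[OF F \<theta>] by blast
    obtain L where L: "L = frechet_derivative (\<lambda>z. F (param C z)) (at (coord C \<theta>))" "linear L" "range L = UNIV"
      and dF: "\<And>v. v \<in> tangent_space J \<theta> \<Longrightarrow> differential J F \<theta> v = L (v C)"
      using local_defining_map_in_chart[OF A F \<theta> C] by metis
    show ?thesis
      using transversal_iff_symbol_onto[OF J F \<theta> C L(2,3) dF] C L(1) q by blast
  qed
  have equiv: "?transversal \<theta> \<longleftrightarrow> symbol_rank TYPE('r) Q E pr F \<theta> = q"
    if "local_defining_map J \<E> W F" "\<theta> \<in> \<E> \<inter> W" for W \<theta> and F :: "('b, 'e) jet \<Rightarrow> real^'q"
    using in_chart[OF that] by metis
  have rank: "(\<forall>\<theta>\<in>\<E>. ?transversal \<theta>) \<longleftrightarrow>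
    (\<forall>W (F :: ('b, 'e) jet \<Rightarrow> real^'q). local_defining_map J \<E> W F \<longrightarrow>
      (\<forall>\<theta>\<in>\<E> \<inter> W. symbol_rank TYPE('r) Q E pr F \<theta> = q))"
  proof (intro iffI allI impI ballI)
    fix W \<theta> and F :: "('b, 'e) jet \<Rightarrow> real^'q"
    assume "\<forall>\<theta>\<in>\<E>. ?transversal \<theta>" "local_defining_map J \<E> W F" "\<theta> \<in> \<E> \<inter> W"
    then show "symbol_rank TYPE('r) Q E pr F \<theta> = q" using equiv[of W F \<theta>] by simp
  next
    fix \<theta>
    assume all: "\<forall>W (F :: ('b, 'e) jet \<Rightarrow> real^'q). local_defining_map J \<E> W F \<longrightarrow>
        (\<forall>\<theta>\<in>\<E> \<inter> W. symbol_rank TYPE('r) Q E pr F \<theta> = q)" and \<theta>: "\<theta> \<in> \<E>"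
    obtain W and F :: "('b, 'e) jet \<Rightarrow> real^'q" where F: "\<theta> \<in> \<E> \<inter> W" "local_defining_map J \<E> W F"
      using pde[OF \<theta>] by blast
    show "?transversal \<theta>" using equiv[OF F(2,1)] all[rule_format, OF F(2,1)] by simp
  qed
  have normal: "locally_normal_form TYPE('r option) q Q E pr \<E> \<longleftrightarrow> (\<forall>\<theta>\<in>\<E>. ?transversal \<theta>)"
  proof
    assume nf: "locally_normal_form TYPE('r option) q Q E pr \<E>"
    show "\<forall>\<theta>\<in>\<E>. ?transversal \<theta>"
    proof
      fix \<theta> assume \<theta>: "\<theta> \<in> \<E>"
      obtain bc and S :: "(('n, 'r option) mindex \<times> 'm) set" and W D h where bc: "bc \<in> adapted Q E pr"
        and S: "\<forall>(I, \<alpha>)\<in>S. deg I = CARD('r option) - 1"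
        and W: "atlas_open J W" "\<theta> \<in> W" "W \<subseteq> dom_ch (jet_chart Q E pr bc :: (('b, 'e) jet, ('n, 'm, 'r option) jet_space) chart)"
        and D: "open D" "drop_coords S ` coord (jet_chart Q E pr bc) ` W \<subseteq> D"
        and h: "\<forall>(I, \<alpha>)\<in>S. smooth_on D (h I \<alpha> :: ('n, 'm, 'r option) jet_space \<Rightarrow> real)"
        and eq: "\<E> \<inter> W = {\<eta> \<in> W. \<forall>(I, \<alpha>)\<in>S. snd (coord (jet_chart Q E pr bc) \<eta>) $ I $ \<alpha>
            = h I \<alpha> (drop_coords S (coord (jet_chart Q E pr bc) \<eta>))}"
        using nf[unfolded locally_normal_form_def Let_def, THEN bspec, OF \<theta>] unfolding J[symmetric]
        by (elim bexE exE conjE)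
      have S': "\<forall>(I, \<alpha>)\<in>S. deg I = CARD('r)" using S by simp
      have CJ: "jet_chart Q E pr bc \<in> J" unfolding J jet_atlas_def using bc by (rule imageI)
      have "tangent_space J \<theta> \<subseteq> tvec_sum (tangent_to J \<E> \<theta>) (vertical_space Q E pr \<theta>)"
        by (rule normal_form_imp_transversal[OF J CJ \<theta> S' W D h eq])
      moreover have "tvec_sum (tangent_to J \<E> \<theta>) (vertical_space Q E pr \<theta>) \<subseteq> tangent_space J \<theta>"
      proof -
        have C: "jet_chart Q E pr bc \<in> charts_at J \<theta>" using CJ W(2,3) unfolding charts_at_def by blast
        then show ?thesis
          unfolding tvec_sum_def
          using tangent_to_iff_curve[OF A C] vertical_space_iff[OF J C] tangent_space_add[OF A]
          by (intro subsetI) (elim CollectE bexE, simp)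
      qed
      ultimately show "?transversal \<theta>" by blast
    qed
  next
    assume tr: "\<forall>\<theta>\<in>\<E>. ?transversal \<theta>"
    show "locally_normal_form TYPE('r option) q Q E pr \<E>"
      unfolding locally_normal_form_def Let_def J[symmetric]
    proof
      fix \<theta> assume \<theta>: "\<theta> \<in> \<E>"
      obtain W and F :: "('b, 'e) jet \<Rightarrow> real^'q" where F: "\<theta> \<in> \<E> \<inter> W" "local_defining_map J \<E> W F"
        using pde[OF \<theta>] by blast
      obtain C where C: "C \<in> charts_at J \<theta>"
        "frechet_derivative (\<lambda>z. F (param C z)) (at (coord C \<theta>)) ` {w. truncate w = 0} = UNIV"
        using in_chart[OF F(2,1)] tr \<theta> by blast
      obtain bc where bc: "bc \<in> adapted Q E pr" "C = jet_chart Q E pr bc"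
        using charts_at_in(1)[OF C(1)] unfolding J jet_atlas_def by blast
      have r': "CARD('r option) - 1 = CARD('r)" by simp
      show "\<exists>bc\<in>adapted Q E pr. \<exists>(S :: (('n, 'r option) mindex \<times> 'm) set) W D h.
        card S = q \<and> (\<forall>(I, \<alpha>)\<in>S. deg I = CARD('r option) - 1) \<and>
        atlas_open J W \<and> \<theta> \<in> W \<and> W \<subseteq> dom_ch (jet_chart Q E pr bc :: (('b, 'e) jet, ('n, 'm, 'r option) jet_space) chart) \<and>
        open D \<and> drop_coords S ` coord (jet_chart Q E pr bc) ` W \<subseteq> D \<and>
        (\<forall>(I, \<alpha>)\<in>S. smooth_on D (h I \<alpha> :: ('n, 'm, 'r option) jet_space \<Rightarrow> real)) \<and>
        \<E> \<inter> W = {\<eta> \<in> W. \<forall>(I, \<alpha>)\<in>S. snd (coord (jet_chart Q E pr bc) \<eta>) $ I $ \<alpha>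
          = h I \<alpha> (drop_coords S (coord (jet_chart Q E pr bc) \<eta>))}"
        using symbol_onto_imp_normal_form[OF J F(2,1) C] unfolding r' q bc(2) by (rule bexI[OF _ bc(1)])
    qed
  qed
  have ker: "tangent_to J \<E> \<theta> \<inter> vertical_space Q E pr \<theta> = symbol_ker Q E pr F \<theta>"
    if F: "local_defining_map J \<E> W F" and \<theta>: "\<theta> \<in> \<E> \<inter> W" for W \<theta> and F :: "('b, 'e) jet \<Rightarrow> real^'q"
  proof -
    obtain C where C: "C \<in> charts_at J \<theta>" using chart[OF F \<theta>] by blast
    show ?thesis
      unfolding symbol_ker_def tangent_to_eq_ker_differential[OF A F \<theta> C] J[symmetric]
      using vertical_space_iff[OF J C] by blast
  qed
  have graph: "locally_section_graph J J' (jet_proj Q E pr (r - 1)) \<E> \<longleftrightarrow>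
      (\<forall>\<theta>\<in>\<E>. tangent_to J \<E> \<theta> \<inter> vertical_space Q E pr \<theta> = {zero_tvec})"
    if rk: "\<forall>\<theta>\<in>carrier_of J. tdim J \<theta> (vertical_space Q E pr \<theta>) = q"
  proof
    assume g: "locally_section_graph J J' (jet_proj Q E pr (r - 1)) \<E>"
    show "\<forall>\<theta>\<in>\<E>. tangent_to J \<E> \<theta> \<inter> vertical_space Q E pr \<theta> = {zero_tvec}"
    proof
      fix \<theta> assume \<theta>: "\<theta> \<in> \<E>"
      obtain W and F :: "('b, 'e) jet \<Rightarrow> real^'q" where F: "\<theta> \<in> \<E> \<inter> W" "local_defining_map J \<E> W F"
        using pde[OF \<theta>] by blast
      obtain C where C: "C \<in> charts_at J \<theta>" using chart[OF F(2,1)] by blast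
      obtain L where L: "linear L" "\<And>v. v \<in> tangent_space J \<theta> \<Longrightarrow> differential J F \<theta> v = L (v C)"
        using local_defining_map_in_chart[OF A F(2,1) C] by metis
      note z = zero_tvec_in[OF A, of \<theta>]
      have z0: "(zero_tvec :: (('b, 'e) jet, ('n, 'm, 'r option) jet_space) tvec) C = 0" by (simp add: zero_tvec_def)
      have "zero_tvec \<in> tangent_to J \<E> \<theta>"
        unfolding tangent_to_eq_ker_differential[OF A F(2,1) C] using z L z0 linear_0[OF L(1)] by simp
      moreover have "(zero_tvec :: (('b, 'e) jet, ('n, 'm, 'r option) jet_space) tvec) \<in> vertical_space Q E pr \<theta>"
        unfolding vertical_space_iff[OF J C] using z z0 linear_0[OF linear_truncate] by simp
      moreover have "v = zero_tvec" if "v \<in> tangent_to J \<E> \<theta>" "v \<in> vertical_space Q E pr \<theta>" for v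
        using section_graph_imp_no_vertical[OF J J' _ \<theta> that] g r by blast
      ultimately show "tangent_to J \<E> \<theta> \<inter> vertical_space Q E pr \<theta> = {zero_tvec}" by blast
    qed
  next
    assume triv: "\<forall>\<theta>\<in>\<E>. tangent_to J \<E> \<theta> \<inter> vertical_space Q E pr \<theta> = {zero_tvec}"
    show "locally_section_graph J J' (jet_proj Q E pr (r - 1)) \<E>"
      unfolding locally_section_graph_def
    proof
      fix \<theta> assume \<theta>: "\<theta> \<in> \<E>"
      obtain W and F :: "('b, 'e) jet \<Rightarrow> real^'q" where F: "\<theta> \<in> \<E> \<inter> W" "local_defining_map J \<E> W F"
        using pde[OF \<theta>] by blast
      have "\<theta> \<in> carrier_of J" using F unfolding local_defining_map_def atlas_open_def by blast
      then have "dim {w :: ('n, 'm, 'r option) jet_space. truncate w = 0} = CARD('q)"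
        using rk tdim_vertical_space[OF J] q by metis
      from no_vertical_imp_section_graph[OF J J' F(2,1) this] triv \<theta>
      show "\<exists>W V s. atlas_open J W \<and> \<theta> \<in> W \<and> atlas_open J' V \<and> smooth_map J' J V s \<and>
          (\<forall>y\<in>V. jet_proj Q E pr (r - 1) (s y) = y) \<and> \<E> \<inter> W = s ` V"
        unfolding r by blast
    qed
  qed
  show ?thesis
    unfolding residual_polarisation_def J[symmetric]
    by (intro conjI normal rank impI allI ballI refl) (rule ker graph, assumption+)+
qed

end
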